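(* Let $P\subseteq\mathbb{R}^m$ be a full-dimensional convex lattice polytope, $n,k\ge1$, $\mathbf{a}'\in\mathbb{Z}^m$. For $d\in\mathbb{N}$, let $F_d=[v^n: v\in dP\cap\mathbb{Z}^m]$ be the color rule (each lattice point of $dP$ a color of multiplicity $n$) with value $p(v)=|v|$ (sum of coordinates) and weight $\rho(v)=q^{\mathbf{a}'\cdot v}$, and let $\chi^{F_d}$ be the class function given by this color rule. Then \[ \chi^{\mathbb{C}[P^{\times n}]}=\sum_{d\ge0}t^d\chi^{\mathbb{C}[P^{\times n}]_d}=\sum_{d\ge0}t^d\chi^{F_d}, \] and for every $\vec\gamma\vdash_k n$, \[ \langle\chi^{\mathbb{C}[P^{\times n}]},\chi^{\vec\gamma}\rangle=\sum_{d\ge0}t^d\sum_{T\in\mathrm{SSYT}_k(\vec\gamma,F_d)}\rho(T). \]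
   Context: $u_j=e^{2\pi ij/k}$. $Z_k\wr S_n$: $n\times n$ matrices with one nonzero entry per row and column, entries in $\{u_0,\dots,u_{k-1}\}$; for $\sigma$, $u(\sigma,i)$ is the entry of row $i$, lying in column $\sigma_i$; cycles are those of $i\mapsto\sigma_i$, the C-type of a cycle $(i_1,\dots,i_r)$ is $\prod u(\sigma,i_l)$. $\mathbb{C}[P^{\times n}]\subseteq\mathbb{C}[t,x_{1,1}^{\pm1},\dots,x_{n,m}^{\pm1}]$ is spanned by monomials $t^d\prod_{i,j}x_{i,j}^{\pi_j(v_i)}$, $d\in\mathbb{N}$, $v_i\in dP\cap\mathbb{Z}^m$, with projective degree $d$ and combinatorial degree $\sum_i\mathbf{a}'\cdot v_i$; $\mathbb{C}[P^{\times n}]_d$ is the projective degree $d$ piece (graded by combinatorial degree, recorded by $q$). $\sigma$ acts by fixing $t$ and $x_{i,j}\mapsto u(\sigma,i)x_{\sigma_i,j}$, extended multiplicatively and linearly. Characters are bigraded: $\chi^{M}(\sigma)=\sum_{d,e}\operatorname{tr}(\sigma|_{M_{d,e}})t^dq^e$. Color rules: a coloring of $\sigma$ by a multiset $F$ of colors assigns a color $f_{r_i}$ to each index $i$ such that the multiset of assigned colors is contained in $F$ and indices in the same cycle get the same color; $\chi^F(\sigma)=\sum_{\text{colorings}}\prod_{i}u(\sigma,i)^{p(f_{r_i})}\rho(f_{r_i})$. Irreducible characters $\chi^{\vec\gamma}$, $\vec\gamma=(\gamma^0,\dots,\gamma^{k-1})$ a $k$-tuple of partitions of total size $n$: for $\sigma$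 with cycle lengths $\alpha_1,\dots,\alpha_l$ and C-types $a_1,\dots,a_l$, $\chi^{\vec\gamma}(\sigma)=\sum\prod_s a_s^{j_s}(-1)^{\mathrm{ht}(\zeta_s)}$ over all ways of successively removing border strips $\zeta_s$ of size $\alpha_s$ from a single component $j_s$ until empty ($\mathrm{ht}$ = rows minus one). $\langle\chi,\psi\rangle=\frac1{n!k^n}\sum_\sigma\chi(\sigma)\overline{\psi(\sigma)}$ (conjugation applied only to the values of $\psi$). $\mathrm{SSYT}_k(\vec\gamma,F)$: fix a total order on the distinct colors; $F_r$ is the submultiset of colors with $p\equiv r\pmod k$; the set consists of tuples of fillings of $\gamma^0,\dots,\gamma^{k-1}$ by colors, rows weakly increasing, columns strictly increasing, with the entries of the filling of $\gamma^r$ forming a submultiset of $F_r$; $\rho(T)=\prod_f\rho(f)^{a_f}$ where $a_f$ is the number of occurrences of $f$ in $T$. *)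

theory Defs
  imports
    "HOL-Analysis.Analysis"
    "HOL-Computational_Algebra.Formal_Power_Series"
    "HOL-Combinatorics.Orbits"
    "HOL-Library.Multiset"
    "HOL-Library.Poly_Mapping"
    "HOL-Number_Theory.Cong"
    "Jordan_Normal_Form.Matrix"
begin

no_notation vec_index (infixl "$" 100)

section \<open>Coefficient rings\<close>

text \<open>
  The monoid algebra \<^typ>\<open>int \<Rightarrow>\<^sub>0 complex\<close> is the ring of Laurent polynomials in \<open>q\<close>, and a formal
  sum \<open>\<Sum>d. t^d * c d\<close> with such coefficients is \<^term>\<open>Abs_fps c\<close>.
\<close>

type_synonym qpoly = "int \<Rightarrow>\<^sub>0 complex"

definition qpow :: "int \<Rightarrow> qpoly" where
  "qpow e = Poly_Mapping.single e 1"

definition qconst :: "complex \<Rightarrow> qpoly" where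
  "qconst c = Poly_Mapping.single 0 c"

section \<open>The wreath product of a cyclic group with a symmetric group\<close>

text \<open>Rows and columns are numbered from \<open>0\<close>.\<close>

definition unit_root :: "nat \<Rightarrow> nat \<Rightarrow> complex" where
  "unit_root k j = exp (2 * of_real pi * \<i> * of_nat j / of_nat k)"

definition wreath :: "nat \<Rightarrow> nat \<Rightarrow> complex mat set" where
  "wreath k n = {A \<in> carrier_mat n n.
     (\<forall>i<n. \<exists>!j. j < n \<and> A $$ (i, j) \<noteq> 0) \<and>
     (\<forall>j<n. \<exists>!i. i < n \<and> A $$ (i, j) \<noteq> 0) \<and>
     (\<forall>i<n. \<forall>j<n. A $$ (i, j) \<noteq> 0 \<longrightarrow> A $$ (i, j) \<in> unit_root k ` {..<k})}"

text \<open>Both functions are extended trivially to indices beyond the size of the matrix.\<close>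

definition perm_of :: "complex mat \<Rightarrow> nat \<Rightarrow> nat" where
  "perm_of A i = (if i < dim_row A then THE j. j < dim_col A \<and> A $$ (i, j) \<noteq> 0 else i)"

definition entry_of :: "complex mat \<Rightarrow> nat \<Rightarrow> complex" where
  "entry_of A i = (if i < dim_row A then A $$ (i, perm_of A i) else 1)"

definition cycles_of :: "complex mat \<Rightarrow> nat set set" where
  "cycles_of A = orbit (perm_of A) ` {..<dim_row A}"

definition C_type :: "complex mat \<Rightarrow> nat set \<Rightarrow> complex" where
  "C_type A c = (\<Prod>i\<in>c. entry_of A i)"

text \<open>
  The cycles are enumerated by increasing smallest element. The character formula below refers to
  an enumeration, but its value does not depend on which one is used.
\<close>

definition cycle_list :: "complex mat \<Rightarrow> nat set list" where
  "cycle_list A = map (orbit (perm_of A)) (sorted_list_of_set (Min ` cycles_of A))"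

definition class_inner ::
  "nat \<Rightarrow> nat \<Rightarrow> (complex mat \<Rightarrow> qpoly fps) \<Rightarrow> (complex mat \<Rightarrow> complex) \<Rightarrow> qpoly fps" where
  "class_inner k n \<phi> \<psi> =
     fps_const (qconst (1 / (fact n * of_nat k ^ n))) *
     (\<Sum>\<sigma>\<in>wreath k n. \<phi> \<sigma> * fps_const (qconst (cnj (\<psi> \<sigma>))))"

section \<open>Lattice polytopes and their lattice points\<close>

definition real_vec :: "int ^ 'm \<Rightarrow> real ^ 'm" where
  "real_vec v = (\<chi> j. of_int (v $ j))"

definition lattice_polytope :: "(real ^ 'm) set \<Rightarrow> bool" where
  "lattice_polytope P \<longleftrightarrow> (\<exists>V. finite V \<and> P = convex hull (real_vec ` V))"

definition lattice_points :: "(real ^ 'm) set \<Rightarrow> nat \<Rightarrow> (int ^ 'm) set" where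
  "lattice_points P d = {v. real_vec v \<in> (\<lambda>x. real d *\<^sub>R x) ` P}"

definition int_dot :: "int ^ 'm \<Rightarrow> int ^ 'm \<Rightarrow> int" where
  "int_dot a v = (\<Sum>j\<in>UNIV. a $ j * v $ j)"

definition coord_sum :: "int ^ 'm \<Rightarrow> int" where
  "coord_sum v = (\<Sum>j\<in>UNIV. v $ j)"

section \<open>The bigraded algebra of a product of copies of a polytope\<close>

text \<open>
  An exponent \<open>(d, e)\<close> stands for the monomial in which \<open>t\<close> has exponent \<open>d\<close> and the invertible
  variable indexed by \<open>(i, j)\<close> has exponent \<open>lookup e (i, j)\<close>. There are infinitely many row
  indices \<open>i\<close>; the algebra for \<open>n\<close> copies only involves those below \<open>n\<close>.
\<close>

type_synonym 'm exponent = "nat \<times> ((nat \<times> 'm) \<Rightarrow>\<^sub>0 int)"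
type_synonym 'm laurent = "'m exponent \<Rightarrow>\<^sub>0 complex"

definition lscale :: "complex \<Rightarrow> 'm laurent \<Rightarrow> 'm laurent" where
  "lscale c f = Poly_Mapping.single 0 c * f"

interpretation laurent: vector_space lscale
  by unfold_locales
    (simp_all add: lscale_def distrib_left distrib_right single_add mult_single
      flip: mult.assoc)

definition t_var :: "'m laurent" where
  "t_var = Poly_Mapping.single (1, 0) 1"

definition x_pow :: "nat \<Rightarrow> 'm \<Rightarrow> int \<Rightarrow> 'm laurent" where
  "x_pow i j z = Poly_Mapping.single (0, Poly_Mapping.single (i, j) z) 1"

definition point_monomial :: "nat \<Rightarrow> nat \<Rightarrow> (nat \<Rightarrow> int ^ 'm) \<Rightarrow> ('m::finite) laurent" where
  "point_monomial n d v = t_var ^ d * (\<Prod>i<n. \<Prod>j\<in>UNIV. x_pow i j (v i $ j))"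

definition poly_algebra :: "(real ^ 'm) set \<Rightarrow> nat \<Rightarrow> ('m::finite) laurent set" where
  "poly_algebra P n =
     laurent.span {point_monomial n d v | d v. \<forall>i<n. v i \<in> lattice_points P d}"

definition proj_degree :: "'m exponent \<Rightarrow> nat" where
  "proj_degree m = fst m"

definition comb_degree :: "int ^ 'm \<Rightarrow> nat \<Rightarrow> ('m::finite) exponent \<Rightarrow> int" where
  "comb_degree a n m = (\<Sum>i<n. int_dot a (\<chi> j. Poly_Mapping.lookup (snd m) (i, j)))"

definition proj_piece :: "'m laurent set \<Rightarrow> nat \<Rightarrow> 'm laurent set" where
  "proj_piece M d = {f \<in> M. \<forall>m\<in>Poly_Mapping.keys f. proj_degree m = d}"

definition comb_piece ::
  "int ^ 'm \<Rightarrow> nat \<Rightarrow> ('m::finite) laurent set \<Rightarrow> int \<Rightarrow> 'm laurent set" where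
  "comb_piece a n M e = {f \<in> M. \<forall>m\<in>Poly_Mapping.keys f. comb_degree a n m = e}"

text \<open>
  The multiplicative and linear extension of fixing \<open>t\<close> and sending the variable indexed by
  \<open>(i, j)\<close> to \<open>entry_of \<sigma> i\<close> times the variable indexed by \<open>(perm_of \<sigma> i, j)\<close>.
\<close>

definition act_monomial :: "complex mat \<Rightarrow> 'm exponent \<Rightarrow> 'm laurent" where
  "act_monomial \<sigma> m =
     t_var ^ fst m *
     (\<Prod>(i, j)\<in>Poly_Mapping.keys (snd m).
        lscale (entry_of \<sigma> i powi Poly_Mapping.lookup (snd m) (i, j))
          (x_pow (perm_of \<sigma> i) j (Poly_Mapping.lookup (snd m) (i, j))))"

definition act :: "complex mat \<Rightarrow> 'm laurent \<Rightarrow> 'm laurent" where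
  "act \<sigma> f = (\<Sum>m\<in>Poly_Mapping.keys f. lscale (Poly_Mapping.lookup f m) (act_monomial \<sigma> m))"

text \<open>
  Meaningful for a finite-dimensional subspace \<open>M\<close> that the linear map \<open>\<phi>\<close> preserves; the value
  does not depend on the basis.
\<close>

definition trace_on :: "'m laurent set \<Rightarrow> ('m laurent \<Rightarrow> 'm laurent) \<Rightarrow> complex" where
  "trace_on M \<phi> =
     (let B = (SOME B. laurent.independent B \<and> laurent.span B = M)
      in \<Sum>b\<in>B. laurent.representation B (\<phi> b) b)"

text \<open>
  Only finitely many combinatorial degrees \<open>e\<close> contribute when \<open>M\<close> is finite-dimensional, so the
  finite-support sum \<^const>\<open>Sum_any\<close> is the intended one.
\<close>

definition graded_char ::
  "int ^ 'm \<Rightarrow> nat \<Rightarrow> ('m::finite) laurent set \<Rightarrow> complex mat \<Rightarrow> qpoly" where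
  "graded_char a n M \<sigma> = Sum_any (\<lambda>e. qconst (trace_on (comb_piece a n M e) (act \<sigma>)) * qpow e)"

definition bigraded_char ::
  "int ^ 'm \<Rightarrow> nat \<Rightarrow> ('m::finite) laurent set \<Rightarrow> complex mat \<Rightarrow> qpoly fps" where
  "bigraded_char a n M \<sigma> =
     Abs_fps (\<lambda>d. Sum_any (\<lambda>e.
       qconst (trace_on (comb_piece a n (proj_piece M d) e) (act \<sigma>)) * qpow e))"

section \<open>Color rules\<close>

definition colorings :: "nat \<Rightarrow> 'c multiset \<Rightarrow> complex mat \<Rightarrow> (nat \<Rightarrow> 'c) set" where
  "colorings n F \<sigma> = {f \<in> {..<n} \<rightarrow>\<^sub>E set_mset F.
     image_mset f (mset_set {..<n}) \<subseteq># F \<and>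
     (\<forall>c\<in>cycles_of \<sigma>. \<forall>i\<in>c. \<forall>j\<in>c. f i = f j)}"

definition color_char ::
  "nat \<Rightarrow> 'c multiset \<Rightarrow> ('c \<Rightarrow> int) \<Rightarrow> ('c \<Rightarrow> qpoly) \<Rightarrow> complex mat \<Rightarrow> qpoly" where
  "color_char n F p \<rho> \<sigma> =
     (\<Sum>f\<in>colorings n F \<sigma>. \<Prod>i<n. qconst (entry_of \<sigma> i powi p (f i)) * \<rho> (f i))"

definition polytope_colors :: "(real ^ 'm) set \<Rightarrow> nat \<Rightarrow> nat \<Rightarrow> (int ^ 'm) multiset" where
  "polytope_colors P n d = (\<Sum>v\<in>lattice_points P d. replicate_mset n v)"

section \<open>Partitions, border strips and irreducible characters\<close>

definition is_partition :: "nat list \<Rightarrow> bool" where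
  "is_partition l \<longleftrightarrow> sorted_wrt (\<ge>) l \<and> 0 \<notin> set l"

definition is_multipartition :: "nat \<Rightarrow> nat \<Rightarrow> nat list list \<Rightarrow> bool" where
  "is_multipartition k n g \<longleftrightarrow>
     length g = k \<and> (\<forall>l\<in>set g. is_partition l) \<and> (\<Sum>l\<leftarrow>g. sum_list l) = n"

text \<open>A cell is a pair of a row and a column index.\<close>

definition diagram :: "nat list \<Rightarrow> (nat \<times> nat) set" where
  "diagram l = {(r, c). r < length l \<and> c < l ! r}"

definition adjacent :: "nat \<times> nat \<Rightarrow> nat \<times> nat \<Rightarrow> bool" where
  "adjacent x y \<longleftrightarrow>
     (fst x = fst y \<and> (snd y = Suc (snd x) \<or> snd x = Suc (snd y))) \<or>
     (snd x = snd y \<and> (fst y = Suc (fst x) \<or> fst x = Suc (fst y)))"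

definition edge_connected :: "(nat \<times> nat) set \<Rightarrow> bool" where
  "edge_connected S \<longleftrightarrow>
     (\<forall>x\<in>S. \<forall>y\<in>S. (x, y) \<in> {(u, v). u \<in> S \<and> v \<in> S \<and> adjacent u v}\<^sup>*)"

text \<open>Removing the border strip \<open>z\<close> from the partition \<open>l\<close> leaves the partition \<open>l'\<close>.\<close>

definition strip_removal :: "nat list \<Rightarrow> (nat \<times> nat) set \<Rightarrow> nat list \<Rightarrow> bool" where
  "strip_removal l z l' \<longleftrightarrow>
     is_partition l' \<and> diagram l' \<subseteq> diagram l \<and> z = diagram l - diagram l' \<and>
     z \<noteq> {} \<and> edge_connected z \<and>
     (\<nexists>r c. {(r, c), (Suc r, c), (r, Suc c), (Suc r, Suc c)} \<subseteq> z)"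

definition strip_height :: "(nat \<times> nat) set \<Rightarrow> nat" where
  "strip_height z = card (fst ` z) - 1"

text \<open>
  The second argument lists the sizes of the strips in the order of removal; each step of a way
  records the component used and the strip removed from it.
\<close>

fun removal_ways :: "nat list list \<Rightarrow> nat list \<Rightarrow> (nat \<times> (nat \<times> nat) set) list set" where
  "removal_ways g [] = (if \<forall>l\<in>set g. l = [] then {[]} else {})"
| "removal_ways g (s # ss) =
     {(j, z) # w | j z l' w.
        j < length g \<and> strip_removal (g ! j) z l' \<and> card z = s \<and>
        w \<in> removal_ways (g[j := l']) ss}"

definition irr_char :: "nat list list \<Rightarrow> complex mat \<Rightarrow> complex" where
  "irr_char g \<sigma> =
     (let cs = cycle_list \<sigma>
      in \<Sum>w\<in>removal_ways g (map card cs).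
           \<Prod>s<length cs. C_type \<sigma> (cs ! s) ^ fst (w ! s) * (-1) ^ strip_height (snd (w ! s)))"

section \<open>Semistandard tableaux\<close>

definition colors_mod :: "nat \<Rightarrow> ('c \<Rightarrow> int) \<Rightarrow> 'c multiset \<Rightarrow> nat \<Rightarrow> 'c multiset" where
  "colors_mod k p F r = {#f \<in># F. [p f = int r] (mod int k)#}"

text \<open>\<open>R\<close> is the chosen total order on the colors, as a reflexive relation.\<close>

definition SSYT ::
  "nat \<Rightarrow> ('c \<times> 'c) set \<Rightarrow> ('c \<Rightarrow> int) \<Rightarrow> nat list list \<Rightarrow> 'c multiset
    \<Rightarrow> (nat \<Rightarrow> nat \<times> nat \<Rightarrow> 'c) set" where
  "SSYT k R p g F =
     {T \<in> (\<Pi>\<^sub>E r\<in>{..<k}. diagram (g ! r) \<rightarrow>\<^sub>E set_mset F). \<forall>r<k.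
        (\<forall>i j j'. (i, j) \<in> diagram (g ! r) \<longrightarrow> (i, j') \<in> diagram (g ! r) \<longrightarrow> j < j' \<longrightarrow>
           (T r (i, j), T r (i, j')) \<in> R) \<and>
        (\<forall>i i' j. (i, j) \<in> diagram (g ! r) \<longrightarrow> (i', j) \<in> diagram (g ! r) \<longrightarrow> i < i' \<longrightarrow>
           (T r (i, j), T r (i', j)) \<in> R \<and> T r (i, j) \<noteq> T r (i', j)) \<and>
        image_mset (T r) (mset_set (diagram (g ! r))) \<subseteq># colors_mod k p F r}"

definition tableau_content ::
  "nat \<Rightarrow> nat list list \<Rightarrow> (nat \<Rightarrow> nat \<times> nat \<Rightarrow> 'c) \<Rightarrow> 'c multiset" where
  "tableau_content k g T = (\<Sum>r<k. image_mset (T r) (mset_set (diagram (g ! r))))"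

definition tableau_weight ::
  "nat \<Rightarrow> ('c \<Rightarrow> qpoly) \<Rightarrow> nat list list \<Rightarrow> (nat \<Rightarrow> nat \<times> nat \<Rightarrow> 'c) \<Rightarrow> qpoly" where
  "tableau_weight k \<rho> g T =
     (\<Prod>f\<in>set_mset (tableau_content k g T). \<rho> f ^ count (tableau_content k g T) f)"

end

theory Submission
  imports Defs "Jordan_Normal_Form.Determinant"
begin

text \<open>
  The action permutes the monomials up to scalars, and the trace of a monomial map is the sum of
  the scalars of the fixed monomials. A monomial is fixed if and only if its lattice points agree
  along the cycles, that is, if and only if it is a coloring.

  For the inner product, averaging over the matrix entries forces the color sitting on a cycle to
  be congruent to the component from which the strip of that cycle is removed. What is left is a
  sum over permutations and removals of border strips of products of signed power sums. Splitting
  off the cycle of the smallest element gives a recursion for it, and a product of Schur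
  polynomials satisfies the same recursion because of
  \<open>|\<lambda>| s_\<lambda> = \<Sum>s. p_s (\<Sum>\<plusminus> s_\<mu>)\<close>, where \<open>\<mu>\<close> runs over the partitions obtained from \<open>\<lambda>\<close> by removing
  a border strip of size \<open>s\<close>. This identity follows from the Jacobi-Trudi determinant by applying
  Newton's identity \<open>m h_m = \<Sum>s. p_s h_(m - s)\<close> in each row: lowering one row index either
  produces two equal rows, or a zero row, or sorts to a smaller partition with a sign.
\<close>

section \<open>Determinants\<close>

text \<open>No division occurs before the final normalisation: grouping permutations by the size of
  the cycle of the smallest element leaves the factor (n - 1)! whatever that size is, and the
  identity for Schur polynomials supplies the missing factor n as the total number of cells. The
  symmetric function identities therefore hold over an arbitrary commutative ring. Every color has
  multiplicity n while at most n indices or cells are to be colored, so the multiset bounds never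
  bind and a color rule reduces to a finite set of colors. The removal order is dictated by
  \<open>cycle_list\<close>, so the recursion has to split off the head of that list. Deleting
  points destroys the initial segment of indices, hence permutations of arbitrary finite sets of
  numbers are treated. Border strips enter through the numbers \<beta> i = lam i - i: these strictly
  decrease, and removing a strip amounts to lowering one of them and sorting again. Rows of length
  zero are allowed, so that all determinants in one identity have the same size L.\<close>

definition row_det :: "nat \<Rightarrow> (nat \<Rightarrow> nat \<Rightarrow> 'a::comm_ring_1) \<Rightarrow> 'a" where
  "row_det L A = Determinant.det (Matrix.mat L L (\<lambda>(i, j). A i j))"

lemma row_det_expand:
  "row_det L A = (\<Sum>p | p permutes {..<L}. of_int (sign p) * (\<Prod>i<L. A i (p i)))"
proof -
  have "row_det L A = (\<Sum>p | p permutes {0..<L}. of_int (sign p) *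
      (\<Prod>i = 0..<L. Matrix.mat L L (\<lambda>(i, j). A i j) $$ (i, p i)))"
    unfolding row_det_def by (rule det_def') auto
  also have "\<dots> = (\<Sum>p | p permutes {0..<L}. of_int (sign p) * (\<Prod>i = 0..<L. A i (p i)))"
  proof (intro sum.cong refl arg_cong2[of _ _ _ _ "(*)"] prod.cong)
    fix p i assume p: "p \<in> {p. p permutes {0..<L}}" and i: "i \<in> {0..<L}"
    then have "p i < L"
      using permutes_in_image[of p "{0..<L}" i] by auto
    with i show "Matrix.mat L L (\<lambda>(i, j). A i j) $$ (i, p i) = A i (p i)"
      by simp
  qed
  finally show ?thesis
    by (simp add: atLeast0LessThan)
qed

lemma row_det_cong:
  assumes "\<And>i j. i < L \<Longrightarrow> j < L \<Longrightarrow> A i j = B i j"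
  shows "row_det L A = row_det L B"
  unfolding row_det_def using assms by (intro arg_cong[of _ _ Determinant.det] cong_mat) auto

lemma row_det_equal_rows:
  assumes "i < L" "i' < L" "i \<noteq> i'" "\<And>j. j < L \<Longrightarrow> A i j = A i' j"
  shows "row_det L A = 0"
  unfolding row_det_def
  by (rule det_identical_rows[of _ L i i']) (use assms in auto)

lemma row_det_zero_row:
  assumes "i < L" "\<And>j. j < L \<Longrightarrow> A i j = 0"
  shows "row_det L A = 0"
  unfolding row_det_expand
proof (intro sum.neutral ballI)
  fix p assume "p \<in> {p. p permutes {..<L}}"
  then have "p i < L"
    using permutes_in_image[of p "{..<L}" i] assms(1) by auto
  then have "(\<Prod>i<L. A i (p i)) = 0"
    using assms by (intro prod_zero) auto
  then show "of_int (sign p) * (\<Prod>i<L. A i (p i)) = 0"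
    by simp
qed

lemma row_det_swap_rows:
  assumes "i < L" "i' < L" "i \<noteq> i'"
  shows "row_det L (\<lambda>r. A (Transposition.transpose i i' r)) = - row_det L A"
proof -
  have p: "Transposition.transpose i i' permutes {0..<L}"
    using assms by (intro permutes_swap_id) auto
  have "row_det L (\<lambda>r. A (Transposition.transpose i i' r)) = Determinant.det (Matrix.mat L L
      (\<lambda>(r, j). Matrix.mat L L (\<lambda>(i, j). A i j) $$ (Transposition.transpose i i' r, j)))"
    unfolding row_det_def
    by (intro arg_cong[of _ _ Determinant.det] cong_mat)
       (use assms in \<open>auto simp: Transposition.transpose_def\<close>)
  also have "\<dots> = of_int (sign (Transposition.transpose i i')) * row_det L A"
    unfolding row_det_def by (rule det_permute_rows) (use p in auto)
  finally show ?thesis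
    using assms by (simp add: sign_swap_id)
qed

text \<open>Multilinearity in all rows at once: each Leibniz product expands into one product per
  choice function \<open>f\<close>, which selects the summand used in every row.\<close>

lemma row_det_rows_sum:
  fixes B :: "nat \<Rightarrow> 'b \<Rightarrow> nat \<Rightarrow> 'a::comm_ring_1"
  assumes "\<And>i. i < L \<Longrightarrow> finite (M i)"
  shows "row_det L (\<lambda>i j. \<Sum>m\<in>M i. c i m * B i m j) =
    (\<Sum>f\<in>Pi\<^sub>E {..<L} M. (\<Prod>i<L. c i (f i)) * row_det L (\<lambda>i. B i (f i)))"
proof -
  have "(\<Prod>i<L. \<Sum>m\<in>M i. c i m * B i m (p i)) =
      (\<Sum>f\<in>Pi\<^sub>E {..<L} M. (\<Prod>i<L. c i (f i)) * (\<Prod>i<L. B i (f i) (p i)))" for p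
    by (subst prod_sum_PiE) (use assms in \<open>auto simp: prod.distrib\<close>)
  then show ?thesis
    unfolding row_det_expand
    by (simp add: sum_distrib_left mult.left_commute) (rule sum.swap)
qed

text \<open>The modified matrix is the product of a unitriangular matrix, with entries
  \<open>- c i\<close> just above the diagonal, and the original one. All subtractions thus use the
  original rows.\<close>

lemma row_det_subtract_next_row:
  "row_det L (\<lambda>i j. A i j - (if Suc i < L then c i * A (Suc i) j else 0)) = row_det L A"
proof -
  define U where "U = Matrix.mat L L (\<lambda>(i, j). if j = i then 1 else if j = Suc i then - c i else 0)"
  define M where "M = Matrix.mat L L (\<lambda>(i, j). A i j)"
  have U: "U \<in> carrier_mat L L" and M: "M \<in> carrier_mat L L"
    by (auto simp: U_def M_def)
  have "diag_mat U = replicate L 1"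
    by (rule nth_equalityI) (auto simp: diag_mat_def U_def)
  moreover have "upper_triangular U"
    unfolding U_def upper_triangular_def by auto
  ultimately have detU: "Determinant.det U = 1"
    using det_upper_triangular[OF _ U] by simp
  have "Matrix.mat L L (\<lambda>(i, j). A i j - (if Suc i < L then c i * A (Suc i) j else 0)) = U * M"
  proof (rule eq_matI)
    fix i j assume ij: "i < dim_row (U * M)" "j < dim_col (U * M)"
    then have ij: "i < L" "j < L" using U M by auto
    \<comment> \<open>In the last row the summand \<open>r = Suc i\<close> falls outside the range,
      which matches the condition \<open>Suc i < L\<close>.\<close>
    have "(U * M) $$ (i, j) = (\<Sum>r<L. (if r = i then A r j else 0) + (if r = Suc i then - c i * A r j else 0))"
      using ij U M unfolding M_def U_def
      by (auto simp: scalar_prod_def atLeast0LessThan intro!: sum.cong)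
    also have "\<dots> = A i j - (if Suc i < L then c i * A (Suc i) j else 0)"
      using ij unfolding sum.distrib by (simp add: sum.delta)
    finally show "Matrix.mat L L (\<lambda>(i, j). A i j - (if Suc i < L then c i * A (Suc i) j else 0)) $$ (i, j) =
        (U * M) $$ (i, j)"
      using ij by simp
  qed (use U M in auto)
  then have "row_det L (\<lambda>i j. A i j - (if Suc i < L then c i * A (Suc i) j else 0)) =
      Determinant.det U * Determinant.det M"
    unfolding row_det_def using det_mult[OF U M] by simp
  then show ?thesis
    by (simp add: detU row_det_def M_def)
qed

section \<open>Complete homogeneous symmetric functions\<close>

text \<open>Complete homogeneous symmetric polynomial evaluated at the list: monomials free of the
  head variable are separated from those divisible by it.\<close>

fun hom_sym :: "'a::comm_ring_1 list \<Rightarrow> nat \<Rightarrow> 'a" where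
  "hom_sym [] m = (if m = 0 then 1 else 0)"
| "hom_sym (x # xs) 0 = 1"
| "hom_sym (x # xs) (Suc m) = hom_sym xs (Suc m) + x * hom_sym (x # xs) m"

text \<open>Jacobi-Trudi determinants rely on the convention that the value at a negative index is
  zero.\<close>

definition hom_sym_int :: "'a::comm_ring_1 list \<Rightarrow> int \<Rightarrow> 'a" where
  "hom_sym_int xs m = (if m < 0 then 0 else hom_sym xs (nat m))"

definition power_sum :: "'a::comm_ring_1 list \<Rightarrow> nat \<Rightarrow> 'a" where
  "power_sum xs s = (\<Sum>x\<leftarrow>xs. x ^ s)"

lemma hom_sym_0 [simp]: "hom_sym xs 0 = 1"
  by (cases xs) auto

lemma hom_sym_int_neg [simp]: "m < 0 \<Longrightarrow> hom_sym_int xs m = 0"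
  by (simp add: hom_sym_int_def)

lemma hom_sym_int_0 [simp]: "hom_sym_int xs 0 = 1"
  by (simp add: hom_sym_int_def)

lemma hom_sym_int_Nil: "hom_sym_int [] m = (if m = 0 then 1 else 0)"
  by (auto simp: hom_sym_int_def)

lemma hom_sym_int_Cons: "hom_sym_int (x # xs) m = hom_sym_int xs m + x * hom_sym_int (x # xs) (m - 1)"
proof (cases "m \<le> 0")
  case True
  then show ?thesis by (cases "m = 0") auto
next
  case False
  then have "nat m = Suc (nat (m - 1))" by auto
  with False show ?thesis by (simp add: hom_sym_int_def)
qed

text \<open>The recursion for the head variable, iterated \<open>k\<close> times; it keeps the first
  \<open>k\<close> terms of the expansion in powers of \<open>x\<close>.\<close>

lemma hom_sym_int_Cons_diff:
  "hom_sym_int (x # xs) m - x ^ k * hom_sym_int (x # xs) (m - int k) = (\<Sum>t<k. x ^ t * hom_sym_int xs (m - int t))"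
proof (induction k)
  case (Suc k)
  have "hom_sym_int (x # xs) (m - int k) = hom_sym_int xs (m - int k) + x * hom_sym_int (x # xs) (m - int (Suc k))"
    by (subst hom_sym_int_Cons) (simp add: algebra_simps)
  with Suc show ?case
    by (simp add: algebra_simps)
qed auto

text \<open>Induction on the variables and then on \<open>m\<close>. A power sum splits as
  \<open>power_sum xs s + x ^ s\<close>; the part involving only the tail is the identity for
  \<open>xs\<close>, and what remains is \<open>x\<close> times \<open>Suc m\<close> copies of
  \<open>hom_sym (x # xs) m\<close>, by the identity for the smaller index.\<close>

lemma newton_hom_sym:
  "of_nat m * hom_sym xs m = (\<Sum>s<m. power_sum xs (Suc s) * hom_sym xs (m - Suc s))"
proof (induction xs arbitrary: m)
  case Nil
  then show ?case by (auto simp: power_sum_def)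
next
  case (Cons x xs)
  let ?H = "hom_sym (x # xs)" and ?h = "hom_sym xs" and ?p = "power_sum xs"
  have H: "?H (Suc m) = ?h (Suc m) + x * ?H m" for m
    by simp
  show ?case
  proof (induction m)
    case 0
    then show ?case by simp
  next
    case (Suc m)
    have "(\<Sum>s<Suc m. power_sum (x # xs) (Suc s) * ?H (Suc m - Suc s)) =
        (\<Sum>s<Suc m. ?p (Suc s) * ?H (m - s)) + (\<Sum>s<Suc m. x ^ Suc s * ?H (m - s))"
      by (simp add: power_sum_def algebra_simps sum.distrib)
    also have "(\<Sum>s<Suc m. x ^ Suc s * ?H (m - s)) =
        x * ?H m + x * (\<Sum>s<m. x ^ Suc s * ?H (m - Suc s))"
      by (subst sum.lessThan_Suc_shift) (simp add: sum_distrib_left mult.assoc)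
    also have "(\<Sum>s<Suc m. ?p (Suc s) * ?H (m - s)) =
        (\<Sum>s<Suc m. ?p (Suc s) * ?h (Suc m - Suc s)) + x * (\<Sum>s<m. ?p (Suc s) * ?H (m - Suc s))"
    proof -
      have "?H (m - s) = ?h (m - s) + x * ?H (m - Suc s)" if "s < m" for s
        using H[of "m - Suc s"] that by (simp add: Suc_diff_Suc)
      then have "(\<Sum>s<m. ?p (Suc s) * ?H (m - s)) =
          (\<Sum>s<m. ?p (Suc s) * ?h (m - s)) + x * (\<Sum>s<m. ?p (Suc s) * ?H (m - Suc s))"
        by (simp add: sum_distrib_left sum.distrib[symmetric] algebra_simps)
      then show ?thesis by (simp add: algebra_simps)
    qed
    also have "(\<Sum>s<Suc m. ?p (Suc s) * ?h (Suc m - Suc s)) = of_nat (Suc m) * ?h (Suc m)"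
      by (rule Cons[symmetric])
    finally have "(\<Sum>s<Suc m. power_sum (x # xs) (Suc s) * ?H (Suc m - Suc s)) =
        of_nat (Suc m) * ?h (Suc m) + x * ?H m +
        x * (\<Sum>s<m. (?p (Suc s) + x ^ Suc s) * ?H (m - Suc s))"
      by (simp only: sum.distrib distrib_left distrib_right add_ac)
    also have "(\<Sum>s<m. (?p (Suc s) + x ^ Suc s) * ?H (m - Suc s)) = of_nat m * ?H m"
      unfolding Suc by (simp add: power_sum_def add_ac)
    finally show ?case
      unfolding H by (simp add: algebra_simps)
  qed
qed

text \<open>The bound \<open>N\<close> is free because terms with a negative index vanish; one
  common \<open>N\<close> can then serve all entries of a matrix.\<close>

lemma newton_hom_sym_int:
  assumes "m \<le> int N"
  shows "of_int m * hom_sym_int xs m = (\<Sum>s<N. power_sum xs (Suc s) * hom_sym_int xs (m - int (Suc s)))"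
proof (cases "m \<ge> 0")
  case True
  then obtain l where l: "m = int l" using nonneg_int_cases by blast
  have "(\<Sum>s<N. power_sum xs (Suc s) * hom_sym_int xs (m - int (Suc s))) =
      (\<Sum>s<l. power_sum xs (Suc s) * hom_sym_int xs (m - int (Suc s)))"
    using assms l by (intro sum.mono_neutral_right) auto
  also have "\<dots> = (\<Sum>s<l. power_sum xs (Suc s) * hom_sym xs (l - Suc s))"
    using l by (intro sum.cong arg_cong2[of _ _ _ _ "(*)"] refl)
      (auto simp: hom_sym_int_def nat_diff_distrib' simp flip: of_nat_Suc)
  finally show ?thesis
    using l newton_hom_sym[of l xs] by (simp add: hom_sym_int_def)
qed (simp add: hom_sym_int_def)

section \<open>Semistandard fillings and the Jacobi-Trudi identity\<close>

text \<open>The conditions that \<open>SSYT\<close> puts on one component, with a set of admissible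
  colors in place of the multiset bound.\<close>

definition fillings :: "('c \<times> 'c) set \<Rightarrow> 'c set \<Rightarrow> (nat \<times> nat) set \<Rightarrow> (nat \<times> nat \<Rightarrow> 'c) set" where
  "fillings R X D = {T \<in> D \<rightarrow>\<^sub>E X.
     (\<forall>i j j'. (i, j) \<in> D \<longrightarrow> (i, j') \<in> D \<longrightarrow> j < j' \<longrightarrow> (T (i, j), T (i, j')) \<in> R) \<and>
     (\<forall>i i' j. (i, j) \<in> D \<longrightarrow> (i', j) \<in> D \<longrightarrow> i < i' \<longrightarrow>
        (T (i, j), T (i', j)) \<in> R \<and> T (i, j) \<noteq> T (i', j))}"

definition schur :: "('c \<times> 'c) set \<Rightarrow> 'c set \<Rightarrow> ('c \<Rightarrow> 'a::comm_ring_1) \<Rightarrow> (nat \<times> nat) set \<Rightarrow> 'a" where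
  "schur R X \<rho> D = (\<Sum>T\<in>fillings R X D. \<Prod>x\<in>D. \<rho> (T x))"

text \<open>Unlike in \<open>diagram\<close>, the number of rows is explicit and rows may be empty,
  so that it can agree with the size of a determinant.\<close>

definition cells :: "nat \<Rightarrow> (nat \<Rightarrow> nat) \<Rightarrow> (nat \<times> nat) set" where
  "cells L lam = {(r, c). r < L \<and> c < lam r}"

lemma cells_Sigma: "cells L lam = (SIGMA r:{..<L}. {..<lam r})"
  by (auto simp: cells_def)

lemma finite_cells [simp]: "finite (cells L lam)"
  by (simp add: cells_Sigma)

text \<open>The shapes left when a horizontal strip is removed: row lengths interlace as
  \<open>lam (Suc i) \<le> mu i \<le> lam i\<close>.\<close>

definition hstrips :: "nat \<Rightarrow> (nat \<Rightarrow> nat) \<Rightarrow> (nat \<Rightarrow> nat) set" where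
  "hstrips L lam = (\<Pi>\<^sub>E i\<in>{..<L}. {(if Suc i < L then lam (Suc i) else 0)..lam i})"

lemma fillings_row:
  "T \<in> fillings R X D \<Longrightarrow> (i, j) \<in> D \<Longrightarrow> (i, j') \<in> D \<Longrightarrow> j < j' \<Longrightarrow> (T (i, j), T (i, j')) \<in> R"
  unfolding fillings_def by blast

lemma fillings_col:
  "T \<in> fillings R X D \<Longrightarrow> (i, j) \<in> D \<Longrightarrow> (i', j) \<in> D \<Longrightarrow> i < i' \<Longrightarrow>
     (T (i, j), T (i', j)) \<in> R \<and> T (i, j) \<noteq> T (i', j)"
  unfolding fillings_def by blast

lemma fillings_mem: "T \<in> fillings R X D \<Longrightarrow> x \<in> D \<Longrightarrow> T x \<in> X"
  unfolding fillings_def by blast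

lemma hstripsD:
  assumes "mu \<in> hstrips L lam" "i < L"
  shows "mu i \<le> lam i" "Suc i < L \<Longrightarrow> lam (Suc i) \<le> mu i"
proof -
  have "i \<in> {..<L}" using assms(2) by simp
  with assms(1) have "mu i \<in> {(if Suc i < L then lam (Suc i) else 0)..lam i}"
    unfolding hstrips_def by (rule PiE_mem)
  then show "mu i \<le> lam i" "Suc i < L \<Longrightarrow> lam (Suc i) \<le> mu i" by auto
qed

lemma finite_hstrips: "finite (hstrips L lam)"
  unfolding hstrips_def by (rule finite_PiE) simp_all

lemma finite_fillings: "finite X \<Longrightarrow> finite D \<Longrightarrow> finite (fillings R X D)"
  unfolding fillings_def by (rule finite_subset[of _ "D \<rightarrow>\<^sub>E X"]) (auto intro: finite_PiE)

text \<open>Branching rule: the cells of the largest color \<open>v\<close> form a horizontal strip,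
  and the other cells carry a semistandard filling of the shape \<open>mu\<close>. The exponent of
  \<open>\<rho> v\<close> in row \<open>i\<close> counts the cells of color \<open>v\<close>
  there.\<close>

lemma schur_insert_max:
  assumes lam: "\<And>i. Suc i < L \<Longrightarrow> lam (Suc i) \<le> lam i"
    and X: "finite X" "v \<notin> X" "\<And>b. b \<in> X \<Longrightarrow> (b, v) \<in> R \<and> (v, b) \<notin> R" and vv: "(v, v) \<in> R"
  shows "schur R (insert v X) \<rho> (cells L lam) =
    (\<Sum>mu\<in>hstrips L lam. (\<Prod>i<L. \<rho> v ^ (lam i - mu i)) * schur R X \<rho> (cells L mu))"
proof -
  have lam': "lam i' \<le> lam i" if "i \<le> i'" "i' < L" for i i'
    using that by (induction i' rule: dec_induct) (auto intro: order_trans lam)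
  define ext :: "(nat \<Rightarrow> nat) \<times> (nat \<times> nat \<Rightarrow> 'a) \<Rightarrow> nat \<times> nat \<Rightarrow> 'a" where
    "ext = (\<lambda>(mu, T) x. if x \<in> cells L mu then T x else if x \<in> cells L lam then v else undefined)"
  define red :: "(nat \<times> nat \<Rightarrow> 'a) \<Rightarrow> (nat \<Rightarrow> nat) \<times> (nat \<times> nat \<Rightarrow> 'a)" where
    "red = (\<lambda>T. let mu = (\<lambda>i. if i < L then card {j. j < lam i \<and> T (i, j) \<noteq> v} else undefined)
       in (mu, restrict T (cells L mu)))"
  let ?S = "SIGMA mu:hstrips L lam. fillings R X (cells L mu)"
  note hs = hstripsD
  have sub: "cells L mu \<subseteq> cells L lam" if "mu \<in> hstrips L lam" for mu
    using hs[OF that] by (fastforce simp: cells_def)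
  have hs': "lam i' \<le> mu i" if "mu \<in> hstrips L lam" "i < i'" "i' < L" for mu i i'
    using hs(2)[OF that(1), of i] lam'[of "Suc i" i'] that(2,3) by linarith
  \<comment> \<open>The entries different from the largest color \<open>v\<close> form an initial segment of every row.\<close>
  have mu_iff: "c < card {j. j < lam i \<and> T (i, j) \<noteq> v} \<longleftrightarrow> c < lam i \<and> T (i, c) \<noteq> v"
    if T: "T \<in> fillings R (insert v X) (cells L lam)" and i: "i < L" for T i c
  proof -
    let ?J = "{j. j < lam i \<and> T (i, j) \<noteq> v}"
    have down: "j \<in> ?J" if "j' \<in> ?J" "j < j'" for j j'
    proof -
      have c: "(i, j) \<in> cells L lam" "(i, j') \<in> cells L lam"
        using i that by (auto simp: cells_def)
      have "T (i, j) = v \<Longrightarrow> False"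
        using fillings_row[OF T c that(2)] fillings_mem[OF T c(2)] X(3) that(1) by auto
      then show ?thesis using that by auto
    qed
    have fin: "finite ?J" by auto
    show ?thesis
    proof
      assume c: "c < card ?J"
      have "\<not> ?J \<subseteq> {..<c}"
        using card_mono[of "{..<c}" ?J] c by auto
      then obtain j where "j \<in> ?J" "j \<notin> {..<c}" by blast
      then have "j \<in> ?J" "c \<le> j" by auto
      then show "c < lam i \<and> T (i, c) \<noteq> v"
        using down[of j c] by (cases "c = j") auto
    next
      assume c: "c < lam i \<and> T (i, c) \<noteq> v"
      then have "c \<in> ?J" by simp
      then have "j \<in> ?J" if "j \<in> {..c}" for j
        using down[of c j] that by (cases "j = c") auto
      then have "{..c} \<subseteq> ?J" by blast
      from card_mono[OF fin this] show "c < card ?J" by simp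
    qed
  qed
  have "schur R (insert v X) \<rho> (cells L lam) =
      (\<Sum>(mu, T)\<in>?S. (\<Prod>i<L. \<rho> v ^ (lam i - mu i)) * (\<Prod>x\<in>cells L mu. \<rho> (T x)))"
    unfolding schur_def
  proof (rule sum.reindex_bij_witness[where i = ext and j = red])
    fix T assume T: "T \<in> fillings R (insert v X) (cells L lam)"
    obtain mu T' where red: "red T = (mu, T')" by fastforce
    then have mu: "mu = (\<lambda>i. if i < L then card {j. j < lam i \<and> T (i, j) \<noteq> v} else undefined)"
      and T': "T' = restrict T (cells L mu)"
      unfolding red_def Let_def by auto
    have cm: "x \<in> cells L mu \<longleftrightarrow> x \<in> cells L lam \<and> T x \<noteq> v" for x
      using mu_iff[OF T] by (cases x) (auto simp: cells_def mu)
    have TE: "T \<in> cells L lam \<rightarrow>\<^sub>E insert v X" using T by (auto simp: fillings_def)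
    show e: "ext (red T) = T"
      using TE unfolding red ext_def
      by (auto simp: fun_eq_iff cm T' PiE_def extensional_def)
    have "mu \<in> hstrips L lam"
      unfolding hstrips_def
    proof (rule PiE_I)
      fix i assume i: "i \<in> {..<L}"
      have "card {j. j < lam i \<and> T (i, j) \<noteq> v} \<le> card {..<lam i}"
        by (rule card_mono) auto
      \<comment> \<open>Otherwise the cell \<open>(i, mu i)\<close> carries \<open>v\<close> and has
        a cell below it, whose color would have to exceed the largest one.\<close>
      moreover have "lam (Suc i) \<le> mu i" if S: "Suc i < L"
      proof (rule ccontr)
        assume "\<not> lam (Suc i) \<le> mu i"
        then have c: "(Suc i, mu i) \<in> cells L lam" "(i, mu i) \<in> cells L lam" "(i, mu i) \<notin> cells L mu"
          using S lam[of i] by (auto simp: cells_def)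
        then have "T (i, mu i) = v" using cm by auto
        moreover have "(T (i, mu i), T (Suc i, mu i)) \<in> R \<and> T (i, mu i) \<noteq> T (Suc i, mu i)"
          using c T by (auto simp: fillings_def)
        moreover have "T (Suc i, mu i) \<in> insert v X" using TE c by auto
        ultimately show False using X by auto
      qed
      ultimately show "mu i \<in> {(if Suc i < L then lam (Suc i) else 0)..lam i}"
        using i by (auto simp: mu)
    qed (auto simp: mu)
    moreover have "T' \<in> fillings R X (cells L mu)"
      using T unfolding fillings_def T' by (auto simp: cm)
    ultimately show "red T \<in> ?S" using red by auto
    have "(\<Prod>x\<in>cells L lam. \<rho> (T x)) =
        (\<Prod>x\<in>cells L lam - cells L mu. \<rho> (T x)) * (\<Prod>x\<in>cells L mu. \<rho> (T x))"
      by (rule prod.subset_diff) (auto simp: cm)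
    also have "(\<Prod>x\<in>cells L lam - cells L mu. \<rho> (T x)) = (\<Prod>x\<in>(SIGMA i:{..<L}. {mu i..<lam i}). \<rho> v)"
    proof (rule prod.cong)
      show "cells L lam - cells L mu = (SIGMA i:{..<L}. {mu i..<lam i})"
        by (auto simp: cells_def)
      then show "\<rho> (T x) = \<rho> v" if "x \<in> (SIGMA i:{..<L}. {mu i..<lam i})" for x
        using that cm[of x] by auto
    qed
    also have "\<dots> = (\<Prod>i<L. \<rho> v ^ (lam i - mu i))"
      using prod.Sigma[of "{..<L}" "\<lambda>i. {mu i..<lam i}" "\<lambda>_ _. \<rho> v"] by simp
    also have "(\<Prod>x\<in>cells L mu. \<rho> (T x)) = (\<Prod>x\<in>cells L mu. \<rho> (T' x))"
      by (rule prod.cong) (auto simp: T')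
    finally show "(case red T of (mu, T) \<Rightarrow>
        (\<Prod>i<L. \<rho> v ^ (lam i - mu i)) * (\<Prod>x\<in>cells L mu. \<rho> (T x))) = (\<Prod>x\<in>cells L lam. \<rho> (T x))"
      by (simp add: red)
  next
    fix y assume y: "y \<in> ?S"
    then obtain mu T where y: "y = (mu, T)" and mu: "mu \<in> hstrips L lam" and T: "T \<in> fillings R X (cells L mu)"
      by auto
    define T' where "T' = ext (mu, T)"
    have T'_in: "x \<in> cells L mu \<Longrightarrow> T' x = T x \<and> T' x \<in> X" for x
      using T by (auto simp: T'_def ext_def fillings_def)
    have T'_out: "x \<in> cells L lam \<Longrightarrow> x \<notin> cells L mu \<Longrightarrow> T' x = v" for x
      by (auto simp: T'_def ext_def)
    have ne: "x \<in> cells L lam \<Longrightarrow> T' x \<noteq> v \<longleftrightarrow> x \<in> cells L mu" for x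
      using T'_in T'_out X by metis
    have cl: "(i, j) \<in> cells L mu" if "(i, j') \<in> cells L mu" "j < j'" for i j j'
      using that by (auto simp: cells_def)
    \<comment> \<open>By interlacing, a cell with another cell of \<open>lam\<close> below it lies
      in \<open>mu\<close>; hence \<open>v\<close> is only placed at the bottom of a column.\<close>
    have cl2: "(i, j) \<in> cells L mu" if "(i', j) \<in> cells L lam" "i < i'" for i i' j
      using that hs'[OF mu, of i i'] by (auto simp: cells_def)
    show "ext y \<in> fillings R (insert v X) (cells L lam)"
      unfolding y T'_def[symmetric] fillings_def
    proof (intro CollectI conjI allI impI)
      show "T' \<in> cells L lam \<rightarrow>\<^sub>E insert v X"
      proof (rule PiE_I)
        show "T' x \<in> insert v X" if "x \<in> cells L lam" for x
          using T'_in[of x] T'_out[of x] that by blast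
        show "T' x = undefined" if "x \<notin> cells L lam" for x
          using that sub[OF mu] by (auto simp: T'_def ext_def)
      qed
    next
      fix i j j' assume a: "(i, j) \<in> cells L lam" "(i, j') \<in> cells L lam" "j < j'"
      show "(T' (i, j), T' (i, j')) \<in> R"
      proof (cases "(i, j') \<in> cells L mu")
        case True
        then show ?thesis
          using cl[OF True a(3)] fillings_row[OF T _ True a(3)] T'_in by auto
      next
        case False
        then show ?thesis
          using T'_out[OF a(2)] T'_in[of "(i, j)"] T'_out[OF a(1)] X vv by metis
      qed
    next
      fix i i' j assume a: "(i, j) \<in> cells L lam" "(i', j) \<in> cells L lam" "i < i'"
      have b: "(i, j) \<in> cells L mu" using cl2 a by auto
      have "(T' (i, j), T' (i', j)) \<in> R \<and> T' (i, j) \<noteq> T' (i', j)"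
      proof (cases "(i', j) \<in> cells L mu")
        case True
        then show ?thesis
          using b fillings_col[OF T b True a(3)] T'_in by auto
      next
        case False
        then show ?thesis
          using T'_out[OF a(2)] T'_in[OF b] X by auto
      qed
      then show "(T' (i, j), T' (i', j)) \<in> R" "T' (i, j) \<noteq> T' (i', j)" by auto
    qed
    have "card {j. j < lam i \<and> T' (i, j) \<noteq> v} = mu i" if "i < L" for i
    proof -
      have "T' (i, j) \<noteq> v \<longleftrightarrow> j < mu i" if "j < lam i" for j
        using ne[of "(i, j)"] that \<open>i < L\<close> by (auto simp: cells_def)
      then have "{j. j < lam i \<and> T' (i, j) \<noteq> v} = {..<mu i}"
        using hs(1)[OF mu that] by (auto intro: less_le_trans)
      then show ?thesis by simp
    qed
    then have "(\<lambda>i. if i < L then card {j. j < lam i \<and> T' (i, j) \<noteq> v} else undefined) = mu"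
      using mu by (auto simp: hstrips_def PiE_def extensional_def)
    moreover have "restrict T' (cells L mu) = T"
    proof
      fix x show "restrict T' (cells L mu) x = T x"
        using T T'_in[of x] by (cases "x \<in> cells L mu") (auto simp: fillings_def)
    qed
    ultimately show "red (ext y) = y"
      unfolding y T'_def[symmetric] red_def Let_def by simp
  qed
  also have "\<dots> = (\<Sum>mu\<in>hstrips L lam. (\<Prod>i<L. \<rho> v ^ (lam i - mu i)) * schur R X \<rho> (cells L mu))"
    unfolding schur_def sum_distrib_left
    by (subst sum.Sigma) (simp_all add: finite_hstrips finite_fillings X)
  finally show ?thesis .
qed

text \<open>Colors in strictly decreasing order, so that the head of the list is the largest color
  and \<open>Cons\<close> matches \<open>schur_insert_max\<close>.\<close>

definition color_list :: "('c \<times> 'c) set \<Rightarrow> 'c list \<Rightarrow> bool" where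
  "color_list R vs \<longleftrightarrow> (\<forall>v\<in>set vs. (v, v) \<in> R) \<and> distinct vs \<and>
     sorted_wrt (\<lambda>v b. (b, v) \<in> R \<and> (v, b) \<notin> R) vs"

lemma color_list_exists:
  assumes "finite X" "linear_order_on X R"
  shows "\<exists>vs. set vs = X \<and> color_list R vs"
proof -
  have R: "\<And>x. x \<in> X \<Longrightarrow> (x, x) \<in> R" "trans R" "antisym R"
    "\<And>x y. x \<in> X \<Longrightarrow> y \<in> X \<Longrightarrow> x \<noteq> y \<Longrightarrow> (x, y) \<in> R \<or> (y, x) \<in> R"
    using assms(2) by (auto simp: order_on_defs refl_on_def total_on_def)
  have mx: "\<exists>v\<in>Y. \<forall>b\<in>Y. (b, v) \<in> R" if "finite Y" "Y \<noteq> {}" "Y \<subseteq> X" for Y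
    using that
  proof (induction Y rule: finite_ne_induct)
    case (singleton y)
    then show ?case using R(1) by auto
  next
    case (insert y Y)
    then obtain v where v: "v \<in> Y" "\<forall>b\<in>Y. (b, v) \<in> R" by auto
    show ?case
    proof (cases "(y, v) \<in> R")
      case True
      then show ?thesis using v by auto
    next
      case False
      then have "(v, y) \<in> R" using R(4)[of v y] R(1)[of y] v insert by auto
      then have "\<forall>b\<in>insert y Y. (b, y) \<in> R"
        using v(2) R(1)[of y] insert(5) transD[OF R(2)] by blast
      then show ?thesis by blast
    qed
  qed
  have "\<exists>vs. set vs = Y \<and> color_list R vs" if "finite Y" "Y \<subseteq> X" for Y
    using that
  proof (induction "card Y" arbitrary: Y)
    case 0
    then show ?case by (auto simp: color_list_def)
  next
    case (Suc c)
    then have "Y \<noteq> {}" by auto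
    from mx[OF Suc(3) this Suc(4)]
    obtain v where v: "v \<in> Y" "\<And>b. b \<in> Y \<Longrightarrow> (b, v) \<in> R" by blast
    have "c = card (Y - {v})" using Suc(2) card_Diff_singleton[OF v(1)] by linarith
    then obtain vs where vs: "set vs = Y - {v}" "color_list R vs"
      using Suc(1)[of "Y - {v}"] Suc(3,4) by blast
    have "(v, b) \<notin> R" if "b \<in> Y - {v}" for b
      using antisymD[OF R(3)] v(2)[of b] that by blast
    with vs v have "color_list R (v # vs)"
      unfolding color_list_def by auto
    moreover have "set (v # vs) = Y" using vs v by auto
    ultimately show ?case by blast
  qed
  with assms(1) show ?thesis by blast
qed

text \<open>Rows and columns are numbered from \<open>0\<close>, which does not affect the index \<open>lam i - i + j\<close>.\<close>

definition jt :: "'a::comm_ring_1 list \<Rightarrow> nat \<Rightarrow> (nat \<Rightarrow> int) \<Rightarrow> 'a" where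
  "jt xs L \<beta> = row_det L (\<lambda>i j. hom_sym_int xs (\<beta> i + int j))"

text \<open>Induction on the colors, showing that the determinant obeys the branching rule: each row
  is reduced by a multiple of the next one, and the result is expanded over the choices of
  \<open>mu\<close>, which are exactly the horizontal strips. Without colors the matrix is the
  identity for the empty shape and has a zero top row otherwise.\<close>

lemma jacobi_trudi:
  assumes "color_list R vs" "\<And>i. Suc i < L \<Longrightarrow> lam (Suc i) \<le> lam i"
  shows "schur R (set vs) \<rho> (cells L lam) = jt (map \<rho> vs) L (\<lambda>i. int (lam i) - int i)"
  using assms
proof (induction vs arbitrary: lam)
  case Nil
  show ?case
  proof (cases "\<forall>i<L. lam i = 0")
    case True
    then have c: "cells L lam = {}" by (auto simp: cells_def)
    have "jt [] L (\<lambda>i. int (lam i) - int i) = Determinant.det (1\<^sub>m L :: 'b mat)"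
      unfolding jt_def row_det_def one_mat_def
      by (intro arg_cong[of _ _ Determinant.det] cong_mat) (auto simp: hom_sym_int_Nil True)
    then show ?thesis
      by (simp add: c schur_def fillings_def)
  next
    case False
    then obtain i where i: "i < L" "lam i > 0" by auto
    have "lam i \<le> lam 0"
      using i(1)
    proof (induction i)
      case (Suc i)
      then show ?case using Nil(2)[of i] by auto
    qed simp
    with i have 0: "0 < L" "lam 0 > 0" by auto
    then have "(0, 0) \<in> cells L lam" by (auto simp: cells_def)
    then have "fillings R {} (cells L lam) = {}"
      by (auto simp: fillings_def)
    moreover have "jt [] L (\<lambda>i. int (lam i) - int i) = 0"
      unfolding jt_def by (rule row_det_zero_row[of 0]) (use 0 in \<open>auto simp: hom_sym_int_Nil\<close>)
    ultimately show ?thesis by (simp add: schur_def)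
  qed
next
  case (Cons v vs)
  have vs: "color_list R vs" and v: "v \<notin> set vs" "(v, v) \<in> R"
    "\<And>b. b \<in> set vs \<Longrightarrow> (b, v) \<in> R \<and> (v, b) \<notin> R"
    using Cons.prems(1) by (auto simp: color_list_def)
  let ?x = "\<rho> v" and ?h = "hom_sym_int (map \<rho> vs)" and ?H = "hom_sym_int (map \<rho> (v # vs))"
  let ?nx = "\<lambda>i. if Suc i < L then lam (Suc i) else 0"
  \<comment> \<open>This row operation truncates the expansion of the row \<open>i\<close> in powers of \<open>?x\<close> exactly where
    a horizontal strip has to end.\<close>
  have "jt (map \<rho> (v # vs)) L (\<lambda>i. int (lam i) - int i) =
      row_det L (\<lambda>i j. ?H (int (lam i) - int i + int j) -
        (if Suc i < L then ?x ^ Suc (lam i - lam (Suc i)) * ?H (int (lam (Suc i)) - int (Suc i) + int j) else 0))"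
    unfolding jt_def
    by (rule row_det_subtract_next_row[symmetric])
  also have "\<dots> = row_det L (\<lambda>i j. \<Sum>m\<in>{?nx i..lam i}. ?x ^ (lam i - m) * ?h (int m - int i + int j))"
  proof (rule row_det_cong)
    fix i j assume ij: "i < L" "j < L"
    let ?k = "Suc (lam i - ?nx i)"
    have le: "?nx i \<le> lam i" using Cons.prems(2)[of i] by auto
    have "(if Suc i < L then ?x ^ Suc (lam i - lam (Suc i)) * ?H (int (lam (Suc i)) - int (Suc i) + int j) else 0) =
        ?x ^ ?k * ?H (int (lam i) - int i + int j - int ?k)"
    proof (cases "Suc i < L")
      case True
      then have eq: "int (lam i) - int i + int j - int ?k = int (lam (Suc i)) - int (Suc i) + int j"
        using le by auto
      show ?thesis unfolding eq by (simp add: True)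
    next
      \<comment> \<open>In the last row the index is \<open>j - i - 1\<close> with
        \<open>i = L - 1\<close>, so the subtracted value is zero and can be included for
        uniformity.\<close>
      case False
      then have "int (lam i) - int i + int j - int ?k < 0" using ij by auto
      then show ?thesis using False by simp
    qed
    then have "?H (int (lam i) - int i + int j) -
        (if Suc i < L then ?x ^ Suc (lam i - lam (Suc i)) * ?H (int (lam (Suc i)) - int (Suc i) + int j) else 0) =
        (\<Sum>t<?k. ?x ^ t * ?h (int (lam i) - int i + int j - int t))"
      using hom_sym_int_Cons_diff[of ?x "map \<rho> vs" "int (lam i) - int i + int j" ?k] by (simp only: list.map)
    also have "\<dots> = (\<Sum>m\<in>{?nx i..lam i}. ?x ^ (lam i - m) * ?h (int m - int i + int j))"
      by (rule sum.reindex_bij_witness[where i = "\<lambda>m. lam i - m" and j = "\<lambda>t. lam i - t"])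
         (use le in \<open>auto simp: algebra_simps of_nat_diff simp del: power_Suc\<close>)
    finally show "?H (int (lam i) - int i + int j) -
        (if Suc i < L then ?x ^ Suc (lam i - lam (Suc i)) * ?H (int (lam (Suc i)) - int (Suc i) + int j) else 0) =
        (\<Sum>m\<in>{?nx i..lam i}. ?x ^ (lam i - m) * ?h (int m - int i + int j))" .
  qed
  also have "\<dots> = (\<Sum>mu\<in>hstrips L lam. (\<Prod>i<L. ?x ^ (lam i - mu i)) * jt (map \<rho> vs) L (\<lambda>i. int (mu i) - int i))"
    unfolding hstrips_def jt_def
    by (rule row_det_rows_sum) simp
  also have "\<dots> = (\<Sum>mu\<in>hstrips L lam. (\<Prod>i<L. ?x ^ (lam i - mu i)) * schur R (set vs) \<rho> (cells L mu))"
  proof (rule sum.cong[OF refl])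
    fix mu assume mu: "mu \<in> hstrips L lam"
    have "mu (Suc i) \<le> mu i" if "Suc i < L" for i
      using hstripsD[OF mu, of i] hstripsD[OF mu, of "Suc i"] that by auto
    then show "(\<Prod>i<L. ?x ^ (lam i - mu i)) * jt (map \<rho> vs) L (\<lambda>i. int (mu i) - int i) =
        (\<Prod>i<L. ?x ^ (lam i - mu i)) * schur R (set vs) \<rho> (cells L mu)"
      using Cons.IH[OF vs, of mu] by simp
  qed
  also have "\<dots> = schur R (set (v # vs)) \<rho> (cells L lam)"
    using schur_insert_max[of L lam "set vs" v R \<rho>] v Cons.prems(2) by simp
  finally show ?case by simp
qed

section \<open>Removing border strips\<close>

lemma jt_cong: "(\<And>i. i < L \<Longrightarrow> \<beta> i = \<beta>' i) \<Longrightarrow> jt xs L \<beta> = jt xs L \<beta>'"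
  unfolding jt_def by (rule row_det_cong) simp

text \<open>Newton's identity is applied in each factor of the Leibniz expansion. Row
  \<open>i\<close> contributes the factor \<open>\<beta> i + p i\<close> to the term of
  \<open>p\<close>; summed over \<open>i\<close> it does not depend on the permutation
  \<open>p\<close> and comes out of the determinant.\<close>

lemma jt_power_sums:
  assumes "\<And>i. i < L \<Longrightarrow> \<beta> i + int L \<le> int N"
  shows "of_int (\<Sum>i<L. \<beta> i + int i) * jt xs L \<beta> =
    (\<Sum>s<N. power_sum xs (Suc s) * (\<Sum>i<L. jt xs L (\<beta>(i := \<beta> i - int (Suc s)))))"
proof -
  let ?P = "{p. p permutes {..<L}}"
  let ?pr = "\<lambda>p i. (\<Prod>r\<in>{..<L} - {i}. hom_sym_int xs (\<beta> r + int (p r)))"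
  have jt_upd: "jt xs L (\<beta>(i := b)) = (\<Sum>p\<in>?P. of_int (sign p) * (hom_sym_int xs (b + int (p i)) * ?pr p i))"
    if "i < L" for i b
    unfolding jt_def row_det_expand
    by (intro sum.cong refl arg_cong2[of _ _ _ _ "(*)"], subst prod.remove[of _ i])
       (use that in \<open>auto intro!: prod.cong\<close>)
  have "(\<Sum>s<N. power_sum xs (Suc s) * (\<Sum>i<L. jt xs L (\<beta>(i := \<beta> i - int (Suc s))))) =
      (\<Sum>s<N. \<Sum>i<L. \<Sum>p\<in>?P. of_int (sign p) * ?pr p i *
        (power_sum xs (Suc s) * hom_sym_int xs (\<beta> i + int (p i) - int (Suc s))))"
    unfolding sum_distrib_left
  proof (intro sum.cong refl)
    fix s i assume "i \<in> {..<L}"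
    then show "power_sum xs (Suc s) * jt xs L (\<beta>(i := \<beta> i - int (Suc s))) =
      (\<Sum>p\<in>?P. of_int (sign p) * ?pr p i *
        (power_sum xs (Suc s) * hom_sym_int xs (\<beta> i + int (p i) - int (Suc s))))"
      by (simp add: jt_upd sum_distrib_left algebra_simps)
  qed
  also have "\<dots> = (\<Sum>i<L. \<Sum>p\<in>?P. of_int (sign p) * ?pr p i *
        (\<Sum>s<N. power_sum xs (Suc s) * hom_sym_int xs (\<beta> i + int (p i) - int (Suc s))))"
    unfolding sum_distrib_left
    by (subst sum.swap, rule sum.cong[OF refl], rule sum.swap)
  also have "\<dots> = (\<Sum>i<L. \<Sum>p\<in>?P. of_int (sign p) * ?pr p i *
        (of_int (\<beta> i + int (p i)) * hom_sym_int xs (\<beta> i + int (p i))))"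
  proof (intro sum.cong refl arg_cong2[of _ _ _ _ "(*)"])
    fix i p assume i: "i \<in> {..<L}" and p: "p \<in> ?P"
    have "p i < L" using permutes_in_image[of p "{..<L}" i] i p by auto
    then have "\<beta> i + int (p i) \<le> int N" using assms[of i] i by auto
    then show "(\<Sum>s<N. power_sum xs (Suc s) * hom_sym_int xs (\<beta> i + int (p i) - int (Suc s))) =
        of_int (\<beta> i + int (p i)) * hom_sym_int xs (\<beta> i + int (p i))"
      by (rule newton_hom_sym_int[symmetric])
  qed
  also have "\<dots> = (\<Sum>i<L. \<Sum>p\<in>?P. of_int (sign p) * (\<Prod>r<L. hom_sym_int xs (\<beta> r + int (p r))) *
        of_int (\<beta> i + int (p i)))"
  proof (intro sum.cong refl)
    fix i p assume i: "i \<in> {..<L}"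
    have "(\<Prod>r<L. hom_sym_int xs (\<beta> r + int (p r))) = hom_sym_int xs (\<beta> i + int (p i)) * ?pr p i"
      using i by (intro prod.remove) auto
    then show "of_int (sign p) * ?pr p i * (of_int (\<beta> i + int (p i)) * hom_sym_int xs (\<beta> i + int (p i))) =
        of_int (sign p) * (\<Prod>r<L. hom_sym_int xs (\<beta> r + int (p r))) * of_int (\<beta> i + int (p i))"
      by (simp add: mult_ac)
  qed
  also have "\<dots> = (\<Sum>p\<in>?P. of_int (sign p) * (\<Prod>r<L. hom_sym_int xs (\<beta> r + int (p r))) *
        of_int (\<Sum>i<L. \<beta> i + int (p i)))"
    by (subst sum.swap) (simp add: sum_distrib_left)
  also have "\<dots> = (\<Sum>p\<in>?P. of_int (sign p) * (\<Prod>r<L. hom_sym_int xs (\<beta> r + int (p r))) *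
        of_int (\<Sum>i<L. \<beta> i + int i))"
  proof (rule sum.cong[OF refl])
    fix p assume "p \<in> ?P"
    then have "(\<Sum>i<L. int (p i)) = (\<Sum>i<L. int i)"
      using sum.permute[of p "{..<L}" int] by (simp add: o_def)
    then have "(\<Sum>i<L. \<beta> i + int (p i)) = (\<Sum>i<L. \<beta> i + int i)"
      by (simp add: sum.distrib)
    then show "of_int (sign p) * (\<Prod>r<L. hom_sym_int xs (\<beta> r + int (p r))) * of_int (\<Sum>i<L. \<beta> i + int (p i)) =
        of_int (sign p) * (\<Prod>r<L. hom_sym_int xs (\<beta> r + int (p r))) * of_int (\<Sum>i<L. \<beta> i + int i)"
      by (simp only:)
  qed
  also have "\<dots> = of_int (\<Sum>i<L. \<beta> i + int i) * jt xs L \<beta>"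
    unfolding jt_def row_det_expand sum_distrib_right[symmetric] by (simp add: mult.commute)
  finally show ?thesis by simp
qed

text \<open>The sequence on the left arises from \<open>\<beta>(i := b)\<close> by carrying
  \<open>b\<close> from position \<open>i\<close> down to position \<open>t\<close>, which takes
  \<open>t - i\<close> adjacent swaps.\<close>

lemma jt_move_row:
  assumes "i \<le> t" "t < L"
  shows "jt xs L (\<lambda>r. if r < i then \<beta> r else if r < t then \<beta> (Suc r) else if r = t then b else \<beta> r) =
    (-1) ^ (t - i) * jt xs L (\<beta>(i := b))"
  using assms
proof (induction t rule: dec_induct)
  case base
  show ?case by (simp, rule jt_cong) auto
next
  case (step t)
  let ?f = "\<lambda>t r. if r < i then \<beta> r else if r < t then \<beta> (Suc r) else if r = t then b else \<beta> r"
  have "?f (Suc t) r = ?f t (Transposition.transpose t (Suc t) r)" for r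
    using step by (auto simp: Transposition.transpose_def)
  then have "jt xs L (?f (Suc t)) = - jt xs L (?f t)"
    unfolding jt_def
    using row_det_swap_rows[of t L "Suc t" "\<lambda>r j. hom_sym_int xs (?f t r + int j)"] step by simp
  then show ?case
    using step by (simp add: Suc_diff_le)
qed

section \<open>Partitions as functions of the row index\<close>

definition row_len :: "nat list \<Rightarrow> nat \<Rightarrow> nat" where
  "row_len l i = (if i < length l then l ! i else 0)"

lemma diagram_row_len: "diagram l = {(r, c). c < row_len l r}"
  by (auto simp: diagram_def row_len_def split: if_splits)

lemma diagram_cells: "length l \<le> L \<Longrightarrow> diagram l = cells L (row_len l)"
  by (auto simp: diagram_def cells_def row_len_def split: if_splits)

lemma finite_diagram [simp]: "finite (diagram l)"
  using diagram_cells[of l "length l"] by simp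

lemma card_diagram: "card (diagram l) = sum_list l"
proof -
  have "card (diagram l) = (\<Sum>r<length l. row_len l r)"
    using diagram_cells[of l "length l"] by (simp add: cells_Sigma)
  also have "\<dots> = (\<Sum>r<length l. l ! r)" by (simp add: row_len_def)
  finally show ?thesis by (simp add: sum_list_sum_nth atLeast0LessThan)
qed

lemma row_len_antimono: "is_partition l \<Longrightarrow> i \<le> j \<Longrightarrow> row_len l j \<le> row_len l i"
  unfolding is_partition_def row_len_def
  by (cases "i = j") (auto simp: sorted_wrt_iff_nth_less)

lemma row_len_pos: "is_partition l \<Longrightarrow> 0 < row_len l i \<longleftrightarrow> i < length l"
  unfolding is_partition_def row_len_def by (auto simp: in_set_conv_nth)

lemma row_len_inject:
  assumes "is_partition l" "is_partition l'" "row_len l = row_len l'"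
  shows "l = l'"
proof -
  have "i < length l \<longleftrightarrow> i < length l'" for i
    using row_len_pos[OF assms(1), of i] row_len_pos[OF assms(2), of i] assms(3) by simp
  then have "length l = length l'" by (metis linorder_neqE_nat less_irrefl)
  then show ?thesis
  proof (rule nth_equalityI)
    fix i assume "i < length l"
    with \<open>length l = length l'\<close> show "l ! i = l' ! i"
      using fun_cong[OF assms(3), of i] by (simp add: row_len_def)
  qed
qed

lemma row_len_exists:
  assumes "\<And>i j. i \<le> j \<Longrightarrow> lam j \<le> lam i" "\<And>i. i \<ge> L \<Longrightarrow> lam i = 0"
  shows "\<exists>l. is_partition l \<and> row_len l = lam \<and> length l \<le> L"
proof -
  define m where "m = card {i. lam i > 0}"
  have "i < L" if "lam i > 0" for i
    using assms(2)[of i] that by (cases "i < L") auto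
  then have sub: "{i. lam i > 0} \<subseteq> {..<L}" by blast
  have fin: "finite {i. lam i > 0}" using sub finite_subset by blast
  have m: "i < m \<longleftrightarrow> lam i > 0" for i
  proof
    assume "i < m"
    show "lam i > 0"
    proof (rule ccontr)
      assume "\<not> lam i > 0"
      then have "j < i" if "lam j > 0" for j
        using assms(1)[of i j] that by linarith
      then have "{i. lam i > 0} \<subseteq> {..<i}" by blast
      then show False using card_mono[of "{..<i}" "{i. lam i > 0}"] \<open>i < m\<close> m_def by auto
    qed
  next
    assume "lam i > 0"
    then have "lam j > 0" if "j \<le> i" for j
      using assms(1)[OF that] by linarith
    then have "{..i} \<subseteq> {i. lam i > 0}" by blast
    then show "i < m" using card_mono[OF fin, of "{..i}"] m_def by auto
  qed
  have "m \<le> L" using card_mono[OF _ sub] m_def by auto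
  moreover have "is_partition (map lam [0..<m])"
    unfolding is_partition_def
  proof
    show "sorted_wrt (\<ge>) (map lam [0..<m])"
      unfolding sorted_wrt_iff_nth_less
    proof (intro allI impI)
      fix i j assume "i < j" "j < length (map lam [0..<m])"
      then show "map lam [0..<m] ! j \<le> map lam [0..<m] ! i"
        using assms(1)[of i j] by simp
    qed
    have "lam i \<noteq> 0" if "i < m" for i
      using m[of i] that by simp
    then show "0 \<notin> set (map lam [0..<m])" by force
  qed
  moreover have "row_len (map lam [0..<m]) = lam"
    using m by (auto simp: row_len_def fun_eq_iff)
  ultimately show ?thesis by (intro exI[of _ "map lam [0..<m]"]) auto
qed

section \<open>The shape of a border strip\<close>

text \<open>
  Removing a border strip that occupies the rows \<open>i, \<dots>, t\<close> shifts the rows \<open>i + 1, \<dots>, t\<close> up by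
  one, diminished by one cell each.
\<close>

definition strip_shape :: "(nat \<Rightarrow> nat) \<Rightarrow> (nat \<Rightarrow> nat) \<Rightarrow> nat \<Rightarrow> nat \<Rightarrow> bool" where
  "strip_shape lam mu i t \<longleftrightarrow> i \<le> t \<and> (\<forall>r. r < i \<or> t < r \<longrightarrow> mu r = lam r) \<and>
     (\<forall>r. i \<le> r \<and> r < t \<longrightarrow> Suc (mu r) = lam (Suc r)) \<and> lam (Suc t) \<le> mu t \<and> mu t < lam t"

text \<open>Connectedness makes consecutive rows of the strip overlap in some column, and the
  absence of squares leaves room for one column only; this fixes the remaining length of every row
  of the strip but the last.\<close>

lemma strip_removal_shape:
  assumes l: "is_partition l" and z: "strip_removal l z l'"
  shows "strip_shape (row_len l) (row_len l') (Min (fst ` z)) (Max (fst ` z))"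
proof -
  let ?lam = "row_len l" and ?mu = "row_len l'"
  define i where "i = Min (fst ` z)"
  define t where "t = Max (fst ` z)"
  have l': "is_partition l'" and sub: "diagram l' \<subseteq> diagram l" and zd: "z = diagram l - diagram l'"
    and ne: "z \<noteq> {}" and con: "edge_connected z"
    and sq: "\<And>r c. \<not> {(r, c), (Suc r, c), (r, Suc c), (Suc r, Suc c)} \<subseteq> z"
    using z by (auto simp: strip_removal_def)
  have mem: "(r, c) \<in> z \<longleftrightarrow> ?mu r \<le> c \<and> c < ?lam r" for r c
    by (auto simp: zd diagram_row_len)
  have le: "?mu r \<le> ?lam r" for r
  proof (rule ccontr)
    assume "\<not> ?mu r \<le> ?lam r"
    then have "(r, ?lam r) \<in> diagram l'" "(r, ?lam r) \<notin> diagram l" by (auto simp: diagram_row_len)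
    with sub show False by auto
  qed
  have fin: "finite (fst ` z)" by (simp add: zd)
  have i: "i \<in> fst ` z" "\<And>r. r \<in> fst ` z \<Longrightarrow> i \<le> r"
    and t: "t \<in> fst ` z" "\<And>r. r \<in> fst ` z \<Longrightarrow> r \<le> t"
    using fin ne by (auto simp: i_def t_def)
  have row: "r \<in> fst ` z \<longleftrightarrow> ?mu r < ?lam r" for r
    using mem by (force simp: image_iff)
  have out: "?mu r = ?lam r" if "r < i \<or> t < r" for r
    using row[of r] le[of r] i(2)[of r] t(2)[of r] that by linarith
  \<comment> \<open>A path from the top row to the bottom row has to step from row \<open>r\<close>
    to row \<open>Suc r\<close> within one column.\<close>
  have cross: "\<exists>c. (r, c) \<in> z \<and> (Suc r, c) \<in> z" if r: "i \<le> r" "r < t" for r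
  proof (rule ccontr)
    assume no: "\<nexists>c. (r, c) \<in> z \<and> (Suc r, c) \<in> z"
    obtain x y where x: "x \<in> z" "fst x = i" and y: "y \<in> z" "fst y = t" using i(1) t(1) by auto
    have "(x, y) \<in> {(u, v). u \<in> z \<and> v \<in> z \<and> adjacent u v}\<^sup>*"
      using con x(1) y(1) unfolding edge_connected_def by blast
    then have "fst y \<le> r"
    proof (induction rule: rtrancl_induct)
      case base
      then show ?case using x r by simp
    next
      case (step u v)
      then have "u \<in> z" "v \<in> z" "adjacent u v" "fst u \<le> r" by auto
      then show ?case
        using no by (cases u; cases v; cases "fst u = r") (auto simp: adjacent_def)
    qed
    then show False using y r by simp
  qed
  \<comment> \<open>The columns shared by the two rows are those from \<open>?mu r\<close> up to
    \<open>?lam (Suc r)\<close> exclusive.\<close>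
  have mid: "Suc (?mu r) = ?lam (Suc r)" if "i \<le> r" "r < t" for r
  proof -
    obtain c where c: "(r, c) \<in> z" "(Suc r, c) \<in> z" using cross[of r] \<open>i \<le> r\<close> \<open>r < t\<close> by auto
    have "?mu (Suc r) \<le> ?mu r" "?lam (Suc r) \<le> ?lam r"
      using row_len_antimono[OF l'] row_len_antimono[OF l] by auto
    then have "\<not> Suc (?mu r) < ?lam (Suc r)"
      using sq[of r "?mu r"] by (auto simp: mem)
    moreover have "?mu r < ?lam (Suc r)" using c by (auto simp: mem)
    ultimately show ?thesis by auto
  qed
  have "i \<le> t" using i t by auto
  moreover have "?lam (Suc t) \<le> ?mu t"
    using out[of "Suc t"] row_len_antimono[OF l', of t "Suc t"] by auto
  moreover have "?mu t < ?lam t" using t(1) row by auto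
  ultimately show ?thesis
    unfolding strip_shape_def i_def[symmetric] t_def[symmetric] using out mid by auto
qed

text \<open>Every cell is joined to the first strip cell of the bottom row by moving left within its
  row and then stepping down. The size telescopes to the difference of the shifted row lengths
  \<open>lam i - i\<close> and \<open>mu t - t\<close>.\<close>

lemma strip_shape_removal:
  assumes l: "is_partition l" and l': "is_partition l'" and sh: "strip_shape (row_len l) (row_len l') i t"
  defines "z \<equiv> diagram l - diagram l'"
  shows "strip_removal l z l'" "fst ` z = {i..t}"
    "int (card z) = (int (row_len l i) - int i) - (int (row_len l' t) - int t)"
proof -
  let ?lam = "row_len l" and ?mu = "row_len l'"
  have it: "i \<le> t" and out: "\<And>r. r < i \<or> t < r \<Longrightarrow> ?mu r = ?lam r"
    and mid: "\<And>r. i \<le> r \<Longrightarrow> r < t \<Longrightarrow> Suc (?mu r) = ?lam (Suc r)"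
    and t: "?lam (Suc t) \<le> ?mu t" "?mu t < ?lam t"
    using sh by (auto simp: strip_shape_def)
  have mem: "(r, c) \<in> z \<longleftrightarrow> ?mu r \<le> c \<and> c < ?lam r" for r c
    by (auto simp: z_def diagram_row_len)
  have lt: "?mu r < ?lam r" if "i \<le> r" "r \<le> t" for r
    using mid[of r] t that row_len_antimono[OF l, of r "Suc r"] by (cases "r = t") auto
  have le: "?mu r \<le> ?lam r" for r
    using lt[of r] out[of r] by (cases "i \<le> r \<and> r \<le> t") auto
  have row: "?mu r < ?lam r \<longleftrightarrow> r \<in> {i..t}" for r
    using lt[of r] out[of r] by (cases "r \<in> {i..t}") auto
  show rows: "fst ` z = {i..t}"
  proof (intro equalityI subsetI)
    fix r assume "r \<in> {i..t}"
    then have "(r, ?mu r) \<in> z" using row[of r] by (auto simp: mem)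
    then show "r \<in> fst ` z" by force
  next
    fix r assume "r \<in> fst ` z"
    then obtain c where "(r, c) \<in> z" by auto
    then have "?mu r < ?lam r" by (auto simp: mem)
    then show "r \<in> {i..t}" using row by auto
  qed
  let ?E = "{(u, v). u \<in> z \<and> v \<in> z \<and> adjacent u v}"
  have left: "((r, c), (r, ?mu r)) \<in> ?E\<^sup>*" if "(r, c) \<in> z" for r c
  proof -
    have "?mu r \<le> c" using that by (simp add: mem)
    then show ?thesis using that
    proof (induction c rule: dec_induct)
      case (step c)
      then have "((r, Suc c), (r, c)) \<in> ?E" by (auto simp: mem adjacent_def)
      moreover have "((r, c), (r, ?mu r)) \<in> ?E\<^sup>*" using step by (auto simp: mem)
      ultimately show ?case by (rule converse_rtrancl_into_rtrancl)
    qed simp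
  qed
  \<comment> \<open>The cell below the first strip cell of row \<open>r\<close> is the last cell of
    row \<open>Suc r\<close>, hence again in the strip.\<close>
  have down: "((r, ?mu r), (t, ?mu t)) \<in> ?E\<^sup>*" if "i \<le> r" "r \<le> t" for r
    using that(2,1)
  proof (induction r rule: inc_induct)
    case (step r)
    have c: "(r, ?mu r) \<in> z" "(Suc r, ?mu r) \<in> z"
      using step lt[of r] mid[of r] row_len_antimono[OF l', of r "Suc r"] by (auto simp: mem)
    then have "((r, ?mu r), (Suc r, ?mu r)) \<in> ?E" by (auto simp: adjacent_def)
    also have "((Suc r, ?mu r), (Suc r, ?mu (Suc r))) \<in> ?E\<^sup>*" using left c by auto
    also have "((Suc r, ?mu (Suc r)), (t, ?mu t)) \<in> ?E\<^sup>*" using step by auto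
    finally show ?case .
  qed simp
  have to_t: "(x, (t, ?mu t)) \<in> ?E\<^sup>*" if "x \<in> z" for x
  proof -
    obtain r c where x: "x = (r, c)" by fastforce
    have "r \<in> {i..t}" using that rows x by force
    then show ?thesis
      using left[of r c] down[of r] that x by (auto intro: rtrancl_trans)
  qed
  have "sym ?E" by (auto simp: sym_def adjacent_def)
  then have symE: "sym (?E\<^sup>*)" by (rule sym_rtrancl)
  have "edge_connected z"
    unfolding edge_connected_def
    using to_t symD[OF symE] by (meson rtrancl_trans)
  moreover have "\<not> {(r, c), (Suc r, c), (r, Suc c), (Suc r, Suc c)} \<subseteq> z" for r c
  proof
    assume a: "{(r, c), (Suc r, c), (r, Suc c), (Suc r, Suc c)} \<subseteq> z"
    then have "r \<in> {i..t}" "Suc r \<in> {i..t}" using rows by (force simp: image_iff)+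
    then have "Suc (?mu r) = ?lam (Suc r)" by (intro mid) auto
    with a show False by (auto simp: mem)
  qed
  moreover have "diagram l' \<subseteq> diagram l"
    using le by (auto simp: diagram_row_len intro: less_le_trans)
  moreover have "z \<noteq> {}" using rows it by auto
  ultimately show "strip_removal l z l'"
    using l' by (auto simp: strip_removal_def z_def)
  have "z = (SIGMA r:{i..t}. {?mu r..<?lam r})"
  proof -
    have "x \<in> z \<longleftrightarrow> x \<in> (SIGMA r:{i..t}. {?mu r..<?lam r})" for x
      using mem[of "fst x" "snd x"] row[of "fst x"] by (cases x) auto
    then show ?thesis by blast
  qed
  then have "card z = (\<Sum>r\<in>{i..t}. ?lam r - ?mu r)" by simp
  then have "int (card z) = (\<Sum>r\<in>{i..t}. int (?lam r) - int (?mu r))"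
    using le by (simp add: of_nat_diff)
  \<comment> \<open>The partial sums telescope because \<open>?lam (Suc u)\<close> is
    \<open>?mu u + 1\<close> inside the strip.\<close>
  moreover have "(\<Sum>r\<in>{i..u}. int (?lam r) - int (?mu r)) =
      (int (?lam i) - int i) - (int (?mu u) - int u)" if "i \<le> u" "u \<le> t" for u
    using that
  proof (induction u rule: dec_induct)
    case (step u)
    then have "{i..Suc u} = insert (Suc u) {i..u}" by auto
    moreover have "int (?lam (Suc u)) = int (?mu u) + 1"
      using mid[of u] step by (simp flip: of_nat_Suc)
    ultimately show ?case using step by simp
  qed simp
  ultimately show "int (card z) = (int (?lam i) - int i) - (int (?mu t) - int t)"
    using it by simp
qed

text \<open>The remaining partition is recorded although the strip determines it, so that sums over
  strips can refer to it.\<close>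

definition strips :: "nat list \<Rightarrow> nat \<Rightarrow> ((nat \<times> nat) set \<times> nat list) set" where
  "strips l s = {(z, l'). strip_removal l z l' \<and> card z = s}"

lemma strips_partition: "(z, l') \<in> strips l s \<Longrightarrow> is_partition l'"
  by (auto simp: strips_def strip_removal_def)

lemma strips_cells: "(z, l') \<in> strips l s \<Longrightarrow> z = diagram l - diagram l'"
  by (simp add: strips_def strip_removal_def)

lemma strips_target_unique:
  assumes "(z, l1) \<in> strips l s" "(z, l2) \<in> strips l s'"
  shows "l1 = l2"
proof -
  have "diagram l1 = diagram l - z" "diagram l2 = diagram l - z"
    using assms by (auto simp: strips_def strip_removal_def)
  then have "c < row_len l1 r \<longleftrightarrow> c < row_len l2 r" for r c
    by (auto simp: diagram_row_len set_eq_iff)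
  then have "row_len l1 r = row_len l2 r" for r
    by (metis linorder_neqE_nat less_irrefl)
  then show ?thesis
    using row_len_inject assms strips_partition by blast
qed

lemma strips_sum_list:
  assumes "(z, l') \<in> strips l s"
  shows "sum_list l = sum_list l' + s"
proof -
  have "diagram l = diagram l' \<union> z" "diagram l' \<inter> z = {}" "card z = s" "finite z"
    using assms by (auto simp: strips_def strip_removal_def)
  then have "card (diagram l) = card (diagram l') + s"
    by (simp add: card_Un_disjoint)
  then show ?thesis by (simp add: card_diagram)
qed

lemma strips_too_large: "sum_list l < s \<Longrightarrow> strips l s = {}"
  using strips_sum_list by fastforce

text \<open>The numbers \<open>\<beta> r\<close> strictly decrease in \<open>r\<close>; lowering
  \<open>\<beta> i\<close> by \<open>s\<close> gives \<open>b\<close>. A strip of size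
  \<open>s\<close> with top row \<open>i\<close> and bottom row \<open>t\<close> forces
  \<open>b\<close> strictly between \<open>\<beta> (Suc t)\<close> and \<open>\<beta> t\<close>, and
  \<open>b\<close> determines it, so the sum has at most one term. Its height \<open>t - i\<close>
  is the number of swaps that sort the lowered sequence.\<close>

lemma strips_shift:
  fixes xs :: "'a::comm_ring_1 list"
  assumes l: "is_partition l" and L: "length l \<le> L" and i: "i < L" and s: "s > 0"
  shows "finite {(z, l') \<in> strips l s. Min (fst ` z) = i} \<and>
    (\<Sum>(z, l')\<in>{(z, l') \<in> strips l s. Min (fst ` z) = i}.
       (-1) ^ strip_height z * jt xs L (\<lambda>r. int (row_len l' r) - int r)) =
     jt xs L ((\<lambda>r. int (row_len l r) - int r)(i := int (row_len l i) - int i - int s))"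
proof -
  let ?lam = "row_len l"
  define \<beta> where "\<beta> = (\<lambda>r. int (?lam r) - int r)"
  define b where "b = \<beta> i - int s"
  let ?S = "{(z, l') \<in> strips l s. Min (fst ` z) = i}"
  have lam0: "?lam r = 0" if "L \<le> r" for r using that L by (simp add: row_len_def)
  have \<beta>_mono: "\<beta> r' < \<beta> r" if "r < r'" for r r'
    using row_len_antimono[OF l, of r r'] that by (simp add: \<beta>_def)
  have shape: "\<exists>t. strip_shape ?lam (row_len l') i t \<and> t < L \<and> b = int (row_len l' t) - int t \<and>
      \<beta> (Suc t) < b \<and> b < \<beta> t \<and> z = diagram l - diagram l'" if "(z, l') \<in> ?S" for z l'
  proof -
    define t where "t = Max (fst ` z)"
    have zs: "strip_removal l z l'" "card z = s" "Min (fst ` z) = i" and l': "is_partition l'"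
      using that strips_partition by (auto simp: strips_def)
    have sh: "strip_shape ?lam (row_len l') i t"
      using strip_removal_shape[OF l zs(1)] zs(3) t_def by simp
    have zd: "z = diagram l - diagram l'" using zs(1) by (simp add: strip_removal_def)
    have b: "b = int (row_len l' t) - int t"
      using strip_shape_removal(3)[OF l l' sh] zs(2) zd by (simp add: b_def \<beta>_def)
    have "?lam (Suc t) \<le> row_len l' t" "row_len l' t < ?lam t" using sh by (auto simp: strip_shape_def)
    then show ?thesis
      using sh b zd lam0[of t] by (intro exI[of _ t]) (auto simp: \<beta>_def not_le[symmetric])
  qed
  consider (equal) j where "j < L" "j \<noteq> i" "\<beta> j = b" | (low) "b \<le> - int L"
    | (strip) "b > - int L" "\<And>j. j < L \<Longrightarrow> \<beta> j \<noteq> b"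
    using s by (cases "\<exists>j<L. \<beta> j = b") (force simp: b_def)+
  then show ?thesis
  proof cases
    case equal
    have "?S = {}"
    proof (rule ccontr)
      assume "?S \<noteq> {}"
      then obtain t where "\<beta> (Suc t) < \<beta> j" "\<beta> j < \<beta> t"
        using shape equal(3) by fast
      then show False
        using \<beta>_mono[of j "Suc t"] \<beta>_mono[of t j] \<beta>_mono[of j t] \<beta>_mono[of "Suc t" j]
        by (cases j t rule: linorder_cases; cases j "Suc t" rule: linorder_cases) auto
    qed
    moreover have "jt xs L (\<beta>(i := b)) = 0"
      unfolding jt_def by (rule row_det_equal_rows[of i L j]) (use equal i in auto)
    ultimately show ?thesis by (simp only: b_def \<beta>_def) simp
  next
    case low
    have "?S = {}"
    proof (rule ccontr)
      assume "?S \<noteq> {}"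
      then obtain l' t where "t < L" "b = int (row_len l' t) - int t"
        using shape by fast
      then show False using low by simp
    qed
    moreover have "jt xs L (\<beta>(i := b)) = 0"
      unfolding jt_def by (rule row_det_zero_row[of i]) (use low i in auto)
    ultimately show ?thesis by (simp only: b_def \<beta>_def) simp
  next
    case strip
    \<comment> \<open>The bottom row \<open>t\<close> is to be the last one whose shifted length
      still exceeds \<open>b\<close>.\<close>
    let ?J = "{r. r < L \<and> b < \<beta> r}"
    define t where "t = Max ?J"
    have fJ: "finite ?J" by simp
    have iJ: "i \<in> ?J" using i s by (simp add: b_def)
    then have "t \<in> ?J" unfolding t_def using Max_in[OF fJ] by blast
    then have t: "t < L" "b < \<beta> t" by auto
    have it: "i \<le> t" unfolding t_def using Max_ge[OF fJ iJ] .
    have t': "\<beta> (Suc t) < b"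
    proof (cases "Suc t < L")
      case True
      have "Suc t \<notin> ?J"
      proof
        assume "Suc t \<in> ?J"
        from Max_ge[OF fJ this] show False unfolding t_def by linarith
      qed
      then show ?thesis using strip(2)[OF True] True by auto
    next
      case False
      then have "\<beta> (Suc t) = - int L" using t lam0[of "Suc t"] by (simp add: \<beta>_def)
      then show ?thesis using strip(1) by simp
    qed
    \<comment> \<open>The subtractions are exact: \<open>pos\<close> and \<open>mut\<close> exclude
      truncation by \<open>- 1\<close> and \<open>nat\<close>.\<close>
    define mu where "mu = (\<lambda>r. if r < i then ?lam r else if r < t then ?lam (Suc r) - 1
      else if r = t then nat (b + int t) else ?lam r)"
    have mut: "int (mu t) = b + int t" "?lam (Suc t) \<le> mu t" "mu t < ?lam t"
      using t t' it by (auto simp: mu_def \<beta>_def)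
    have pos: "0 < ?lam (Suc r)" if "r < t" for r
      using row_len_antimono[OF l, of "Suc r" t] that mut(3) by linarith
    have sh: "strip_shape ?lam mu i t"
      unfolding strip_shape_def using it mut pos by (auto simp: mu_def)
    have step: "mu (Suc r) \<le> mu r" for r
    proof -
      consider "Suc r < i" | "Suc r = i" | "i \<le> r" "Suc r < t" | "i \<le> r" "Suc r = t" | "r = t" | "t < r"
        using it by linarith
      then show ?thesis
      proof cases
        case 2
        have "mu i \<le> ?lam i"
          using mut(3) pos[of i] row_len_antimono[OF l, of i "Suc i"] it
          by (cases "i = t") (auto simp: mu_def)
        then show ?thesis
          using 2 row_len_antimono[OF l, of r i] by (auto simp: mu_def)
      next
        case 3
        then show ?thesis
          using row_len_antimono[OF l, of "Suc r" "Suc (Suc r)"] by (auto simp: mu_def)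
      next
        case 4
        then show ?thesis using mut(3) by (auto simp: mu_def)
      next
        case 5
        then show ?thesis using mut(2) it by (auto simp: mu_def)
      qed (use it row_len_antimono[OF l, of r "Suc r"] in \<open>auto simp: mu_def\<close>)
    qed
    have "mu r' \<le> mu r" if "r \<le> r'" for r r'
      using that by (induction r' rule: dec_induct) (auto intro: order_trans step)
    moreover have "mu r = 0" if "r \<ge> L" for r
      using that t it lam0[of r] by (auto simp: mu_def)
    ultimately obtain l' where l': "is_partition l'" "row_len l' = mu" "length l' \<le> L"
      using row_len_exists[of mu L] by blast
    define z where "z = diagram l - diagram l'"
    note rem = strip_shape_removal[OF l l'(1), unfolded l'(2), OF sh, folded z_def]
    have "int (card z) = int s" using rem(3) mut(1) by (simp add: b_def \<beta>_def)
    moreover have "Min (fst ` z) = i" unfolding rem(2) using it by (intro Min_eqI) auto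
    ultimately have zS: "(z, l') \<in> ?S" using rem(1) by (simp add: strips_def)
    have "?S = {(z, l')}"
    proof (rule ccontr)
      assume "?S \<noteq> {(z, l')}"
      then obtain z2 l2 where 2: "(z2, l2) \<in> ?S" "(z2, l2) \<noteq> (z, l')"
        using zS by auto
      obtain u where u: "strip_shape ?lam (row_len l2) i u" "b = int (row_len l2 u) - int u"
        "\<beta> (Suc u) < b" "b < \<beta> u" "z2 = diagram l - diagram l2"
        using shape[OF 2(1)] by blast
      \<comment> \<open>The intervals between consecutive values of \<open>\<beta>\<close> are
        disjoint, so \<open>b\<close> determines the bottom row.\<close>
      have "\<not> u < t" "\<not> t < u"
        using \<beta>_mono[of "Suc u" t] \<beta>_mono[of "Suc t" u] u t t'
        by (metis Suc_lessI less_asym less_trans)+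
      then have "u = t" by simp
      have "row_len l2 r = mu r" for r
      proof -
        consider "r < i \<or> t < r" | "i \<le> r" "r < t" | "r = t" by linarith
        then show ?thesis
        proof cases
          case 2
          then have "Suc (row_len l2 r) = ?lam (Suc r)"
            using u(1) \<open>u = t\<close> by (simp add: strip_shape_def)
          then show ?thesis using 2 by (simp add: mu_def)
        qed (use u \<open>u = t\<close> mut(1) it in \<open>auto simp: strip_shape_def mu_def\<close>)
      qed
      then have "row_len l2 = row_len l'" using l'(2) by auto
      then have "l2 = l'" using row_len_inject l'(1) strips_partition 2(1) by blast
      then show False using 2(2) u(5) z_def by simp
    qed
    moreover have "strip_height z = t - i"
      using it by (simp add: strip_height_def rem(2))
    moreover have "jt xs L (\<lambda>r. int (row_len l' r) - int r) = (-1) ^ (t - i) * jt xs L (\<beta>(i := b))"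
    proof -
      have "int (mu r) - int r = (if r < i then \<beta> r else if r < t then \<beta> (Suc r) else if r = t then b else \<beta> r)" for r
        using mut(1) pos[of r] by (auto simp: mu_def \<beta>_def of_nat_diff)
      then show ?thesis
        unfolding l'(2) using jt_move_row[OF it t(1), of xs \<beta> b] by simp
    qed
    moreover have "(-1) ^ (t - i) * ((-1) ^ (t - i) * y) = y" for y :: 'a
      by (simp flip: mult.assoc power_add)
    ultimately show ?thesis
      by (simp add: b_def \<beta>_def)
  qed
qed

lemma finite_strips:
  assumes "is_partition l"
  shows "finite (strips l s)"
proof -
  have "inj_on snd (strips l s)"
    by (rule inj_onI) (auto dest!: strips_cells)
  moreover have "snd ` strips l s \<subseteq> {l'. set l' \<subseteq> {..sum_list l} \<and> length l' \<le> sum_list l}"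
  proof
    fix l' assume "l' \<in> snd ` strips l s"
    then obtain z where z: "(z, l') \<in> strips l s" by (metis imageE prod.collapse)
    have p: "is_partition l'" using z by (rule strips_partition)
    have "sum_list l' \<le> sum_list l" using strips_sum_list[OF z] by simp
    moreover have "set l' \<subseteq> {..sum_list l'}"
      using member_le_sum_list[of _ l'] by blast
    moreover have "length l' \<le> sum_list l'"
    proof -
      have "0 \<notin> set l'" using p by (simp add: is_partition_def)
      then show ?thesis by (induction l') auto
    qed
    ultimately show "l' \<in> {l'. set l' \<subseteq> {..sum_list l} \<and> length l' \<le> sum_list l}" by auto
  qed
  ultimately show ?thesis
    using finite_lists_length_le[of "{..sum_list l}" "sum_list l"]
    by (metis (no_types, lifting) finite_atMost finite_imageD finite_subset)
qed

text \<open>This is \<open>jt_power_sums\<close> for the determinant with \<open>length l\<close>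
  rows: removing a strip cannot lengthen a partition, so all shapes that occur fit this number of
  rows.\<close>

lemma schur_power_sums:
  assumes l: "is_partition l" and vs: "color_list R vs" and N: "sum_list l \<le> N"
  shows "of_nat (sum_list l) * schur R (set vs) \<rho> (diagram l) =
    (\<Sum>s<N. power_sum (map \<rho> vs) (Suc s) *
      (\<Sum>(z, l')\<in>strips l (Suc s). (-1) ^ strip_height z * schur R (set vs) \<rho> (diagram l')))"
proof -
  let ?xs = "map \<rho> vs"
  define L where "L = length l"
  \<comment> \<open>Bounds every index \<open>\<beta> i + j\<close> in the matrix, as Newton's
    identity requires, and is at least \<open>N\<close>. Strips of size above
    \<open>sum_list l\<close> do not exist, so the surplus terms vanish.\<close>
  define M where "M = N + L + L + row_len l 0"
  let ?\<beta> = "\<lambda>l r. int (row_len l r) - int r"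
  have sch: "schur R (set vs) \<rho> (diagram l') = jt ?xs L (?\<beta> l')" if "is_partition l'" "length l' \<le> L" for l'
    unfolding diagram_cells[OF that(2)]
    by (rule jacobi_trudi[OF vs]) (use row_len_antimono[OF that(1)] in auto)
  have len: "length l' \<le> L" if z: "(z, l') \<in> strips l s" for z l' s
  proof -
    have "row_len l' r \<le> row_len l r" for r
    proof (rule ccontr)
      assume "\<not> row_len l' r \<le> row_len l r"
      then have "(r, row_len l r) \<in> diagram l' - diagram l" by (auto simp: diagram_row_len)
      then show False using z by (auto simp: strips_def strip_removal_def)
    qed
    from this[of L] have "row_len l' L = 0" by (simp add: row_len_def L_def)
    then show ?thesis using row_len_pos[OF strips_partition[OF z], of L] by simp
  qed
  let ?T = "\<lambda>s. \<Sum>(z, l')\<in>strips l s. (-1) ^ strip_height z * schur R (set vs) \<rho> (diagram l')"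
  have T: "(\<Sum>i<L. jt ?xs L ((?\<beta> l)(i := ?\<beta> l i - int s))) = ?T s" if s: "s > 0" for s
  proof -
    have "?T s = (\<Sum>(z, l')\<in>strips l s. (-1) ^ strip_height z * jt ?xs L (?\<beta> l'))"
      by (rule sum.cong) (auto simp: sch strips_partition len)
    \<comment> \<open>Strips are sorted by their top row, since lowering the index of row
      \<open>i\<close> accounts for those that begin there.\<close>
    also have "\<dots> = (\<Sum>i<L. \<Sum>x\<in>{x \<in> strips l s. Min (fst ` fst x) = i}.
        case x of (z, l') \<Rightarrow> (-1) ^ strip_height z * jt ?xs L (?\<beta> l'))"
    proof (rule sum.group[symmetric])
      show "(\<lambda>x. Min (fst ` fst x)) ` strips l s \<subseteq> {..<L}"
      proof
        fix i assume "i \<in> (\<lambda>x. Min (fst ` fst x)) ` strips l s"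
        then obtain z l' where z: "(z, l') \<in> strips l s" "i = Min (fst ` z)" by auto
        then have "z \<noteq> {}" "z \<subseteq> diagram l" by (auto simp: strips_def strip_removal_def)
        then have "i \<in> fst ` z" using z(2) finite_subset[of z "diagram l"] by auto
        then show "i \<in> {..<L}" using \<open>z \<subseteq> diagram l\<close> by (auto simp: diagram_def L_def)
      qed
    qed (auto simp: finite_strips l)
    also have "\<dots> = (\<Sum>i<L. jt ?xs L ((?\<beta> l)(i := ?\<beta> l i - int s)))"
    proof (rule sum.cong[OF refl])
      fix i assume "i \<in> {..<L}"
      moreover have "{x \<in> strips l s. Min (fst ` fst x) = i} = {(z, l') \<in> strips l s. Min (fst ` z) = i}"
        by auto
      ultimately show "(\<Sum>x\<in>{x \<in> strips l s. Min (fst ` fst x) = i}.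
          case x of (z, l') \<Rightarrow> (-1) ^ strip_height z * jt ?xs L (?\<beta> l')) =
          jt ?xs L ((?\<beta> l)(i := ?\<beta> l i - int s))"
        using strips_shift[OF l _ _ s, of L i ?xs] by (simp add: L_def)
    qed
    finally show ?thesis by simp
  qed
  have "(\<Sum>i<L. ?\<beta> l i + int i) = int (sum_list l)"
    by (simp add: L_def row_len_def sum_list_sum_nth atLeast0LessThan)
  then have "of_nat (sum_list l) * schur R (set vs) \<rho> (diagram l) =
      of_int (\<Sum>i<L. ?\<beta> l i + int i) * jt ?xs L (?\<beta> l)"
    using sch[OF l] by (simp add: L_def)
  also have "\<dots> = (\<Sum>s<M. power_sum ?xs (Suc s) * (\<Sum>i<L. jt ?xs L ((?\<beta> l)(i := ?\<beta> l i - int (Suc s)))))"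
  proof (rule jt_power_sums)
    fix i assume "i < L"
    show "?\<beta> l i + int L \<le> int M"
      using row_len_antimono[OF l, of 0 i] by (simp add: M_def)
  qed
  also have "\<dots> = (\<Sum>s<M. power_sum ?xs (Suc s) * ?T (Suc s))"
    by (simp only: T zero_less_Suc)
  also have "\<dots> = (\<Sum>s<N. power_sum ?xs (Suc s) * ?T (Suc s))"
    by (rule sum.mono_neutral_right) (use N strips_too_large[of l] in \<open>auto simp: M_def\<close>)
  finally show ?thesis .
qed

section \<open>Sums over removals of border strips\<close>

text \<open>Signed sum over \<open>removal_ways\<close> in recursive form; \<open>P j s\<close> is
  the weight of taking a strip of size \<open>s\<close> from component \<open>j\<close>.\<close>

fun strip_sum :: "(nat \<Rightarrow> nat \<Rightarrow> 'a::comm_ring_1) \<Rightarrow> nat list list \<Rightarrow> nat list \<Rightarrow> 'a" where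
  "strip_sum P g [] = (if \<forall>l\<in>set g. l = [] then 1 else 0)"
| "strip_sum P g (s # ss) = (\<Sum>j<length g. P j s *
     (\<Sum>(z, l')\<in>strips (g ! j) s. (-1) ^ strip_height z * strip_sum P (g[j := l']) ss))"

lemma strip_sum_removal_ways:
  assumes "\<And>l. l \<in> set g \<Longrightarrow> is_partition l"
  shows "finite (removal_ways g ss) \<and> (\<forall>w\<in>removal_ways g ss. length w = length ss) \<and>
    strip_sum P g ss = (\<Sum>w\<in>removal_ways g ss.
      \<Prod>t<length ss. P (fst (w ! t)) (ss ! t) * (-1) ^ strip_height (snd (w ! t)))"
  using assms
proof (induction ss arbitrary: g)
  case Nil
  then show ?case by simp
next
  case (Cons s ss)
  let ?S = "SIGMA j:{..<length g}. strips (g ! j) s"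
  let ?T = "SIGMA x:?S. case x of (j, z, l') \<Rightarrow> removal_ways (g[j := l']) ss"
  let ?f = "\<lambda>((j, z, l'), w). (j, z) # w"
  let ?G = "\<lambda>ss w. \<Prod>t<length ss. P (fst (w ! t)) (ss ! t) * (-1) ^ strip_height (snd (w ! t))"
  have part: "is_partition l" if "l \<in> set (g[j := l'])" "(z, l') \<in> strips (g ! j) s" for l j z l'
    using that Cons.prems set_update_subset_insert[of g j l'] strips_partition by fastforce
  note IH = Cons.IH[of "g[j := l']" for j l', OF part]
  have finS: "finite ?S" using Cons.prems by (intro finite_SigmaI) (auto intro: finite_strips)
  have eq: "removal_ways g (s # ss) = ?f ` ?T"
    by (auto simp: strips_def image_iff) blast+
  \<comment> \<open>The component and the strip determine the next partition, so no way of removal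
    is counted twice.\<close>
  have inj: "inj_on ?f ?T"
    by (rule inj_onI) (auto dest: strips_target_unique)
  have "finite ?T" using IH by (intro finite_SigmaI finS) auto
  then have fin: "finite (removal_ways g (s # ss))" unfolding eq by simp
  have "strip_sum P g (s # ss) = (\<Sum>(j, z, l')\<in>?S. P j s * ((-1) ^ strip_height z * strip_sum P (g[j := l']) ss))"
    using Cons.prems by (simp add: sum_distrib_left sum.Sigma finite_strips case_prod_unfold)
  also have "\<dots> = (\<Sum>x\<in>?S. \<Sum>w\<in>(case x of (j, z, l') \<Rightarrow> removal_ways (g[j := l']) ss). ?G (s # ss) (?f (x, w)))"
  proof (rule sum.cong[OF refl])
    fix x assume x: "x \<in> ?S"
    then obtain j z l' where x: "x = (j, z, l')" "(z, l') \<in> strips (g ! j) s" by auto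
    show "(case x of (j, z, l') \<Rightarrow> P j s * ((-1) ^ strip_height z * strip_sum P (g[j := l']) ss)) =
        (\<Sum>w\<in>(case x of (j, z, l') \<Rightarrow> removal_ways (g[j := l']) ss). ?G (s # ss) (?f (x, w)))"
      using IH[OF _ x(2)] unfolding x
      by (simp add: sum_distrib_left prod.lessThan_Suc_shift mult.assoc del: prod.lessThan_Suc)
  qed
  also have "\<dots> = (\<Sum>y\<in>?T. ?G (s # ss) (?f y))"
    using IH by (subst sum.Sigma) (auto simp: finS case_prod_unfold)
  also have "\<dots> = (\<Sum>w\<in>removal_ways g (s # ss). ?G (s # ss) w)"
    unfolding eq using sum.reindex[OF inj, of "?G (s # ss)"] by (simp add: o_def)
  finally show ?case
    using fin IH unfolding eq by auto
qed

definition schur_prod :: "('c \<times> 'c) set \<Rightarrow> (nat \<Rightarrow> 'c list) \<Rightarrow> ('c \<Rightarrow> 'a::comm_ring_1) \<Rightarrow> nat list list \<Rightarrow> 'a" where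
  "schur_prod R vs \<rho> g = (\<Prod>j<length g. schur R (set (vs j)) \<rho> (diagram (g ! j)))"

text \<open>One unfolding of \<open>strip_sum\<close> with the inner sums replaced by products of
  Schur polynomials; it is the term for strip size \<open>s\<close> in
  \<open>schur_prod_power_sums\<close>.\<close>

definition strip_expansion ::
  "('c \<times> 'c) set \<Rightarrow> (nat \<Rightarrow> 'c list) \<Rightarrow> ('c \<Rightarrow> 'a::comm_ring_1) \<Rightarrow> nat list list \<Rightarrow> nat \<Rightarrow> 'a" where
  "strip_expansion R vs \<rho> g s = (\<Sum>j<length g. power_sum (map \<rho> (vs j)) s *
     (\<Sum>(z, l')\<in>strips (g ! j) s. (-1) ^ strip_height z * schur_prod R vs \<rho> (g[j := l'])))"

text \<open>Product rule: the total number of cells is a sum over the components, and each summand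
  is handled by \<open>schur_power_sums\<close> in its own factor.\<close>

lemma schur_prod_power_sums:
  assumes g: "\<And>l. l \<in> set g \<Longrightarrow> is_partition l"
    and vs: "\<And>j. j < length g \<Longrightarrow> color_list R (vs j)"
    and N: "(\<Sum>l\<leftarrow>g. sum_list l) \<le> N"
  shows "of_nat (\<Sum>l\<leftarrow>g. sum_list l) * schur_prod R vs \<rho> g = (\<Sum>s<N. strip_expansion R vs \<rho> g (Suc s))"
proof -
  let ?S = "\<lambda>j l. schur R (set (vs j)) \<rho> (diagram l)"
  let ?rest = "\<lambda>j. \<Prod>i\<in>{..<length g} - {j}. ?S i (g ! i)"
  have upd: "schur_prod R vs \<rho> (g[j := l']) = ?S j l' * ?rest j" if "j < length g" for j l'
    unfolding schur_prod_def
    by (subst prod.remove[of _ j]) (use that in \<open>auto intro!: prod.cong\<close>)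
  have "of_nat (\<Sum>l\<leftarrow>g. sum_list l) * schur_prod R vs \<rho> g =
      (\<Sum>j<length g. of_nat (sum_list (g ! j)) * schur_prod R vs \<rho> g)"
    by (simp add: sum_list_sum_nth atLeast0LessThan sum_distrib_right)
  also have "\<dots> = (\<Sum>j<length g. \<Sum>s<N. power_sum (map \<rho> (vs j)) (Suc s) *
      (\<Sum>(z, l')\<in>strips (g ! j) (Suc s). (-1) ^ strip_height z * schur_prod R vs \<rho> (g[j := l'])))"
  proof (rule sum.cong[OF refl])
    fix j assume "j \<in> {..<length g}"
    then have j: "j < length g" by simp
    have "sum_list (g ! j) \<le> (\<Sum>l\<leftarrow>g. sum_list l)"
      using j by (intro member_le_sum_list) auto
    then have "of_nat (sum_list (g ! j)) * ?S j (g ! j) = (\<Sum>s<N. power_sum (map \<rho> (vs j)) (Suc s) *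
        (\<Sum>(z, l')\<in>strips (g ! j) (Suc s). (-1) ^ strip_height z * ?S j l'))"
      using j N by (intro schur_power_sums g vs) auto
    moreover have "schur_prod R vs \<rho> g = ?S j (g ! j) * ?rest j"
      using upd[OF j, of "g ! j"] by simp
    ultimately have "of_nat (sum_list (g ! j)) * schur_prod R vs \<rho> g =
        (\<Sum>s<N. power_sum (map \<rho> (vs j)) (Suc s) *
        (\<Sum>(z, l')\<in>strips (g ! j) (Suc s). (-1) ^ strip_height z * ?S j l')) * ?rest j"
      by (simp flip: mult.assoc)
    then show "of_nat (sum_list (g ! j)) * schur_prod R vs \<rho> g =
        (\<Sum>s<N. power_sum (map \<rho> (vs j)) (Suc s) *
        (\<Sum>(z, l')\<in>strips (g ! j) (Suc s). (-1) ^ strip_height z * schur_prod R vs \<rho> (g[j := l'])))"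
      by (simp add: upd[OF j] sum_distrib_right case_prod_unfold mult.assoc)
  qed
  also have "\<dots> = (\<Sum>s<N. strip_expansion R vs \<rho> g (Suc s))"
    unfolding strip_expansion_def by (rule sum.swap)
  finally show ?thesis .
qed

section \<open>Cycles of permutations\<close>

lemma Min_subset_eq:
  assumes "finite A" "M \<subseteq> A" "Min A \<in> M"
  shows "Min M = Min A"
proof (rule Min_eqI)
  show "finite M" using assms(1,2) finite_subset by blast
  show "Min A \<le> y" if "y \<in> M" for y
    using assms(1,2) that by (intro Min_le) auto
qed fact

text \<open>The analogue of \<open>cycle_list\<close> for a permutation of an arbitrary finite set;
  the induction over permutations deletes points.\<close>

definition cycle_enum :: "(nat \<Rightarrow> nat) \<Rightarrow> nat set \<Rightarrow> nat set list" where
  "cycle_enum q A = map (orbit q) (sorted_list_of_set (Min ` orbit q ` A))"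

context
  fixes q :: "nat \<Rightarrow> nat" and A :: "nat set"
  assumes q: "q permutes A" and fin: "finite A"
begin

lemma self_in_orbit: "x \<in> orbit q x"
proof (rule permutation_self_in_orbit)
  show "permutation q"
    unfolding permutation_permutes using q fin by blast
qed

lemma orbit_eqI: "y \<in> orbit q x \<Longrightarrow> orbit q y = orbit q x"
  by (metis orbit_swap orbit_trans self_in_orbit subset_antisym subsetI)

lemma orbit_in: "x \<in> A \<Longrightarrow> orbit q x \<subseteq> A"
  by (rule permutes_orbit_subset[OF q])

lemma finite_orbit_in: "x \<in> A \<Longrightarrow> finite (orbit q x)"
  using orbit_in finite_subset fin by blast

lemma Min_orbit_in: "x \<in> A \<Longrightarrow> Min (orbit q x) \<in> orbit q x"
  by (rule Min_in) (auto simp: finite_orbit_in orbit_nonempty)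

lemma orbit_Min: "x \<in> A \<Longrightarrow> orbit q (Min (orbit q x)) = orbit q x"
  by (rule orbit_eqI[OF Min_orbit_in])

lemma set_cycle_enum: "set (cycle_enum q A) = orbit q ` A"
proof -
  have "set (cycle_enum q A) = orbit q ` Min ` orbit q ` A"
    by (simp add: cycle_enum_def fin)
  also have "\<dots> = (\<lambda>x. orbit q (Min (orbit q x))) ` A" by (simp add: image_image)
  also have "\<dots> = orbit q ` A" by (rule image_cong) (auto simp: orbit_Min)
  finally show ?thesis .
qed

lemma distinct_cycle_enum: "distinct (cycle_enum q A)"
proof -
  have "inj_on (orbit q) (Min ` orbit q ` A)"
    by (rule inj_onI) (auto simp: orbit_Min)
  then show ?thesis by (simp add: cycle_enum_def distinct_map fin)
qed

end

lemma cycle_enum_empty [simp]: "cycle_enum q {} = []"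
  by (simp add: cycle_enum_def)

text \<open>The smallest cycle minimum is \<open>Min A\<close> itself, so its cycle stands at the
  head.\<close>

lemma cycle_enum_Cons:
  assumes q: "q permutes A" and fin: "finite A" and ne: "A \<noteq> {}"
  shows "cycle_enum q A = orbit q (Min A) #
    map (orbit q) (sorted_list_of_set (Min ` orbit q ` A - {Min A}))"
proof -
  let ?M = "Min ` orbit q ` A"
  have "Min A \<in> A" using fin ne by simp
  have "?M \<subseteq> A"
    using Min_orbit_in[OF q fin] orbit_in[OF q fin] by blast
  moreover have "Min (orbit q (Min A)) = Min A"
    by (rule Min_subset_eq[OF fin orbit_in[OF q fin \<open>Min A \<in> A\<close>] self_in_orbit[OF q fin]])
  then have "Min A \<in> ?M"
    using imageI[OF imageI[OF \<open>Min A \<in> A\<close>, of "orbit q"], of Min] by simp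
  ultimately have "Min ?M = Min A"
    by (intro Min_subset_eq[OF fin])
  moreover have "?M \<noteq> {}" using ne by simp
  ultimately show ?thesis
    unfolding cycle_enum_def
    using sorted_list_of_set_nonempty[of ?M] fin by simp
qed

lemma cycle_enum_fixed_Min:
  assumes q: "q permutes A - {a}" and fin: "finite A" and a: "a = Min A" "A \<noteq> {}"
  shows "cycle_enum q A = {a} # cycle_enum q (A - {a})"
proof -
  have qa: "q a = a" using q by (simp add: permutes_def)
  have "a \<in> A" unfolding a(1) using a(2) fin by (intro Min_in)
  have qA: "q permutes A" using q permutes_subset by blast
  have orb: "orbit q a = {a}" using qa by (simp add: orbit_eq_singleton_iff)
  have "orbit q ` A = insert {a} (orbit q ` (A - {a}))"
    using \<open>a \<in> A\<close> orb by auto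
  then have "Min ` orbit q ` A = insert a (Min ` orbit q ` (A - {a}))" by simp
  moreover have "a \<notin> Min ` orbit q ` (A - {a})"
  proof
    assume "a \<in> Min ` orbit q ` (A - {a})"
    then obtain x where x: "x \<in> A - {a}" "a = Min (orbit q x)" by blast
    then have "a \<in> orbit q x" using Min_orbit_in[OF q _ x(1)] fin by simp
    then show False using orbit_in[OF q _ x(1)] fin by auto
  qed
  ultimately show ?thesis
    unfolding cycle_enum_Cons[OF qA fin a(2)] a(1)[symmetric] by (simp add: orb cycle_enum_def)
qed

text \<open>Composition with the transposition inserts \<open>b\<close> into the cycle of
  \<open>a\<close> directly behind \<open>a\<close>. Since \<open>a\<close> stays the minimum of
  that cycle, the enumeration changes in its head only.\<close>

lemma cycle_enum_insert:
  assumes q: "q permutes A - {b}" and fin: "finite A" and a: "a = Min A" and b: "b \<in> A" "b \<noteq> a"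
  defines "p \<equiv> q \<circ> Transposition.transpose a b"
  shows "p permutes A" "cycle_enum p A = insert b (orbit q a) # tl (cycle_enum q (A - {b}))"
    "cycle_enum q (A - {b}) = orbit q a # tl (cycle_enum q (A - {b}))" "b \<notin> orbit q a"
proof -
  have aA: "a \<in> A" unfolding a using b fin by (intro Min_in) auto
  have qA: "q permutes A" using q permutes_subset by blast
  have finb: "finite (A - {b})" using fin by simp
  show pA: "p permutes A"
    unfolding p_def by (rule permutes_compose[OF permutes_swap_id qA]) (use aA b in auto)
  have qb: "q b = b" using q by (simp add: permutes_def)
  have pa: "p a = b" and pb: "p b = q a" and py: "\<And>y. y \<noteq> a \<Longrightarrow> y \<noteq> b \<Longrightarrow> p y = q y"
    using qb b by (auto simp: p_def Transposition.transpose_def)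
  let ?C = "orbit q a"
  have aC: "a \<in> ?C" by (rule self_in_orbit[OF qA fin])
  have C_sub: "?C \<subseteq> A - {b}" using orbit_in[OF q finb, of a] aA b by auto
  then show bC: "b \<notin> ?C" by auto
  have orb_a: "orbit p a = insert b ?C"
  proof
    show "orbit p a \<subseteq> insert b ?C"
    proof
      fix x assume "x \<in> orbit p a"
      then show "x \<in> insert b ?C"
      proof induction
        case (step y)
        then show ?case
          using py[of y] pa pb aC by (cases "y = a"; cases "y = b") (auto intro: orbit.intros)
      qed (simp add: pa)
    qed
    have b': "b \<in> orbit p a" using orbit.base[of p a] pa by simp
    have "x \<in> orbit p a" if "x \<in> ?C" for x
      using that
    proof induction
      case base
      show ?case using orbit.step[OF b'] pb by simp
    next
      case (step y)
      then show ?case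
        using py[of y] pb bC step(1) orbit.step[OF b'] orbit.step[OF step(2)]
        by (cases "y = a"; cases "y = b") auto
    qed
    with b' show "insert b ?C \<subseteq> orbit p a" by auto
  qed
  have orb_x: "orbit p x = orbit q x" if "x \<notin> insert b ?C" for x
  proof (rule orbit_cong)
    show "x \<in> orbit q x" by (rule self_in_orbit[OF qA fin])
    fix y assume y: "y \<in> orbit q x"
    have "orbit q y = orbit q x" using orbit_eqI[OF qA fin y] .
    moreover have "orbit q b = {b}" using qb by (simp add: orbit_eq_singleton_iff)
    ultimately have "y \<noteq> a" "y \<noteq> b"
      using that self_in_orbit[OF qA fin, of x] by auto
    then show "p y = q y" by (rule py)
  qed
  have MinA: "Min (A - {b}) = a"
    using fin aA b a by (intro Min_eqI) auto
  have ne: "A - {b} \<noteq> {}" using aA b by auto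
  have Min_orb: "Min (orbit p a) = a"
    unfolding orb_a using C_sub aC b unfolding a by (intro Min_subset_eq fin) auto
  have Min_orb_q: "Min (orbit q a) = a"
    unfolding a using C_sub aC fin a by (intro Min_subset_eq) auto
  \<comment> \<open>The point \<open>b\<close> joins a cycle whose minimum is \<open>a\<close>, so
    no cycle minimum is gained or lost.\<close>
  have mins: "Min ` orbit p ` A = Min ` orbit q ` (A - {b})"
  proof -
    have "Min (orbit p x) = Min (orbit q x)" if "x \<in> A - {b}" for x
    proof (cases "x \<in> ?C")
      case True
      then have "orbit p x = orbit p a" using orb_a orbit_eqI[OF pA fin] by auto
      then show ?thesis using orbit_eqI[OF qA fin True] Min_orb Min_orb_q by simp
    next
      case False
      then show ?thesis using orb_x that by simp
    qed
    moreover have "Min (orbit p b) = Min (orbit q a)"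
      using orbit_eqI[OF pA fin, of b a] orb_a Min_orb Min_orb_q by simp
    ultimately have "(\<lambda>x. Min (orbit p x)) ` A = (\<lambda>x. Min (orbit q x)) ` (A - {b})"
      using aA b by (auto simp: image_iff) metis
    then show ?thesis by (simp add: image_image)
  qed
  have rest: "orbit p m = orbit q m" if m_in: "m \<in> Min ` orbit q ` (A - {b}) - {a}" for m
  proof -
    obtain x where x: "x \<in> A - {b}" "m = Min (orbit q x)" using m_in by blast
    have m: "m \<in> orbit q x" using Min_orbit_in[OF q finb x(1)] x(2) by simp
    then have "m \<in> A - {b}" using orbit_in[OF q finb x(1)] by auto
    moreover have "m \<notin> ?C"
    proof
      assume "m \<in> ?C"
      then have "orbit q x = ?C" using orbit_eqI[OF qA fin] m by metis
      then show False using x(2) Min_orb_q m_in by simp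
    qed
    ultimately show ?thesis by (intro orb_x) auto
  qed
  have q_eq: "cycle_enum q (A - {b}) = orbit q a #
      map (orbit q) (sorted_list_of_set (Min ` orbit q ` (A - {b}) - {a}))"
    using cycle_enum_Cons[OF q finb ne] MinA by simp
  then show "cycle_enum q (A - {b}) = orbit q a # tl (cycle_enum q (A - {b}))" by simp
  have "cycle_enum p A = orbit p a #
      map (orbit p) (sorted_list_of_set (Min ` orbit p ` A - {a}))"
    using cycle_enum_Cons[OF pA fin] aA a by auto
  also have "map (orbit p) (sorted_list_of_set (Min ` orbit p ` A - {a})) =
      map (orbit q) (sorted_list_of_set (Min ` orbit q ` (A - {b}) - {a}))"
    unfolding mins by (rule map_cong[OF refl]) (use rest fin in auto)
  finally show "cycle_enum p A = insert b (orbit q a) # tl (cycle_enum q (A - {b}))"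
    unfolding q_eq orb_a by simp
qed

text \<open>Permutations are sorted by the image \<open>b\<close> of \<open>a\<close>. Cutting
  \<open>b\<close> out of the cycle of \<open>a\<close> leaves a permutation fixing
  \<open>b\<close>; for \<open>b = a\<close> the transposition is the identity.\<close>

lemma sum_permutes_remove:
  fixes f :: "('b \<Rightarrow> 'b) \<Rightarrow> 'a::comm_monoid_add"
  assumes "finite A" "a \<in> A"
  shows "(\<Sum>p | p permutes A. f p) =
    (\<Sum>b\<in>A. \<Sum>q | q permutes A - {b}. f (q \<circ> Transposition.transpose a b))"
proof -
  have "(\<Sum>p | p permutes A. f p) =
      (\<Sum>(b, q)\<in>(SIGMA b:A. {q. q permutes A - {b}}). f (q \<circ> Transposition.transpose a b))"
  proof (rule sum.reindex_bij_witness[where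
        i = "\<lambda>(b, q). q \<circ> Transposition.transpose a b" and j = "\<lambda>p. (p a, p \<circ> Transposition.transpose a (p a))"])
    fix p assume p: "p \<in> {p. p permutes A}"
    then have pa: "p a \<in> A" using assms(2) by (simp add: permutes_in_image)
    let ?q = "p \<circ> Transposition.transpose a (p a)"
    have "?q permutes A"
      using p pa assms by (intro permutes_compose[OF permutes_swap_id]) auto
    then have "?q permutes A - {p a}"
      by (rule permutes_superset) auto
    then show "(p a, ?q) \<in> (SIGMA b:A. {q. q permutes A - {b}})" using pa by simp
    show "(case (p a, ?q) of (b, q) \<Rightarrow> q \<circ> Transposition.transpose a b) = p"
      by (simp add: fun_eq_iff)
    then show "(case (p a, ?q) of (b, q) \<Rightarrow> f (q \<circ> Transposition.transpose a b)) = f p"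
      by simp
  next
    fix x assume "x \<in> (SIGMA b:A. {q. q permutes A - {b}})"
    then obtain b q where x: "x = (b, q)" "b \<in> A" "q permutes A - {b}" by auto
    have qb: "q b = b" using x(3) by (simp add: permutes_def)
    have "q permutes A" using x(3) permutes_subset by blast
    then show "(case x of (b, q) \<Rightarrow> q \<circ> Transposition.transpose a b) \<in> {p. p permutes A}"
      using x assms by (auto intro!: permutes_compose[OF permutes_swap_id])
    show "((case x of (b, q) \<Rightarrow> q \<circ> Transposition.transpose a b) a,
        (case x of (b, q) \<Rightarrow> q \<circ> Transposition.transpose a b) \<circ>
        Transposition.transpose a ((case x of (b, q) \<Rightarrow> q \<circ> Transposition.transpose a b) a)) = x"
      using qb by (simp add: x fun_eq_iff)
  qed
  also have "\<dots> = (\<Sum>b\<in>A. \<Sum>q | q permutes A - {b}. f (q \<circ> Transposition.transpose a b))"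
    by (rule sum.Sigma[symmetric]) (use assms in \<open>auto intro: finite_permutations\<close>)
  finally show ?thesis .
qed

section \<open>Recursion over the cycle of the smallest element\<close>

text \<open>
  The induction over permutations removes the elements of the first cycle one at a time, the
  smallest one last; \<open>bump e\<close> accounts for the \<open>e\<close> elements removed so far.
\<close>

fun bump :: "nat \<Rightarrow> nat list \<Rightarrow> nat list" where
  "bump e [] = []"
| "bump e (s # ss) = (s + e) # ss"

lemma bump_0 [simp]: "bump 0 ss = ss"
  by (cases ss) auto

lemma schur_empty [simp]: "schur R X \<rho> {} = 1"
  by (simp add: schur_def fillings_def)

locale colored_schur =
  fixes R :: "('c \<times> 'c) set" and vs :: "nat \<Rightarrow> 'c list" and \<rho> :: "'c \<Rightarrow> 'a::comm_ring_1" and k :: nat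
  assumes vs: "\<And>j. j < k \<Longrightarrow> color_list R (vs j)"
begin

definition psum :: "nat \<Rightarrow> nat \<Rightarrow> 'a" where
  "psum j s = power_sum (map \<rho> (vs j)) s"

text \<open>Let \<open>m = card A\<close> and let \<open>a\<close> be the minimum. Either
  \<open>a\<close> is fixed, the first cycle closes with size \<open>Suc e\<close>, and
  \<open>(m - 1)!\<close> times products of Schur polynomials remain; or one of the
  \<open>m - 1\<close> other points follows \<open>a\<close> and is absorbed into \<open>e\<close>,
  each choice contributing \<open>(m - 2)!\<close> by induction. Both cases have the factor
  \<open>(m - 1)!\<close>, so every size of the first cycle gets the same weight.\<close>

lemma strip_sum_cycles_bump:
  assumes "finite A" "A \<noteq> {}" "is_multipartition k (card A + e) g"
  shows "(\<Sum>p | p permutes A. strip_sum psum g (bump e (map card (cycle_enum p A)))) =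
      of_nat (fact (card A - 1)) * (\<Sum>s<card A. strip_expansion R vs \<rho> g (Suc (s + e)))"
  using assms
proof (induction "card A" arbitrary: A e g rule: less_induct)
  case less
  let ?X = "strip_expansion R vs \<rho>"
  let ?c = "\<lambda>p A. map card (cycle_enum p A)"
  define a where "a = Min A"
  have a: "a \<in> A" using less.prems by (simp add: a_def)
  have m: "card A > 0" using less.prems by (simp add: card_gt_0_iff)
  \<comment> \<open>The case without absorbed points, for smaller sets: the number of cells from
    \<open>schur_prod_power_sums\<close> completes the factorial.\<close>
  have whole: "(\<Sum>q | q permutes B. strip_sum psum g' (?c q B)) = of_nat (fact (card B)) * schur_prod R vs \<rho> g'"
    if B: "finite B" "card B < card A" and g': "is_multipartition k (card B) g'" for B g'
  proof (cases "B = {}")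
    case True
    have g'0: "l = []" if "l \<in> set g'" for l
    proof -
      have "sum_list l \<le> 0"
        using g' True that member_le_sum_list[of "sum_list l" "map sum_list g'"]
        by (auto simp: is_multipartition_def)
      moreover have "0 \<notin> set l" using g' that by (auto simp: is_multipartition_def is_partition_def)
      ultimately show ?thesis by (cases l) auto
    qed
    then have "schur_prod R vs \<rho> g' = 1"
      unfolding schur_prod_def
    proof (intro prod.neutral ballI)
      fix j assume "j \<in> {..<length g'}"
      then have "g' ! j = []" using g'0 by simp
      then show "schur R (set (vs j)) \<rho> (diagram (g' ! j)) = 1" by (simp add: diagram_def)
    qed
    then show ?thesis using True g'0 by simp
  next
    case False
    have "(\<Sum>q | q permutes B. strip_sum psum g' (?c q B)) =
        of_nat (fact (card B - 1)) * (\<Sum>s<card B. ?X g' (Suc s))"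
      using less.hyps[of B 0 g'] B False g' by simp
    also have "(\<Sum>s<card B. ?X g' (Suc s)) = of_nat (card B) * schur_prod R vs \<rho> g'"
      using schur_prod_power_sums[of g' R vs "card B" \<rho>] g' vs by (auto simp: is_multipartition_def)
    also have "of_nat (fact (card B - 1)) * (of_nat (card B) * schur_prod R vs \<rho> g') =
        of_nat (fact (card B)) * schur_prod R vs \<rho> g'"
      using False B by (subst (2) fact_reduce) (simp_all add: card_gt_0_iff algebra_simps)
    finally show ?thesis .
  qed
  \<comment> \<open>Here the first cycle is complete: a strip of size \<open>Suc e\<close> is
    removed for it, and \<open>whole\<close> sums over the remaining cycles.\<close>
  have fixed: "(\<Sum>q | q permutes A - {a}. strip_sum psum g (bump e (?c q A))) =
      of_nat (fact (card A - 1)) * ?X g (Suc e)"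
  proof -
    have card: "card (A - {a}) = card A - 1" "card (A - {a}) < card A"
      using a less.prems(1) m by auto
    have "(\<Sum>q | q permutes A - {a}. strip_sum psum g (bump e (?c q A))) =
        (\<Sum>q | q permutes A - {a}. strip_sum psum g (Suc e # ?c q (A - {a})))"
      by (rule sum.cong) (use cycle_enum_fixed_Min[OF _ less.prems(1) a_def less.prems(2)] in auto)
    also have "\<dots> = (\<Sum>j<length g. psum j (Suc e) * (\<Sum>(z, l')\<in>strips (g ! j) (Suc e).
        (-1) ^ strip_height z * (\<Sum>q | q permutes A - {a}. strip_sum psum (g[j := l']) (?c q (A - {a})))))"
      by (simp add: sum_distrib_left case_prod_unfold sum.swap[of _ "{q. q permutes A - {a}}"])
    also have "\<dots> = (\<Sum>j<length g. psum j (Suc e) * (\<Sum>(z, l')\<in>strips (g ! j) (Suc e).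
        (-1) ^ strip_height z * (of_nat (fact (card A - 1)) * schur_prod R vs \<rho> (g[j := l']))))"
    proof (intro sum.cong refl arg_cong2[of _ _ _ _ "(*)"])
      fix j x assume j: "j \<in> {..<length g}" and "x \<in> strips (g ! j) (Suc e)"
      then obtain z l' where x: "x = (z, l')" "(z, l') \<in> strips (g ! j) (Suc e)" by (cases x) auto
      have "is_multipartition k (card (A - {a})) (g[j := l'])"
        unfolding is_multipartition_def
      proof (intro conjI ballI)
        show "length (g[j := l']) = k" using less.prems(3) by (simp add: is_multipartition_def)
        show "is_partition l" if "l \<in> set (g[j := l'])" for l
          using that less.prems(3) set_update_subset_insert[of g j l'] strips_partition[OF x(2)]
          by (auto simp: is_multipartition_def)
        have "(\<Sum>l\<leftarrow>g. sum_list l) = (\<Sum>l\<leftarrow>g[j := l']. sum_list l) + Suc e"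
        proof -
          have "sum_list (g ! j) \<le> (\<Sum>l\<leftarrow>g. sum_list l)"
            by (rule member_le_sum_list) (use j in auto)
          then show ?thesis
            using j strips_sum_list[OF x(2)] by (simp add: map_update sum_list_update)
        qed
        then show "(\<Sum>l\<leftarrow>g[j := l']. sum_list l) = card (A - {a})"
          using less.prems(3) card(1) m unfolding is_multipartition_def by linarith
      qed
      then show "(case x of (z, l') \<Rightarrow> (-1) ^ strip_height z *
            (\<Sum>q | q permutes A - {a}. strip_sum psum (g[j := l']) (?c q (A - {a})))) =
          (case x of (z, l') \<Rightarrow> (-1) ^ strip_height z *
            (of_nat (fact (card A - 1)) * schur_prod R vs \<rho> (g[j := l'])))"
        using whole[of "A - {a}"] less.prems(1) card x by simp
    qed
    also have "\<dots> = of_nat (fact (card A - 1)) * ?X g (Suc e)"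
      by (simp add: strip_expansion_def psum_def sum_distrib_left case_prod_unfold mult_ac)
    finally show ?thesis .
  qed
  \<comment> \<open>Here \<open>a\<close> is mapped to \<open>b\<close>: deleting \<open>b\<close>
    shortens the first cycle by one, which \<open>bump (Suc e)\<close> compensates.\<close>
  have moved: "(\<Sum>q | q permutes A - {b}. strip_sum psum g (bump e (?c (q \<circ> Transposition.transpose a b) A))) =
      of_nat (fact (card A - 2)) * (\<Sum>s<card A - 1. ?X g (Suc (Suc s + e)))" if b: "b \<in> A - {a}" for b
  proof -
    have card: "card (A - {b}) = card A - 1" "card (A - {b}) < card A"
      using b less.prems(1) m by auto
    have ne: "A - {b} \<noteq> {}" using a b by auto
    have "(\<Sum>q | q permutes A - {b}. strip_sum psum g (bump e (?c (q \<circ> Transposition.transpose a b) A))) =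
        (\<Sum>q | q permutes A - {b}. strip_sum psum g (bump (Suc e) (?c q (A - {b}))))"
    proof (rule sum.cong[OF refl])
      fix q assume "q \<in> {q. q permutes A - {b}}"
      then have q: "q permutes A - {b}" by simp
      note ins = cycle_enum_insert[OF q less.prems(1) a_def]
      have b': "b \<in> A" "b \<noteq> a" using b by auto
      have "q permutes A" using q permutes_subset by blast
      then have "finite (orbit q a)"
        using finite_orbit_in[OF _ less.prems(1) a] by blast
      then have "card (insert b (orbit q a)) = Suc (card (orbit q a))"
        using ins(4)[OF b'] by simp
      then have "bump e (?c (q \<circ> Transposition.transpose a b) A) = bump (Suc e) (?c q (A - {b}))"
        unfolding ins(2)[OF b'] by (subst ins(3)[OF b']) simp
      then show "strip_sum psum g (bump e (?c (q \<circ> Transposition.transpose a b) A)) =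
          strip_sum psum g (bump (Suc e) (?c q (A - {b})))" by simp
    qed
    also have "\<dots> = of_nat (fact (card (A - {b}) - 1)) * (\<Sum>s<card (A - {b}). ?X g (Suc (s + Suc e)))"
      by (rule less.hyps) (use less.prems card ne m in auto)
    finally show ?thesis using card by (simp add: numeral_2_eq_2)
  qed
  have "(\<Sum>p | p permutes A. strip_sum psum g (bump e (?c p A))) =
      (\<Sum>b\<in>A. \<Sum>q | q permutes A - {b}. strip_sum psum g (bump e (?c (q \<circ> Transposition.transpose a b) A)))"
    by (rule sum_permutes_remove) (use a less.prems in auto)
  also have "\<dots> = of_nat (fact (card A - 1)) * ?X g (Suc e) +
      (\<Sum>b\<in>A - {a}. of_nat (fact (card A - 2)) * (\<Sum>s<card A - 1. ?X g (Suc (Suc s + e))))"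
    using a less.prems(1) fixed moved by (simp add: sum.remove)
  also have "(\<Sum>b\<in>A - {a}. of_nat (fact (card A - 2)) * (\<Sum>s<card A - 1. ?X g (Suc (Suc s + e)))) =
      of_nat (fact (card A - 1)) * (\<Sum>s<card A - 1. ?X g (Suc (Suc s + e)))"
  \<comment> \<open>For a single point there is no \<open>b\<close> to choose and
    \<open>card A - 2\<close> is truncated, so this case stays apart.\<close>
  proof (cases "card A = 1")
    case False
    then have "fact (card A - 1) = (card A - 1) * (fact (card A - 2) :: nat)"
      using m by (subst fact_reduce) (auto simp: numeral_2_eq_2)
    then show ?thesis using a less.prems(1) by (simp add: mult.assoc)
  qed (use a less.prems(1) in simp)
  also have "of_nat (fact (card A - 1)) * ?X g (Suc e) +
      of_nat (fact (card A - 1)) * (\<Sum>s<card A - 1. ?X g (Suc (Suc s + e))) =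
      of_nat (fact (card A - 1)) * (\<Sum>s<Suc (card A - 1). ?X g (Suc (s + e)))"
    unfolding sum.lessThan_Suc_shift by (simp add: distrib_left)
  finally show ?case using m by simp
qed

text \<open>A form of the Frobenius character formula: power sums of the cycle lengths, weighted by
  signed border strip removals, add up to a product of Schur polynomials times a factorial.\<close>

lemma strip_sum_cycles:
  assumes "finite A" "A \<noteq> {}" "is_multipartition k (card A) g"
  shows "(\<Sum>p | p permutes A. strip_sum psum g (map card (cycle_enum p A))) =
      of_nat (fact (card A)) * schur_prod R vs \<rho> g"
proof -
  have "(\<Sum>p | p permutes A. strip_sum psum g (map card (cycle_enum p A))) =
      of_nat (fact (card A - 1)) * (\<Sum>s<card A. strip_expansion R vs \<rho> g (Suc s))"
    using strip_sum_cycles_bump[of A 0 g] assms by simp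
  also have "(\<Sum>s<card A. strip_expansion R vs \<rho> g (Suc s)) = of_nat (card A) * schur_prod R vs \<rho> g"
    using schur_prod_power_sums[of g R vs "card A" \<rho>] assms(3) vs by (auto simp: is_multipartition_def)
  finally show ?thesis
    using assms(1,2) by (subst fact_reduce) (simp_all add: card_gt_0_iff algebra_simps)
qed

end

section \<open>Averaging over the wreath product\<close>

lemma qconst_0 [simp]: "qconst 0 = 0" by (simp add: qconst_def)
lemma qconst_1 [simp]: "qconst 1 = 1" by (simp add: qconst_def)
lemma qconst_add: "qconst (a + b) = qconst a + qconst b" by (simp add: qconst_def single_add)
lemma qconst_mult: "qconst (a * b) = qconst a * qconst b" by (simp add: qconst_def mult_single)
lemma qconst_minus: "qconst (- a) = - qconst a" by (simp add: qconst_def single_uminus)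

lemma qconst_sum: "qconst (\<Sum>x\<in>A. f x) = (\<Sum>x\<in>A. qconst (f x))"
  by (induction A rule: infinite_finite_induct) (auto simp: qconst_add)

lemma qconst_prod: "qconst (\<Prod>x\<in>A. f x) = (\<Prod>x\<in>A. qconst (f x))"
  by (induction A rule: infinite_finite_induct) (auto simp: qconst_mult)

lemma qconst_power: "qconst (a ^ m) = qconst a ^ m"
  by (induction m) (auto simp: qconst_mult)

lemma qconst_of_nat: "qconst (of_nat m) = of_nat m"
  by (induction m) (auto simp: qconst_add)

abbreviation unit_roots :: "nat \<Rightarrow> complex set" where
  "unit_roots k \<equiv> unit_root k ` {..<k}"

lemma unit_root_nonzero [simp]: "unit_root k j \<noteq> 0"
  by (simp add: unit_root_def)

lemma unit_root_power: "unit_root k j = unit_root k 1 ^ j"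
  by (simp add: unit_root_def exp_of_nat_mult[symmetric] mult_ac)

lemma cnj_unit_root: "cnj (unit_root k j) = inverse (unit_root k j)"
  by (simp add: unit_root_def exp_cnj exp_minus)

lemma unit_root_1_powi_eq_1:
  assumes "k \<ge> 1"
  shows "unit_root k 1 powi m = 1 \<longleftrightarrow> int k dvd m"
proof -
  have "unit_root k 1 powi m = exp (2 * of_real pi * \<i> / of_nat k * of_int m)"
    unfolding unit_root_def by (simp add: exp_power_int mult_ac)
  also have "\<dots> = 1 \<longleftrightarrow> (\<exists>l::int. 2 * pi * of_int m / of_nat k = of_int (2 * l) * pi)"
    by (simp add: exp_eq_1 mult_ac)
  also have "\<dots> \<longleftrightarrow> (\<exists>l::int. m = l * int k)"
  proof (intro ex_cong1)
    fix l :: int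
    have "2 * pi * of_int m / of_nat k = of_int (2 * l) * pi \<longleftrightarrow> real_of_int m = of_int l * of_nat k"
      using assms by (auto simp: field_simps)
    also have "\<dots> \<longleftrightarrow> real_of_int m = real_of_int (l * int k)" by simp
    finally show "2 * pi * of_int m / of_nat k = of_int (2 * l) * pi \<longleftrightarrow> m = l * int k"
      by (simp only: of_int_eq_iff)
  qed
  finally show ?thesis by (auto simp: dvd_def mult.commute)
qed

lemma inj_on_unit_root:
  assumes "k \<ge> 1"
  shows "inj_on (unit_root k) {..<k}"
proof (rule inj_onI)
  fix i j assume ij: "i \<in> {..<k}" "j \<in> {..<k}" "unit_root k i = unit_root k j"
  have "unit_root k 1 powi (int i - int j) = 1"
    using ij(3) by (simp add: power_int_diff unit_root_power[of k i] unit_root_power[of k j])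
  then have "int k dvd int i - int j" using unit_root_1_powi_eq_1[OF assms] by blast
  moreover have "\<bar>int i - int j\<bar> < int k" using ij(1,2) by auto
  ultimately show "i = j"
    using dvd_imp_le_int[of "int i - int j" "int k"] by (cases "i = j") auto
qed

text \<open>A geometric sum whose ratio \<open>z\<close> is a \<open>k\<close>-th root of unity,
  equal to 1 exactly under the congruence. This is the orthogonality of the characters of a cyclic
  group.\<close>

lemma sum_unit_roots:
  assumes "k \<ge> 1"
  shows "(\<Sum>x\<in>unit_roots k. x powi a * cnj x ^ j) = (if [a = int j] (mod int k) then of_nat k else 0)"
proof -
  define z where "z = unit_root k 1 powi (a - int j)"
  have tm: "unit_root k i powi a * cnj (unit_root k i) ^ j = z ^ i" for i
  proof -
    have "unit_root k i powi a * cnj (unit_root k i) ^ j = unit_root k i powi (a - int j)"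
      by (simp add: cnj_unit_root power_int_diff power_inverse divide_inverse)
    also have "\<dots> = z ^ i"
      unfolding z_def unit_root_power[of k i]
      by (simp flip: power_int_of_nat power_int_mult add: mult.commute)
    finally show ?thesis .
  qed
  have "(\<Sum>x\<in>unit_roots k. x powi a * cnj x ^ j) = (\<Sum>i<k. z ^ i)"
    by (simp add: sum.reindex[OF inj_on_unit_root[OF assms]] tm)
  also have "\<dots> = (if [a = int j] (mod int k) then of_nat k else 0)"
  proof (cases "z = 1")
    case True
    then show ?thesis
      using unit_root_1_powi_eq_1[OF assms, of "a - int j"] by (simp add: z_def cong_iff_dvd_diff)
  next
    case False
    have "z ^ k = 1"
      unfolding z_def
      using unit_root_1_powi_eq_1[OF assms, of "(a - int j) * int k"]
      by (simp flip: power_int_of_nat power_int_mult)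
    then have "(\<Sum>i<k. z ^ i) = 0" using False by (simp add: geometric_sum)
    then show ?thesis
      using False unit_root_1_powi_eq_1[OF assms, of "a - int j"] by (simp add: z_def cong_iff_dvd_diff)
  qed
  finally show ?thesis .
qed

section \<open>Wreath product elements as pairs of a permutation and a family of roots of
  unity\<close>

definition monomial_mat :: "nat \<Rightarrow> (nat \<Rightarrow> nat) \<Rightarrow> (nat \<Rightarrow> complex) \<Rightarrow> complex mat" where
  "monomial_mat n p u = Matrix.mat n n (\<lambda>(i, j). if j = p i then u i else 0)"

lemma wreath_perm:
  assumes "\<sigma> \<in> wreath k n"
  shows "dim_row \<sigma> = n" "perm_of \<sigma> permutes {..<n}" "i < n \<Longrightarrow> entry_of \<sigma> i \<in> unit_roots k"
    "\<sigma> = monomial_mat n (perm_of \<sigma>) (entry_of \<sigma>)"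
proof -
  have dim: "dim_row \<sigma> = n" "dim_col \<sigma> = n"
    and rows: "\<And>i. i < n \<Longrightarrow> \<exists>!j. j < n \<and> \<sigma> $$ (i, j) \<noteq> 0"
    and cols: "\<And>j. j < n \<Longrightarrow> \<exists>!i. i < n \<and> \<sigma> $$ (i, j) \<noteq> 0"
    and ent: "\<And>i j. i < n \<Longrightarrow> j < n \<Longrightarrow> \<sigma> $$ (i, j) \<noteq> 0 \<Longrightarrow> \<sigma> $$ (i, j) \<in> unit_roots k"
    using assms unfolding wreath_def by auto
  show "dim_row \<sigma> = n" by fact
  have p: "perm_of \<sigma> i < n \<and> \<sigma> $$ (i, perm_of \<sigma> i) \<noteq> 0" if "i < n" for i
    unfolding perm_of_def using theI'[OF rows[OF that]] that dim by simp
  have uniq: "j = perm_of \<sigma> i" if "i < n" "j < n" "\<sigma> $$ (i, j) \<noteq> 0" for i j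
    using rows[OF that(1)] p[OF that(1)] that by auto
  have "inj_on (perm_of \<sigma>) {..<n}"
  proof (rule inj_onI)
    fix i i' assume i: "i \<in> {..<n}" "i' \<in> {..<n}" "perm_of \<sigma> i = perm_of \<sigma> i'"
    show "i = i'"
      using cols[of "perm_of \<sigma> i"] p[of i] p[of i'] i by auto
  qed
  moreover have "perm_of \<sigma> ` {..<n} \<subseteq> {..<n}" using p by auto
  ultimately have "bij_betw (perm_of \<sigma>) {..<n} {..<n}"
    by (simp add: bij_betw_def endo_inj_surj)
  then show "perm_of \<sigma> permutes {..<n}"
    by (rule bij_imp_permutes) (simp add: perm_of_def dim)
  show "entry_of \<sigma> i \<in> unit_roots k" if "i < n"
    using ent[of i "perm_of \<sigma> i"] p[OF that] that dim by (simp add: entry_of_def)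
  show "\<sigma> = monomial_mat n (perm_of \<sigma>) (entry_of \<sigma>)"
    unfolding monomial_mat_def
    by (rule eq_matI) (use uniq dim in \<open>auto simp: entry_of_def\<close>)
qed

lemma monomial_mat_wreath:
  assumes p: "p permutes {..<n}" and u: "u \<in> {..<n} \<rightarrow> unit_roots k"
  shows "monomial_mat n p u \<in> wreath k n" "perm_of (monomial_mat n p u) = p"
    "i < n \<Longrightarrow> entry_of (monomial_mat n p u) i = u i"
proof -
  let ?A = "monomial_mat n p u"
  have pn: "p i < n" if "i < n" for i using permutes_in_image[OF p, of i] that by simp
  have nz: "u i \<noteq> 0" if "i < n" for i using Pi_mem[OF u, of i] that by auto
  have A: "?A $$ (i, j) = (if j = p i then u i else 0)" if "i < n" "j < n" for i j
    using that by (simp add: monomial_mat_def)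
  have dim: "dim_row ?A = n" "dim_col ?A = n" by (auto simp: monomial_mat_def)
  have inv: "j = p i \<longleftrightarrow> i = inv_into UNIV p j" for i j
    by (metis permutes_inv_eq[OF p])
  show W: "?A \<in> wreath k n"
    unfolding wreath_def
  proof (intro CollectI conjI allI impI)
    show "?A \<in> carrier_mat n n" using dim by auto
    show "\<exists>!j. j < n \<and> ?A $$ (i, j) \<noteq> 0" if "i < n" for i
      by (rule ex1I[of _ "p i"]) (use that pn nz A in \<open>auto split: if_splits\<close>)
    show "\<exists>!i. i < n \<and> ?A $$ (i, j) \<noteq> 0" if "j < n" for j
    proof (rule ex1I[of _ "inv_into UNIV p j"])
      have "inv_into UNIV p j < n" using permutes_in_image[OF permutes_inv[OF p], of j] that by simp
      then show "inv_into UNIV p j < n \<and> ?A $$ (inv_into UNIV p j, j) \<noteq> 0"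
        using that nz A inv[of j "inv_into UNIV p j"] by auto
      show "i = inv_into UNIV p j" if "i < n \<and> ?A $$ (i, j) \<noteq> 0" for i
        using that A[of i j] inv \<open>j < n\<close> by (auto split: if_splits)
    qed
    show "?A $$ (i, j) \<in> unit_roots k" if "i < n" "j < n" "?A $$ (i, j) \<noteq> 0" for i j
      using that A u by (auto split: if_splits)
  qed
  have perm: "perm_of ?A i = p i" for i
  proof (cases "i < n")
    case True
    have "perm_of ?A i = (THE j. j < n \<and> ?A $$ (i, j) \<noteq> 0)"
      using True dim by (simp add: perm_of_def)
    also have "\<dots> = p i"
      by (rule the_equality) (use True pn nz A in \<open>auto split: if_splits\<close>)
    finally show ?thesis .
  next
    case False
    then show ?thesis using dim p by (simp add: perm_of_def permutes_def)
  qed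
  then show "perm_of ?A = p" by auto
  show "entry_of ?A i = u i" if "i < n"
    using that dim pn A by (simp add: entry_of_def perm)
qed

lemma sum_wreath:
  "(\<Sum>\<sigma>\<in>wreath k n. h \<sigma>) =
    (\<Sum>p | p permutes {..<n}. \<Sum>u\<in>{..<n} \<rightarrow>\<^sub>E unit_roots k. h (monomial_mat n p u))"
proof -
  have "(\<Sum>\<sigma>\<in>wreath k n. h \<sigma>) =
      (\<Sum>(p, u)\<in>{p. p permutes {..<n}} \<times> ({..<n} \<rightarrow>\<^sub>E unit_roots k). h (monomial_mat n p u))"
  proof (rule sum.reindex_bij_witness[where i = "\<lambda>(p, u). monomial_mat n p u"
        and j = "\<lambda>\<sigma>. (perm_of \<sigma>, restrict (entry_of \<sigma>) {..<n})"])
    fix \<sigma> assume \<sigma>: "\<sigma> \<in> wreath k n"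
    note W = wreath_perm[OF \<sigma>]
    have eq: "monomial_mat n (perm_of \<sigma>) (restrict (entry_of \<sigma>) {..<n}) = \<sigma>"
      by (subst (3) W(4)) (auto simp: monomial_mat_def intro!: cong_mat)
    then show "(case (perm_of \<sigma>, restrict (entry_of \<sigma>) {..<n}) of (p, u) \<Rightarrow> monomial_mat n p u) = \<sigma>"
      "(case (perm_of \<sigma>, restrict (entry_of \<sigma>) {..<n}) of (p, u) \<Rightarrow> h (monomial_mat n p u)) = h \<sigma>"
      by simp_all
    show "(perm_of \<sigma>, restrict (entry_of \<sigma>) {..<n}) \<in>
        {p. p permutes {..<n}} \<times> ({..<n} \<rightarrow>\<^sub>E unit_roots k)"
      using W by auto
  next
    fix x assume "x \<in> {p. p permutes {..<n}} \<times> ({..<n} \<rightarrow>\<^sub>E unit_roots k)"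
    then obtain p u where x: "x = (p, u)" "p permutes {..<n}" "u \<in> {..<n} \<rightarrow>\<^sub>E unit_roots k" by auto
    have u: "u \<in> {..<n} \<rightarrow> unit_roots k" using x(3) by auto
    note M = monomial_mat_wreath[OF x(2) u]
    have "restrict (entry_of (monomial_mat n p u)) {..<n} = u"
      using M(3) x(3) by (auto simp: fun_eq_iff PiE_def extensional_def)
    then show "(perm_of (case x of (p, u) \<Rightarrow> monomial_mat n p u),
        restrict (entry_of (case x of (p, u) \<Rightarrow> monomial_mat n p u)) {..<n}) = x"
      using M(2) by (simp add: x)
    show "(case x of (p, u) \<Rightarrow> monomial_mat n p u) \<in> wreath k n"
      using M(1) by (simp add: x)
  qed
  then show ?thesis by (simp add: sum.cartesian_product)
qed

lemma removal_ways_component: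
  "w \<in> removal_ways g ss \<Longrightarrow> t < length ss \<Longrightarrow> fst (w ! t) < length g"
proof (induction ss arbitrary: g w t)
  case (Cons s ss)
  then obtain j z l' w' where w: "w = (j, z) # w'" "j < length g" "w' \<in> removal_ways (g[j := l']) ss"
    by auto
  then show ?case
    using Cons.IH[OF w(3)] Cons.prems(2) by (cases t) auto
qed simp

text \<open>For colorings it only matters that the cycles partition the index set. The blocks come
  as a list because steps of a removal are matched with cycles by position.\<close>

locale set_list =
  fixes cs :: "'i set list" and A :: "'i set"
  assumes fin: "finite A" and un: "\<Union>(set cs) = A" and ne: "{} \<notin> set cs" and dist: "distinct cs"
    and disj: "\<And>c c'. c \<in> set cs \<Longrightarrow> c' \<in> set cs \<Longrightarrow> c \<noteq> c' \<Longrightarrow> c \<inter> c' = {}"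
begin

definition idx :: "'i \<Rightarrow> nat" where
  "idx i = (THE t. t < length cs \<and> i \<in> cs ! t)"

lemma idx_eq: "t < length cs \<Longrightarrow> i \<in> cs ! t \<Longrightarrow> idx i = t"
  unfolding idx_def
proof (rule the_equality)
  fix t' assume t: "t < length cs" "i \<in> cs ! t" and t': "t' < length cs \<and> i \<in> cs ! t'"
  then have "cs ! t' = cs ! t" using disj[of "cs ! t'" "cs ! t"] by auto
  then show "t' = t" using dist t(1) t' nth_eq_iff_index_eq by blast
qed simp

lemma part_subset: "t < length cs \<Longrightarrow> cs ! t \<subseteq> A"
  using un by auto

lemma idx: assumes "i \<in> A" shows "idx i < length cs" "i \<in> cs ! idx i"
proof -
  obtain t where "t < length cs" "i \<in> cs ! t"
    using assms un by (auto simp: in_set_conv_nth)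
  with idx_eq show "idx i < length cs" "i \<in> cs ! idx i" by auto
qed

lemma prod_parts:
  fixes h :: "'i \<Rightarrow> 'a::comm_monoid_mult"
  shows "(\<Prod>i\<in>A. h i) = (\<Prod>t<length cs. \<Prod>i\<in>cs ! t. h i)"
proof -
  have "A = (\<Union>t\<in>{..<length cs}. cs ! t)"
    using idx part_subset by blast
  then have "(\<Prod>i\<in>A. h i) = (\<Prod>i\<in>(\<Union>t\<in>{..<length cs}. cs ! t). h i)" by simp
  also have "\<dots> = (\<Prod>t<length cs. \<Prod>i\<in>cs ! t. h i)"
  proof (rule prod.UNION_disjoint)
    show "\<forall>t\<in>{..<length cs}. finite (cs ! t)"
      using part_subset finite_subset[OF _ fin] by auto
    show "\<forall>t\<in>{..<length cs}. \<forall>t'\<in>{..<length cs}. t \<noteq> t' \<longrightarrow> cs ! t \<inter> cs ! t' = {}"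
      using idx_eq by blast
  qed simp
  finally show ?thesis .
qed

lemma prod_parts_const:
  fixes h :: "nat \<Rightarrow> 'a::comm_monoid_mult"
  shows "(\<Prod>i\<in>A. h (idx i)) = (\<Prod>t<length cs. h t ^ card (cs ! t))"
  unfolding prod_parts by (intro prod.cong refl) (simp add: idx_eq)

definition const_on_blocks :: "('i \<Rightarrow> 'c) \<Rightarrow> bool" where
  "const_on_blocks f \<longleftrightarrow> (\<forall>c\<in>set cs. \<forall>i\<in>c. \<forall>j\<in>c. f i = f j)"

text \<open>A function constant on blocks is a function of the block index, and the block size turns
  up as the exponent; over the cycles of a permutation the inner sums become power sums.\<close>

lemma sum_const_on_blocks:
  fixes \<psi> :: "nat \<Rightarrow> 'c \<Rightarrow> 'a::comm_ring_1"
  assumes X: "finite X"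
  shows "(\<Sum>f | f \<in> A \<rightarrow>\<^sub>E X \<and> const_on_blocks f. \<Prod>i\<in>A. \<psi> (idx i) (f i)) =
    (\<Prod>t<length cs. \<Sum>v\<in>X. \<psi> t v ^ card (cs ! t))"
proof -
  have some: "(SOME i. i \<in> cs ! t) \<in> cs ! t" if "t < length cs" for t
  proof (rule someI_ex)
    show "\<exists>i. i \<in> cs ! t" using that ne nth_mem[OF that] by (metis ex_in_conv)
  qed
  have "(\<Sum>f | f \<in> A \<rightarrow>\<^sub>E X \<and> const_on_blocks f. \<Prod>i\<in>A. \<psi> (idx i) (f i)) =
      (\<Sum>h\<in>{..<length cs} \<rightarrow>\<^sub>E X. \<Prod>t<length cs. \<psi> t (h t) ^ card (cs ! t))"
  proof (rule sum.reindex_bij_witness[where i = "\<lambda>h. restrict (\<lambda>i. h (idx i)) A"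
        and j = "\<lambda>f. restrict (\<lambda>t. f (SOME i. i \<in> cs ! t)) {..<length cs}"])
    fix f assume "f \<in> {f. f \<in> A \<rightarrow>\<^sub>E X \<and> const_on_blocks f}"
    then have f: "f \<in> A \<rightarrow>\<^sub>E X" and const: "const_on_blocks f" by auto
    have c: "f i = f j" if "t < length cs" "i \<in> cs ! t" "j \<in> cs ! t" for t i j
      using const nth_mem[OF that(1)] that(2,3) unfolding const_on_blocks_def by blast
    have val: "f (SOME j. j \<in> cs ! idx i) = f i" if "i \<in> A" for i
      using c[OF idx(1)[OF that] some[OF idx(1)[OF that]] idx(2)[OF that]] .
    show "restrict (\<lambda>i. restrict (\<lambda>t. f (SOME i. i \<in> cs ! t)) {..<length cs} (idx i)) A = f"
    proof
      fix i show "restrict (\<lambda>i. restrict (\<lambda>t. f (SOME i. i \<in> cs ! t)) {..<length cs} (idx i)) A i = f i"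
        using val idx(1) PiE_arb[OF f] by (cases "i \<in> A") auto
    qed
    show "restrict (\<lambda>t. f (SOME i. i \<in> cs ! t)) {..<length cs} \<in> {..<length cs} \<rightarrow>\<^sub>E X"
      using f some part_subset by (auto dest!: PiE_mem)
    have "(\<Prod>i\<in>A. \<psi> (idx i) (f i)) = (\<Prod>i\<in>A. \<psi> (idx i) (f (SOME j. j \<in> cs ! idx i)))"
      by (intro prod.cong refl) (simp add: val)
    also have "\<dots> = (\<Prod>t<length cs. \<psi> t (f (SOME j. j \<in> cs ! t)) ^ card (cs ! t))"
      by (rule prod_parts_const)
    finally show "(\<Prod>t<length cs. \<psi> t (restrict (\<lambda>t. f (SOME i. i \<in> cs ! t)) {..<length cs} t) ^ card (cs ! t)) =
        (\<Prod>i\<in>A. \<psi> (idx i) (f i))" by simp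
  next
    fix h assume h: "h \<in> {..<length cs} \<rightarrow>\<^sub>E X"
    have inA: "i \<in> A" if "t < length cs" "i \<in> cs ! t" for t i using part_subset that by blast
    show "restrict (\<lambda>i. h (idx i)) A \<in> {f. f \<in> A \<rightarrow>\<^sub>E X \<and> const_on_blocks f}"
    proof (intro CollectI conjI)
      show "restrict (\<lambda>i. h (idx i)) A \<in> A \<rightarrow>\<^sub>E X"
        using h idx(1) by (auto dest!: PiE_mem)
      show "const_on_blocks (restrict (\<lambda>i. h (idx i)) A)"
        unfolding const_on_blocks_def
      proof (intro ballI)
        fix c i j assume c: "c \<in> set cs" "i \<in> c" "j \<in> c"
        then obtain t where "t < length cs" "c = cs ! t" by (auto simp: in_set_conv_nth)
        with c inA idx_eq show "restrict (\<lambda>i. h (idx i)) A i = restrict (\<lambda>i. h (idx i)) A j" by simp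
      qed
    qed
    show "restrict (\<lambda>t. restrict (\<lambda>i. h (idx i)) A (SOME i. i \<in> cs ! t)) {..<length cs} = h"
    proof
      fix t
      show "restrict (\<lambda>t. restrict (\<lambda>i. h (idx i)) A (SOME i. i \<in> cs ! t)) {..<length cs} t = h t"
        using some idx_eq inA PiE_arb[OF h] by (cases "t < length cs") auto
    qed
  qed
  also have "\<dots> = (\<Prod>t<length cs. \<Sum>v\<in>X. \<psi> t v ^ card (cs ! t))"
    by (rule prod_sum_PiE[symmetric]) (use X in auto)
  finally show ?thesis .
qed

end

lemma set_list_cycle_enum:
  assumes "p permutes A" "finite A"
  shows "set_list (cycle_enum p A) A"
proof
  show "\<Union>(set (cycle_enum p A)) = A"
    using orbit_in[OF assms] self_in_orbit[OF assms] by (auto simp: set_cycle_enum[OF assms])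
  show "{} \<notin> set (cycle_enum p A)"
    unfolding set_cycle_enum[OF assms] using orbit_nonempty by (metis imageE)
  show "distinct (cycle_enum p A)" by (rule distinct_cycle_enum[OF assms])
  show "c \<inter> c' = {}" if "c \<in> set (cycle_enum p A)" "c' \<in> set (cycle_enum p A)" "c \<noteq> c'" for c c'
    using that orbit_eqI[OF assms] unfolding set_cycle_enum[OF assms] by blast
qed fact

lemma cycles_monomial_mat:
  assumes p: "p permutes {..<n}" and u: "u \<in> {..<n} \<rightarrow> unit_roots k"
  shows "cycles_of (monomial_mat n p u) = set (cycle_enum p {..<n})"
    "cycle_list (monomial_mat n p u) = cycle_enum p {..<n}"
    "c \<in> set (cycle_enum p {..<n}) \<Longrightarrow> C_type (monomial_mat n p u) c = (\<Prod>i\<in>c. u i)"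
proof -
  note M = monomial_mat_wreath[OF p u]
  have dim: "dim_row (monomial_mat n p u) = n" by (simp add: monomial_mat_def)
  show cyc: "cycles_of (monomial_mat n p u) = set (cycle_enum p {..<n})"
    unfolding cycles_of_def by (simp add: dim M(2) set_cycle_enum[OF p])
  show "cycle_list (monomial_mat n p u) = cycle_enum p {..<n}"
    unfolding cycle_list_def cycles_of_def cycle_enum_def by (simp add: dim M(2))
  assume "c \<in> set (cycle_enum p {..<n})"
  then have "c \<subseteq> {..<n}" using orbit_in[OF p] by (auto simp: set_cycle_enum[OF p])
  then show "C_type (monomial_mat n p u) c = (\<Prod>i\<in>c. u i)"
    unfolding C_type_def by (intro prod.cong refl) (use M(3) in auto)
qed

text \<open>\<open>polytope_colors\<close> with an arbitrary set of colors in place of the lattice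
  points.\<close>

definition all_colors :: "nat \<Rightarrow> 'c set \<Rightarrow> 'c multiset" where
  "all_colors n X = (\<Sum>v\<in>X. replicate_mset n v)"

lemma count_all_colors: "finite X \<Longrightarrow> count (all_colors n X) v = (if v \<in> X then n else 0)"
  by (simp add: all_colors_def count_sum)

lemma set_all_colors: "finite X \<Longrightarrow> n \<ge> 1 \<Longrightarrow> set_mset (all_colors n X) = X"
  by (auto simp: set_mset_def count_all_colors split: if_splits)

text \<open>A family over at most \<open>n\<close> elements cannot use a color more than
  \<open>n\<close> times.\<close>

lemma image_mset_subseteq_count:
  assumes "finite D" "card D \<le> n" "f ` D \<subseteq> Y" "\<And>v. v \<in> Y \<Longrightarrow> n \<le> count F v"
  shows "image_mset f (mset_set D) \<subseteq># F"
proof (rule mset_subset_eqI)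
  fix v
  show "count (image_mset f (mset_set D)) v \<le> count F v"
  proof (cases "v \<in> Y")
    case True
    have "count (image_mset f (mset_set D)) v \<le> size (image_mset f (mset_set D))"
      by (rule count_le_size)
    then show ?thesis using assms(1,2,4) True by fastforce
  next
    case False
    then have "v \<notin># image_mset f (mset_set D)" using assms(1,3) by auto
    then show ?thesis by (metis le0 not_in_iff)
  qed
qed

lemma colorings_all_colors:
  assumes p: "p permutes {..<n}" and u: "u \<in> {..<n} \<rightarrow> unit_roots k" and X: "finite X" and n: "n \<ge> 1"
  shows "colorings n (all_colors n X) (monomial_mat n p u) =
    {f. f \<in> {..<n} \<rightarrow>\<^sub>E X \<and> set_list.const_on_blocks (cycle_enum p {..<n}) f}"
proof -
  interpret set_list "cycle_enum p {..<n}" "{..<n}"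
    by (rule set_list_cycle_enum[OF p]) simp
  have "image_mset f (mset_set {..<n}) \<subseteq># all_colors n X" if "f \<in> {..<n} \<rightarrow>\<^sub>E X" for f
  proof (rule image_mset_subseteq_count[of _ n _ X])
    show "f ` {..<n} \<subseteq> X" using that by (auto simp: PiE_iff)
  qed (simp_all add: count_all_colors X)
  moreover have "cycles_of (monomial_mat n p u) = set (cycle_enum p {..<n})"
    using p u by (rule cycles_monomial_mat(1))
  ultimately show ?thesis
    unfolding colorings_def const_on_blocks_def set_all_colors[OF X n] by auto
qed

text \<open>For a fixed permutation, coloring and removal of strips, the sum over the matrix entries
  factors over the indices: a C-type raised to the number of its component spreads over the elements
  of the cycle. Each factor is \<open>k\<close> or zero according to whether the color is congruent
  to that component. So \<open>k ^ n\<close> appears, and only the colors in \<open>vs j\<close>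
  survive on cycles sent to component \<open>j\<close>.\<close>

lemma class_inner_coefficient:
  assumes X: "finite X" and n: "n \<ge> 1" and k: "k \<ge> 1" and g: "is_multipartition k n g"
    and colors: "\<And>j. j < k \<Longrightarrow> color_list R (vs j) \<and> set (vs j) = {v \<in> X. [p v = int j] (mod int k)}"
  shows "(\<Sum>\<sigma>\<in>wreath k n. color_char n (all_colors n X) p \<rho> \<sigma> * qconst (cnj (irr_char g \<sigma>))) =
    of_nat (fact n * k ^ n) * schur_prod R vs \<rho> g"
proof -
  interpret colored_schur R vs \<rho> k by unfold_locales (use colors in auto)
  have g': "\<And>l. l \<in> set g \<Longrightarrow> is_partition l" and len: "length g = k"
    using g by (auto simp: is_multipartition_def)
  let ?U = "unit_roots k"
  have inner: "(\<Sum>u\<in>{..<n} \<rightarrow>\<^sub>E ?U. color_char n (all_colors n X) p \<rho> (monomial_mat n q u) *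
      qconst (cnj (irr_char g (monomial_mat n q u)))) =
      of_nat (k ^ n) * strip_sum psum g (map card (cycle_enum q {..<n}))"
    if q: "q permutes {..<n}" for q
  proof -
    define cs where "cs = cycle_enum q {..<n}"
    interpret set_list cs "{..<n}"
      unfolding cs_def by (rule set_list_cycle_enum[OF q]) simp
    define W where "W = removal_ways g (map card cs)"
    define F where "F = {f. f \<in> {..<n} \<rightarrow>\<^sub>E X \<and> const_on_blocks f}"
    \<comment> \<open>The component from which the strip of cycle \<open>t\<close> is taken;
      \<open>J w (idx i)\<close> is the one belonging to the cycle of the index
      \<open>i\<close>.\<close>
    define J where "J = (\<lambda>(w :: (nat \<times> (nat \<times> nat) set) list) t. fst (w ! t))"
    define sg where "sg = (\<lambda>(w :: (nat \<times> (nat \<times> nat) set) list). \<Prod>t<length cs. (-1 :: qpoly) ^ strip_height (snd (w ! t)))"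
    have ways: "finite W" "\<And>w. w \<in> W \<Longrightarrow> length w = length cs"
      "\<And>w t. w \<in> W \<Longrightarrow> t < length cs \<Longrightarrow> J w t < k"
      "strip_sum psum g (map card cs) = (\<Sum>w\<in>W. \<Prod>t<length cs. psum (J w t) (card (cs ! t)) * (-1) ^ strip_height (snd (w ! t)))"
      using strip_sum_removal_ways[of g "map card cs" psum, OF g'] removal_ways_component[of _ g "map card cs"]
      unfolding W_def J_def len by auto
    have finF: "finite F" unfolding F_def by (rule finite_subset[of _ "{..<n} \<rightarrow>\<^sub>E X"]) (auto intro: finite_PiE X)
    have color: "color_char n (all_colors n X) p \<rho> (monomial_mat n q u) =
        (\<Sum>f\<in>F. (\<Prod>i<n. qconst (u i powi p (f i))) * (\<Prod>i<n. \<rho> (f i)))"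
      and irr: "qconst (cnj (irr_char g (monomial_mat n q u))) = (\<Sum>w\<in>W. (\<Prod>i<n. qconst (cnj (u i) ^ J w (idx i))) * sg w)"
      if "u \<in> {..<n} \<rightarrow>\<^sub>E ?U" for u
    proof -
      have u: "u \<in> {..<n} \<rightarrow> ?U" using that by auto
      note M = monomial_mat_wreath[OF q u]
      note C = cycles_monomial_mat[OF q u, folded cs_def]
      show "color_char n (all_colors n X) p \<rho> (monomial_mat n q u) =
        (\<Sum>f\<in>F. (\<Prod>i<n. qconst (u i powi p (f i))) * (\<Prod>i<n. \<rho> (f i)))"
        unfolding color_char_def colorings_all_colors[OF q u X n, folded cs_def, folded F_def]
        by (simp add: M(3) prod.distrib)
      have "irr_char g (monomial_mat n q u) = (\<Sum>w\<in>W. (\<Prod>i<n. u i ^ J w (idx i)) *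
          (\<Prod>t<length cs. (-1) ^ strip_height (snd (w ! t))))"
        unfolding irr_char_def Let_def C(2) W_def[symmetric] prod.distrib
      proof (intro sum.cong refl arg_cong2[of _ _ _ _ "(*)"])
        fix w
        have "(\<Prod>t<length cs. C_type (monomial_mat n q u) (cs ! t) ^ fst (w ! t)) =
            (\<Prod>t<length cs. \<Prod>i\<in>cs ! t. u i ^ J w t)"
          by (intro prod.cong refl) (simp add: C(3) J_def prod_power_distrib)
        also have "\<dots> = (\<Prod>t<length cs. \<Prod>i\<in>cs ! t. u i ^ J w (idx i))"
          by (intro prod.cong refl) (simp add: idx_eq)
        also have "\<dots> = (\<Prod>i<n. u i ^ J w (idx i))" by (rule prod_parts[symmetric])
        finally show "(\<Prod>t<length cs. C_type (monomial_mat n q u) (cs ! t) ^ fst (w ! t)) =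
            (\<Prod>i<n. u i ^ J w (idx i))" .
      qed
      then show "qconst (cnj (irr_char g (monomial_mat n q u))) = (\<Sum>w\<in>W. (\<Prod>i<n. qconst (cnj (u i) ^ J w (idx i))) * sg w)"
        by (simp add: qconst_sum qconst_mult qconst_prod qconst_power qconst_minus sg_def)
    qed
    let ?\<psi> = "\<lambda>j v. qconst (if [p v = int j] (mod int k) then of_nat k else 0) * \<rho> v"
    have "(\<Sum>u\<in>{..<n} \<rightarrow>\<^sub>E ?U. color_char n (all_colors n X) p \<rho> (monomial_mat n q u) *
        qconst (cnj (irr_char g (monomial_mat n q u)))) =
        (\<Sum>u\<in>{..<n} \<rightarrow>\<^sub>E ?U. \<Sum>f\<in>F. \<Sum>w\<in>W. sg w * ((\<Prod>i<n. \<rho> (f i)) *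
          (\<Prod>i<n. qconst (u i powi p (f i) * cnj (u i) ^ J w (idx i)))))"
    proof (rule sum.cong[OF refl])
      fix u assume u: "u \<in> {..<n} \<rightarrow>\<^sub>E ?U"
      show "color_char n (all_colors n X) p \<rho> (monomial_mat n q u) * qconst (cnj (irr_char g (monomial_mat n q u))) =
        (\<Sum>f\<in>F. \<Sum>w\<in>W. sg w * ((\<Prod>i<n. \<rho> (f i)) *
          (\<Prod>i<n. qconst (u i powi p (f i) * cnj (u i) ^ J w (idx i)))))"
        unfolding color[OF u] irr[OF u] sum_product by (simp add: qconst_mult prod.distrib mult_ac)
    qed
    also have "\<dots> = (\<Sum>w\<in>W. \<Sum>f\<in>F. \<Sum>u\<in>{..<n} \<rightarrow>\<^sub>E ?U. sg w * ((\<Prod>i<n. \<rho> (f i)) *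
          (\<Prod>i<n. qconst (u i powi p (f i) * cnj (u i) ^ J w (idx i)))))"
      by (subst sum.swap, subst (2) sum.swap, subst sum.swap) (rule refl)
    \<comment> \<open>The entries \<open>u i\<close> range independently over the roots of unity, so
      their sum factors.\<close>
    also have "\<dots> = (\<Sum>w\<in>W. \<Sum>f\<in>F. sg w * ((\<Prod>i<n. \<rho> (f i)) *
          (\<Prod>i<n. qconst (\<Sum>x\<in>?U. x powi p (f i) * cnj x ^ J w (idx i)))))"
    proof (intro sum.cong refl)
      fix w f
      have "(\<Sum>u\<in>{..<n} \<rightarrow>\<^sub>E ?U. \<Prod>i<n. qconst (u i powi p (f i) * cnj (u i) ^ J w (idx i))) =
          (\<Prod>i<n. \<Sum>x\<in>?U. qconst (x powi p (f i) * cnj x ^ J w (idx i)))"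
        by (rule prod_sum_PiE[symmetric]) auto
      then show "(\<Sum>u\<in>{..<n} \<rightarrow>\<^sub>E ?U. sg w * ((\<Prod>i<n. \<rho> (f i)) *
          (\<Prod>i<n. qconst (u i powi p (f i) * cnj (u i) ^ J w (idx i))))) =
          sg w * ((\<Prod>i<n. \<rho> (f i)) * (\<Prod>i<n. qconst (\<Sum>x\<in>?U. x powi p (f i) * cnj x ^ J w (idx i))))"
        by (simp add: sum_distrib_left[symmetric] qconst_sum)
    qed
    also have "\<dots> = (\<Sum>w\<in>W. sg w * (\<Sum>f\<in>F. \<Prod>i<n. ?\<psi> (J w (idx i)) (f i)))"
      by (simp add: sum_unit_roots[OF k] sum_distrib_left prod.distrib mult_ac)
    also have "\<dots> = (\<Sum>w\<in>W. sg w * (\<Prod>t<length cs. \<Sum>v\<in>X. ?\<psi> (J w t) v ^ card (cs ! t)))"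
      unfolding F_def using sum_const_on_blocks[OF X, of "\<lambda>t. ?\<psi> (J _ t)"] by simp
    also have "\<dots> = (\<Sum>w\<in>W. sg w * (\<Prod>t<length cs. of_nat k ^ card (cs ! t) * psum (J w t) (card (cs ! t))))"
    proof (intro sum.cong refl arg_cong2[of _ _ _ _ "(*)"] prod.cong)
      fix w t assume w: "w \<in> W" and t: "t \<in> {..<length cs}"
      let ?j = "J w t" and ?s = "card (cs ! t)"
      have j: "?j < k" using ways(3) w t by simp
      have "cs ! t \<noteq> {}" using ne t nth_mem[of t cs] by (metis lessThan_iff)
      \<comment> \<open>The exponent is positive, so the zero weight of a color that is not
        congruent to \<open>?j\<close> stays zero.\<close>
      then have s: "?s > 0" using part_subset[of t] t finite_subset[of "cs ! t" "{..<n}"] by (simp add: card_gt_0_iff)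
      have "(\<Sum>v\<in>X. ?\<psi> ?j v ^ ?s) = (\<Sum>v\<in>{v \<in> X. [p v = int ?j] (mod int k)}. of_nat k ^ ?s * \<rho> v ^ ?s)"
        using X s by (intro sum.mono_neutral_cong_right) (auto simp: power_mult_distrib qconst_of_nat)
      also have "\<dots> = of_nat k ^ ?s * (\<Sum>v\<in>set (vs ?j). \<rho> v ^ ?s)"
        unfolding conjunct2[OF colors[OF j]] by (rule sum_distrib_left[symmetric])
      also have "(\<Sum>v\<in>set (vs ?j). \<rho> v ^ ?s) = psum ?j ?s"
        using colors[OF j] by (simp add: psum_def power_sum_def color_list_def sum_list_distinct_conv_sum_set o_def)
      finally show "(\<Sum>v\<in>X. ?\<psi> ?j v ^ ?s) = of_nat k ^ ?s * psum ?j ?s" .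
    qed
    also have "\<dots> = (\<Sum>w\<in>W. of_nat (k ^ n) * (\<Prod>t<length cs. psum (J w t) (card (cs ! t)) * (-1) ^ strip_height (snd (w ! t))))"
      using prod_parts_const[of "\<lambda>_. of_nat k :: qpoly"]
      by (simp add: sg_def prod.distrib mult_ac)
    also have "\<dots> = of_nat (k ^ n) * strip_sum psum g (map card cs)"
      unfolding ways(4) by (rule sum_distrib_left[symmetric])
    finally show ?thesis unfolding cs_def .
  qed
  have "(\<Sum>\<sigma>\<in>wreath k n. color_char n (all_colors n X) p \<rho> \<sigma> * qconst (cnj (irr_char g \<sigma>))) =
      (\<Sum>q | q permutes {..<n}. of_nat (k ^ n) * strip_sum psum g (map card (cycle_enum q {..<n})))"
    unfolding sum_wreath by (rule sum.cong[OF refl]) (simp add: inner)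
  also have "\<dots> = of_nat (k ^ n) * (of_nat (fact n) * schur_prod R vs \<rho> g)"
    using strip_sum_cycles[of "{..<n}" g] g n by (simp add: sum_distrib_left[symmetric] lessThan_empty_iff)
  finally show ?thesis by (simp add: mult_ac)
qed

lemma prod_mset_image_sum:
  "finite I \<Longrightarrow> prod_mset (image_mset f (\<Sum>i\<in>I. M i)) = (\<Prod>i\<in>I. prod_mset (image_mset f (M i)))"
  by (induction I rule: finite_induct) auto

text \<open>Each component has at most \<open>n\<close> cells, so the multiset condition only says
  which colors are allowed; the tableaux then form a product set on which the weight is
  multiplicative.\<close>

lemma sum_SSYT:
  assumes X: "finite X" and n: "n \<ge> 1" and g: "is_multipartition k n g"
    and vs: "\<And>j. j < k \<Longrightarrow> set (vs j) = {v \<in> X. [p v = int j] (mod int k)}"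
  shows "(\<Sum>T\<in>SSYT k R p g (all_colors n X). tableau_weight k \<rho> g T) = schur_prod R vs \<rho> g"
proof -
  have len: "length g = k" using g by (simp add: is_multipartition_def)
  have card: "card (diagram (g ! r)) \<le> n" if "r < k" for r
  proof -
    have "sum_list (g ! r) \<le> (\<Sum>l\<leftarrow>g. sum_list l)"
      by (rule member_le_sum_list) (use that len in auto)
    then show ?thesis using g by (simp add: card_diagram is_multipartition_def)
  qed
  have cm: "count (colors_mod k p (all_colors n X) r) v = (if v \<in> set (vs r) then n else 0)" if "r < k" for r v
    using vs[OF that] X by (simp add: colors_mod_def count_all_colors)
  have fill: "image_mset T (mset_set (diagram (g ! r))) \<subseteq># colors_mod k p (all_colors n X) r \<longleftrightarrow>
      T ` diagram (g ! r) \<subseteq> set (vs r)" if "r < k" for r and T :: "nat \<times> nat \<Rightarrow> 'a"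
  proof
    assume a: "image_mset T (mset_set (diagram (g ! r))) \<subseteq># colors_mod k p (all_colors n X) r"
    show "T ` diagram (g ! r) \<subseteq> set (vs r)"
    proof
      fix v assume "v \<in> T ` diagram (g ! r)"
      then have "v \<in># image_mset T (mset_set (diagram (g ! r)))" by simp
      then have "v \<in># colors_mod k p (all_colors n X) r" using a mset_subset_eqD by metis
      then show "v \<in> set (vs r)" using cm[OF that, of v] by (metis not_in_iff)
    qed
  next
    assume "T ` diagram (g ! r) \<subseteq> set (vs r)"
    then show "image_mset T (mset_set (diagram (g ! r))) \<subseteq># colors_mod k p (all_colors n X) r"
      using card[OF that] by (intro image_mset_subseteq_count) (auto simp: cm[OF that])
  qed
  have sub: "set (vs r) \<subseteq> X" if "r < k" for r using vs[OF that] by auto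
  have "SSYT k R p g (all_colors n X) = (\<Pi>\<^sub>E r\<in>{..<k}. fillings R (set (vs r)) (diagram (g ! r)))"
  proof (intro equalityI subsetI)
    fix T assume T: "T \<in> SSYT k R p g (all_colors n X)"
    show "T \<in> (\<Pi>\<^sub>E r\<in>{..<k}. fillings R (set (vs r)) (diagram (g ! r)))"
    proof (rule PiE_I)
      fix r assume "r \<in> {..<k}"
      then have r: "r < k" by simp
      have "T r \<in> diagram (g ! r) \<rightarrow>\<^sub>E X"
        using T r by (auto simp: SSYT_def set_all_colors[OF X n] dest: PiE_mem)
      moreover have "T r ` diagram (g ! r) \<subseteq> set (vs r)"
        using T r fill[OF r] unfolding SSYT_def by blast
      ultimately have "T r \<in> diagram (g ! r) \<rightarrow>\<^sub>E set (vs r)" by (auto simp: PiE_iff)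
      then show "T r \<in> fillings R (set (vs r)) (diagram (g ! r))"
        using T r unfolding SSYT_def fillings_def by blast
    next
      fix r assume "r \<notin> {..<k}"
      then show "T r = undefined" using T unfolding SSYT_def by (auto dest: PiE_arb)
    qed
  next
    fix T assume T: "T \<in> (\<Pi>\<^sub>E r\<in>{..<k}. fillings R (set (vs r)) (diagram (g ! r)))"
    have Tr: "T r \<in> fillings R (set (vs r)) (diagram (g ! r))" if "r < k" for r
      using T that by (auto dest: PiE_mem)
    have "T \<in> (\<Pi>\<^sub>E r\<in>{..<k}. diagram (g ! r) \<rightarrow>\<^sub>E X)"
    proof (rule PiE_I)
      fix r assume "r \<in> {..<k}"
      then show "T r \<in> diagram (g ! r) \<rightarrow>\<^sub>E X"
        using Tr[of r] sub[of r] by (auto simp: fillings_def PiE_iff)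
    qed (use T in \<open>auto dest: PiE_arb\<close>)
    moreover have "T r ` diagram (g ! r) \<subseteq> set (vs r)" if "r < k" for r
      using fillings_mem[OF Tr[OF that]] by blast
    ultimately show "T \<in> SSYT k R p g (all_colors n X)"
      unfolding SSYT_def set_all_colors[OF X n]
      by (intro CollectI conjI allI impI)
         (simp_all add: fill, (blast dest: Tr fillings_row fillings_col)+)
  qed
  moreover have "tableau_weight k \<rho> g T = (\<Prod>r<k. \<Prod>x\<in>diagram (g ! r). \<rho> (T r x))" for T
  proof -
    have "tableau_weight k \<rho> g T = prod_mset (image_mset \<rho> (tableau_content k g T))"
      unfolding tableau_weight_def by (rule image_prod_mset_multiplicity[symmetric])
    also have "\<dots> = (\<Prod>r<k. \<Prod>x\<in>diagram (g ! r). \<rho> (T r x))"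
      unfolding tableau_content_def
      by (simp add: prod_mset_image_sum prod_unfold_prod_mset image_mset.compositionality o_def)
    finally show ?thesis .
  qed
  ultimately show ?thesis
    unfolding schur_prod_def schur_def len
    by (simp add: prod_sum_PiE finite_fillings)
qed

section \<open>Traces on spans of monomials\<close>

lemma lookup_lscale: "Poly_Mapping.lookup (lscale c f) m = c * Poly_Mapping.lookup f m"
  unfolding lscale_def mult_map_scale_conv_mult[symmetric]
  by (simp add: Poly_Mapping.map.rep_eq when_def)

lemma lscale_single: "lscale c (Poly_Mapping.single m b) = Poly_Mapping.single m (c * b)"
  by (simp add: lscale_def mult_single)

lemma laurent_expand:
  assumes "finite S" "Poly_Mapping.keys f \<subseteq> S"
  shows "f = (\<Sum>m\<in>S. lscale (Poly_Mapping.lookup f m) (Poly_Mapping.single m 1))"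
proof (rule poly_mapping_eqI)
  fix m
  have "Poly_Mapping.lookup (\<Sum>m\<in>S. lscale (Poly_Mapping.lookup f m) (Poly_Mapping.single m 1)) m =
      (\<Sum>m'\<in>S. if m' = m then Poly_Mapping.lookup f m else 0)"
    by (simp add: lookup_sum lookup_lscale lookup_single when_def if_distrib cong: if_cong)
  then show "Poly_Mapping.lookup f m =
      Poly_Mapping.lookup (\<Sum>m\<in>S. lscale (Poly_Mapping.lookup f m) (Poly_Mapping.single m 1)) m"
    using assms by (auto simp: in_keys_iff)
qed

text \<open>All graded pieces are of this form: the span of a set of monomials, described by their
  exponents.\<close>

definition supported :: "'m exponent set \<Rightarrow> 'm laurent set" where
  "supported J = {f. Poly_Mapping.keys f \<subseteq> J}"

lemma subspace_supported: "laurent.subspace (supported J)"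
proof (rule laurent.subspaceI)
  show "x + y \<in> supported J" if "x \<in> supported J" "y \<in> supported J" for x y
    using that keys_add[of x y] by (auto simp: supported_def)
  show "lscale c x \<in> supported J" if "x \<in> supported J" for c x
    using that by (auto simp: supported_def in_keys_iff lookup_lscale)
qed (simp add: supported_def)

lemma span_monomials:
  "laurent.span ((\<lambda>m. Poly_Mapping.single m 1) ` J) = supported J"
proof
  show "laurent.span ((\<lambda>m. Poly_Mapping.single m 1) ` J) \<subseteq> supported J"
    by (rule laurent.span_minimal[OF _ subspace_supported]) (auto simp: supported_def)
  show "supported J \<subseteq> laurent.span ((\<lambda>m. Poly_Mapping.single m 1) ` J)"
  proof
    fix f assume f: "f \<in> supported J"
    have "(\<Sum>m\<in>Poly_Mapping.keys f. lscale (Poly_Mapping.lookup f m) (Poly_Mapping.single m 1)) \<in>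
        laurent.span ((\<lambda>m. Poly_Mapping.single m 1) ` J)"
      by (intro laurent.span_sum laurent.span_scale, rule laurent.span_base)
         (use f in \<open>auto simp: supported_def\<close>)
    then show "f \<in> laurent.span ((\<lambda>m. Poly_Mapping.single m 1) ` J)"
      by (subst laurent_expand[OF finite_keys subset_refl])
  qed
qed

text \<open>The basis \<open>B\<close> chosen by \<open>trace_on\<close> is unspecified. Expanding
  each \<open>b\<close> into monomials and interchanging the sums returns to the monomial basis, in
  the manner of \<open>tr (X Y) = tr (Y X)\<close>.\<close>

lemma trace_on_supported:
  assumes J: "finite J"
    and \<phi>: "\<And>f. \<phi> f = (\<Sum>m\<in>Poly_Mapping.keys f. lscale (Poly_Mapping.lookup f m) (\<psi> m))"
    and \<psi>: "\<And>m. m \<in> J \<Longrightarrow> \<psi> m \<in> supported J"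
  shows "trace_on (supported J) \<phi> = (\<Sum>m\<in>J. Poly_Mapping.lookup (\<psi> m) m)"
proof -
  define B where "B = (SOME B. laurent.independent B \<and> laurent.span B = supported J)"
  have "\<exists>B. laurent.independent B \<and> laurent.span B = supported J"
  proof -
    obtain B where B: "B \<subseteq> supported J" "laurent.independent B" "supported J \<subseteq> laurent.span B"
      using laurent.basis_exists[of "supported J"] by metis
    then have "laurent.span B = supported J"
      using laurent.span_minimal[OF B(1) subspace_supported] by auto
    then show ?thesis using B by blast
  qed
  then have B: "laurent.independent B" "laurent.span B = supported J"
    unfolding B_def by (metis (mono_tags, lifting) someI_ex)+
  have finB: "finite B"
    using laurent.independent_span_bound[of "(\<lambda>m. Poly_Mapping.single m 1) ` J" B] B J
    by (metis finite_imageI laurent.span_superset span_monomials)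
  have BV: "b \<in> supported J" if "b \<in> B" for b using laurent.span_base[OF that] B by auto
  have \<psi>B: "\<psi> m \<in> laurent.span B" if "m \<in> J" for m using \<psi>[OF that] B by simp
  let ?rep = "laurent.representation B"
  have "trace_on (supported J) \<phi> = (\<Sum>b\<in>B. ?rep (\<phi> b) b)"
    unfolding trace_on_def Let_def B_def ..
  also have "\<dots> = (\<Sum>b\<in>B. \<Sum>m\<in>J. Poly_Mapping.lookup b m * ?rep (\<psi> m) b)"
  proof (rule sum.cong[OF refl])
    fix b assume b: "b \<in> B"
    have "\<phi> b = (\<Sum>m\<in>J. lscale (Poly_Mapping.lookup b m) (\<psi> m))"
      unfolding \<phi> using BV[OF b] J
      by (intro sum.mono_neutral_left) (auto simp: supported_def in_keys_iff lscale_def)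
    then have "?rep (\<phi> b) = ?rep (\<Sum>m\<in>J. lscale (Poly_Mapping.lookup b m) (\<psi> m))" by simp
    also have "\<dots> = (\<lambda>b'. \<Sum>m\<in>J. ?rep (lscale (Poly_Mapping.lookup b m) (\<psi> m)) b')"
      by (rule laurent.representation_sum[OF B(1)]) (intro laurent.span_scale \<psi>B)
    finally have "?rep (\<phi> b) = (\<lambda>b'. \<Sum>m\<in>J. ?rep (lscale (Poly_Mapping.lookup b m) (\<psi> m)) b')" .
    then show "?rep (\<phi> b) b = (\<Sum>m\<in>J. Poly_Mapping.lookup b m * ?rep (\<psi> m) b)"
      using laurent.representation_scale[OF B(1) \<psi>B] by simp
  qed
  also have "\<dots> = (\<Sum>m\<in>J. \<Sum>b\<in>B. Poly_Mapping.lookup b m * ?rep (\<psi> m) b)" by (rule sum.swap)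
  also have "\<dots> = (\<Sum>m\<in>J. Poly_Mapping.lookup (\<Sum>b\<in>B. lscale (?rep (\<psi> m) b) b) m)"
    by (simp add: lookup_sum lookup_lscale mult.commute)
  also have "\<dots> = (\<Sum>m\<in>J. Poly_Mapping.lookup (\<psi> m) m)"
    using laurent.sum_representation_eq[OF B(1) \<psi>B finB] by simp
  finally show ?thesis .
qed

section \<open>Families of lattice points as monomials, and the action on them\<close>

definition point_exponent :: "nat \<Rightarrow> (nat \<Rightarrow> int ^ 'm) \<Rightarrow> (nat \<times> 'm::finite) \<Rightarrow>\<^sub>0 int" where
  "point_exponent n v = (\<Sum>i<n. \<Sum>j\<in>UNIV. Poly_Mapping.single (i, j) (v i $ j))"

lemma lookup_point_exponent:
  "Poly_Mapping.lookup (point_exponent n v) (i, j) = (if i < n then v i $ j else 0)"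
proof -
  have "Poly_Mapping.lookup (point_exponent n v) (i, j) =
      (\<Sum>i'<n. \<Sum>j'\<in>UNIV. if j' = j then (if i' = i then v i $ j else 0) else 0)"
    unfolding point_exponent_def lookup_sum lookup_single
    by (intro sum.cong refl) (auto simp: when_def)
  then show ?thesis by simp
qed

lemma single_prod:
  fixes e :: "'b \<Rightarrow> 'm exponent"
  assumes "finite S"
  shows "(\<Prod>x\<in>S. Poly_Mapping.single (e x) (c x :: complex)) = Poly_Mapping.single (\<Sum>x\<in>S. e x) (\<Prod>x\<in>S. c x)"
  using assms by (induction S rule: finite_induct) (auto simp: mult_single)

lemma exponent_sum_snd: "(\<Sum>x\<in>S. (0 :: nat, e x)) = (0, \<Sum>x\<in>S. e x)"
  by (induction S rule: infinite_finite_induct) (auto simp: zero_prod_def)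

lemma t_var_power: "t_var ^ d = Poly_Mapping.single (d, 0) 1"
  by (induction d) (auto simp: t_var_def mult_single zero_prod_def[symmetric])

lemma point_monomial_single: "point_monomial n d v = Poly_Mapping.single (d, point_exponent n v) 1"
  unfolding point_monomial_def t_var_power x_pow_def
  by (simp add: single_prod exponent_sum_snd mult_single point_exponent_def)

text \<open>The variables of row \<open>i\<close> move to row \<open>perm_of \<sigma> i\<close>, so
  row \<open>r\<close> of the image carries the point that \<open>v\<close> has at the preimage of
  \<open>r\<close>. The exponents of \<open>entry_of \<sigma> i\<close> add up over the coordinates,
  which is the origin of \<open>coord_sum\<close> as the value of a color.\<close>

lemma act_monomial_point:
  fixes v :: "nat \<Rightarrow> int ^ 'm"
  assumes \<sigma>: "\<sigma> \<in> wreath k n"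
  shows "act_monomial \<sigma> (d, point_exponent n v) =
    Poly_Mapping.single (d, point_exponent n (v \<circ> inv_into UNIV (perm_of \<sigma>)))
      (\<Prod>i<n. entry_of \<sigma> i powi coord_sum (v i))"
proof -
  note W = wreath_perm[OF \<sigma>]
  let ?e = "point_exponent n v" and ?p = "perm_of \<sigma>" and ?u = "entry_of \<sigma>"
  let ?I = "{..<n} \<times> (UNIV :: 'm set)"
  have keys: "Poly_Mapping.keys ?e \<subseteq> ?I"
    by (auto simp: in_keys_iff lookup_point_exponent split: if_splits)
  have nz: "?u i \<noteq> 0" if "i < n" for i using W(3)[OF that] by auto
  \<comment> \<open>Factors with exponent zero are 1, so the product may run over all index pairs
    with row below \<open>n\<close>.\<close>
  have "(\<Prod>(i, j)\<in>Poly_Mapping.keys ?e. lscale (?u i powi Poly_Mapping.lookup ?e (i, j))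
          (x_pow (?p i) j (Poly_Mapping.lookup ?e (i, j)))) =
      (\<Prod>(i, j)\<in>?I. lscale (?u i powi Poly_Mapping.lookup ?e (i, j))
          (x_pow (?p i) j (Poly_Mapping.lookup ?e (i, j))))"
    by (rule prod.mono_neutral_left)
       (use keys in \<open>auto simp: in_keys_iff x_pow_def lscale_single zero_prod_def[symmetric]\<close>)
  also have "\<dots> = (\<Prod>(i, j)\<in>?I. Poly_Mapping.single (0, Poly_Mapping.single (?p i, j) (v i $ j)) (?u i powi (v i $ j)))"
    by (intro prod.cong refl) (auto simp: x_pow_def lscale_single lookup_point_exponent)
  also have "\<dots> = Poly_Mapping.single (0, \<Sum>(i, j)\<in>?I. Poly_Mapping.single (?p i, j) (v i $ j))
      (\<Prod>(i, j)\<in>?I. ?u i powi (v i $ j))"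
    by (simp add: single_prod exponent_sum_snd case_prod_unfold)
  also have "(\<Prod>(i, j)\<in>?I. ?u i powi (v i $ j)) = (\<Prod>i<n. ?u i powi coord_sum (v i))"
  proof -
    have pw: "(\<Prod>j\<in>S. c powi (f j)) = c powi (\<Sum>j\<in>S. f j)" if "c \<noteq> 0" "finite S"
      for c :: complex and f :: "'m \<Rightarrow> int" and S
      using that(2) by (induction S rule: finite_induct) (auto simp: power_int_add that(1))
    have "(\<Prod>(i, j)\<in>?I. ?u i powi (v i $ j)) = (\<Prod>i<n. \<Prod>j\<in>UNIV. ?u i powi (v i $ j))"
      by (rule prod.cartesian_product[symmetric])
    also have "\<dots> = (\<Prod>i<n. ?u i powi coord_sum (v i))"
      by (intro prod.cong refl) (simp add: pw nz coord_sum_def)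
    finally show ?thesis .
  qed
  also have "(\<Sum>(i, j)\<in>?I. Poly_Mapping.single (?p i, j) (v i $ j)) = point_exponent n (v \<circ> inv_into UNIV ?p)"
  proof -
    have "(\<Sum>(i, j)\<in>?I. Poly_Mapping.single (?p i, j) (v i $ j)) =
        (\<Sum>i<n. \<Sum>j\<in>UNIV. Poly_Mapping.single (?p i, j) (v i $ j))"
      by (rule sum.cartesian_product[symmetric])
    also have "\<dots> = (\<Sum>i<n. \<Sum>j\<in>UNIV. Poly_Mapping.single (?p i, j) ((v \<circ> inv_into UNIV ?p) (?p i) $ j))"
      by (simp add: permutes_inverses[OF W(2)])
    also have "\<dots> = point_exponent n (v \<circ> inv_into UNIV ?p)"
      unfolding point_exponent_def
      using sum.permute[OF W(2), of "\<lambda>i. \<Sum>j\<in>UNIV. Poly_Mapping.single (i, j) ((v \<circ> inv_into UNIV ?p) i $ j)"]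
      by (simp add: o_def)
    finally show ?thesis .
  qed
  finally show ?thesis
    unfolding act_monomial_def by (simp add: t_var_power mult_single)
qed

text \<open>A polytope is bounded, so the integer points of a dilate lie in a box.\<close>

lemma finite_lattice_points:
  assumes "lattice_polytope P"
  shows "finite (lattice_points P d :: (int ^ 'm) set)"
proof -
  obtain V where V: "finite V" "P = convex hull (real_vec ` V)"
    using assms by (auto simp: lattice_polytope_def)
  have "bounded P" unfolding V(2)
    by (intro compact_imp_bounded finite_imp_compact_convex_hull finite_imageI V(1))
  then have "bounded ((\<lambda>x. real d *\<^sub>R x) ` P)" by (rule bounded_scaling)
  then obtain b where b: "\<And>x. x \<in> (\<lambda>x. real d *\<^sub>R x) ` P \<Longrightarrow> norm x \<le> b"
    unfolding bounded_iff by blast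
  let ?N = "\<lceil>b\<rceil>"
  have "lattice_points P d \<subseteq> (\<lambda>f. \<chi> j. f j) ` (UNIV \<rightarrow>\<^sub>E {- ?N..?N})"
  proof
    fix v :: "int ^ 'm" assume "v \<in> lattice_points P d"
    then have n: "norm (real_vec v) \<le> b" by (intro b) (simp add: lattice_points_def)
    have "v $ j \<in> {- ?N..?N}" for j
    proof -
      have "\<bar>real_of_int (v $ j)\<bar> \<le> b"
        using component_le_norm_cart[of "real_vec v" j] n by (simp add: real_vec_def)
      then have "real_of_int \<bar>v $ j\<bar> \<le> of_int ?N" by linarith
      then show ?thesis by (simp only: of_int_le_iff) auto
    qed
    then show "v \<in> (\<lambda>f. \<chi> j. f j) ` (UNIV \<rightarrow>\<^sub>E {- ?N..?N})"
      by (intro image_eqI[of _ _ "\<lambda>j. v $ j"]) auto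
  qed
  then show ?thesis by (rule finite_subset) (intro finite_imageI finite_PiE, simp_all)
qed

lemma qpow_sum: "finite S \<Longrightarrow> qpow (\<Sum>x\<in>S. e x) = (\<Prod>x\<in>S. qpow (e x))"
proof (induction S rule: finite_induct)
  case (insert x S)
  then show ?case
    using mult_single[of "e x" "1 :: complex" "sum e S" 1] by (simp add: qpow_def)
qed (simp add: qpow_def)

lemma point_exponent_eq_iff:
  "point_exponent n v = point_exponent n w \<longleftrightarrow> (\<forall>i<n. v i = w i)"
proof
  assume eq: "point_exponent n v = point_exponent n w"
  have "v i $ j = w i $ j" if "i < n" for i j
    using arg_cong[OF eq, of "\<lambda>e. Poly_Mapping.lookup e (i, j)"] that
    by (simp add: lookup_point_exponent)
  then show "\<forall>i<n. v i = w i" by (auto simp: Finite_Cartesian_Product.vec_eq_iff)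
qed (simp add: point_exponent_def)

lemma comb_degree_point_exponent:
  "comb_degree a n (d, point_exponent n v) = (\<Sum>i<n. int_dot a (v i))"
  unfolding comb_degree_def
proof (intro sum.cong refl)
  fix i assume "i \<in> {..<n}"
  then have "(\<chi> j. Poly_Mapping.lookup (snd (d, point_exponent n v)) (i, j)) = v i"
    by (simp add: lookup_point_exponent Finite_Cartesian_Product.vec_eq_iff)
  then show "int_dot a (\<chi> j. Poly_Mapping.lookup (snd (d, point_exponent n v)) (i, j)) = int_dot a (v i)"
    by simp
qed

text \<open>The spanning monomials are homogeneous for both degrees, so conditions on the degrees of
  all terms again cut out a span of monomials. Taking the families \<open>v\<close> extensional
  makes their parametrisation of the exponents injective.\<close>

lemma graded_piece:
  "comb_piece a n (proj_piece (poly_algebra P n) d) e =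
    supported ((\<lambda>v. (d, point_exponent n v)) `
      {v \<in> {..<n} \<rightarrow>\<^sub>E lattice_points P d. (\<Sum>i<n. int_dot a (v i)) = e})"
proof -
  let ?I = "{(d, point_exponent n v) | d v. \<forall>i<n. v i \<in> lattice_points P d}"
  have "{point_monomial n d v | d v. \<forall>i<n. v i \<in> lattice_points P d} =
      (\<lambda>m. Poly_Mapping.single m 1) ` ?I"
    by (auto simp: point_monomial_single)
  then have "poly_algebra P n = supported ?I"
    unfolding poly_algebra_def by (simp only: span_monomials)
  then have "comb_piece a n (proj_piece (poly_algebra P n) d) e =
      supported {m \<in> ?I. proj_degree m = d \<and> comb_degree a n m = e}"
    unfolding comb_piece_def proj_piece_def supported_def by blast
  also have "{m \<in> ?I. proj_degree m = d \<and> comb_degree a n m = e} =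
      (\<lambda>v. (d, point_exponent n v)) `
      {v \<in> {..<n} \<rightarrow>\<^sub>E lattice_points P d. (\<Sum>i<n. int_dot a (v i)) = e}" (is "?L = ?R")
  proof
    show "?L \<subseteq> ?R"
    proof
      fix m assume "m \<in> ?L"
      then obtain v where m: "m = (d, point_exponent n v)" and v: "\<forall>i<n. v i \<in> lattice_points P d"
        and e: "(\<Sum>i<n. int_dot a (v i)) = e"
        by (auto simp: proj_degree_def comb_degree_point_exponent)
      have "point_exponent n v = point_exponent n (restrict v {..<n})"
        by (simp add: point_exponent_eq_iff)
      then show "m \<in> ?R"
        unfolding m using v e by (intro image_eqI[of _ _ "restrict v {..<n}"]) auto
    qed
    show "?R \<subseteq> ?L"
      by (auto simp: proj_degree_def comb_degree_point_exponent PiE_iff)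
  qed
  finally show ?thesis .
qed

text \<open>The monomial of \<open>v\<close> goes to a multiple of the monomial of \<open>v\<close>
  composed with the inverse permutation; the diagonal entry vanishes unless the two monomials
  agree.\<close>

lemma trace_on_graded_piece:
  assumes \<sigma>: "\<sigma> \<in> wreath k n" and fin: "finite (lattice_points P d)"
  shows "trace_on (comb_piece a n (proj_piece (poly_algebra P n) d) e) (act \<sigma>) =
    (\<Sum>v | v \<in> {..<n} \<rightarrow>\<^sub>E lattice_points P d \<and> (\<Sum>i<n. int_dot a (v i)) = e.
      if \<forall>i<n. v (perm_of \<sigma> i) = v i then \<Prod>i<n. entry_of \<sigma> i powi coord_sum (v i) else 0)"
proof -
  let ?V = "{v \<in> {..<n} \<rightarrow>\<^sub>E lattice_points P d. (\<Sum>i<n. int_dot a (v i)) = e}"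
  let ?m = "\<lambda>v. (d, point_exponent n v)"
  let ?p = "perm_of \<sigma>"
  let ?q = "inv_into UNIV ?p"
  note W = wreath_perm[OF \<sigma>]
  have q: "?q permutes {..<n}" by (rule permutes_inv[OF W(2)])
  have finV: "finite ?V"
    by (rule finite_subset[of _ "{..<n} \<rightarrow>\<^sub>E lattice_points P d"]) (auto intro: finite_PiE fin)
  have inj: "inj_on ?m ?V"
  proof (rule inj_onI)
    fix v w assume "v \<in> ?V" "w \<in> ?V" "?m v = ?m w"
    then show "v = w" by (intro PiE_ext[of v _ _ w]) (auto simp: point_exponent_eq_iff)
  qed
  have "trace_on (comb_piece a n (proj_piece (poly_algebra P n) d) e) (act \<sigma>) =
      (\<Sum>m\<in>?m ` ?V. Poly_Mapping.lookup (act_monomial \<sigma> m) m)"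
    unfolding graded_piece
  proof (rule trace_on_supported)
    show "finite (?m ` ?V)" using finV by simp
    show "act \<sigma> f = (\<Sum>m\<in>Poly_Mapping.keys f. lscale (Poly_Mapping.lookup f m) (act_monomial \<sigma> m))" for f
      by (rule act_def)
    fix m assume "m \<in> ?m ` ?V"
    then obtain v where m: "m = ?m v" and v: "v \<in> ?V" by auto
    let ?w = "restrict (v \<circ> ?q) {..<n}"
    \<comment> \<open>The same vector \<open>a\<close> is paired with every row, so permuting the
      rows keeps the combinatorial degree.\<close>
    have "?w \<in> ?V"
      using v sum.permute[OF q, of "\<lambda>i. int_dot a (v i)"] permutes_in_image[OF q]
      by (auto simp: o_def PiE_iff)
    moreover have "point_exponent n (v \<circ> ?q) = point_exponent n ?w"
      by (simp add: point_exponent_eq_iff)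
    ultimately have "?m (v \<circ> ?q) \<in> ?m ` ?V" by (intro image_eqI[of _ _ ?w]) auto
    then show "act_monomial \<sigma> m \<in> supported (?m ` ?V)"
      unfolding m act_monomial_point[OF \<sigma>] supported_def by (simp add: keys_single)
  qed
  also have "\<dots> = (\<Sum>v\<in>?V. Poly_Mapping.lookup (act_monomial \<sigma> (?m v)) (?m v))"
    by (simp add: sum.reindex[OF inj])
  also have "\<dots> = (\<Sum>v\<in>?V. if \<forall>i<n. v (?p i) = v i then \<Prod>i<n. entry_of \<sigma> i powi coord_sum (v i) else 0)"
  proof (rule sum.cong[OF refl])
    fix v
    have "point_exponent n (v \<circ> ?q) = point_exponent n v \<longleftrightarrow> (\<forall>i\<in>{..<n}. v (?q i) = v i)"
      by (auto simp: point_exponent_eq_iff)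
    also have "{..<n} = ?p ` {..<n}" using permutes_image[OF W(2)] by simp
    also have "(\<forall>i\<in>?p ` {..<n}. v (?q i) = v i) \<longleftrightarrow> (\<forall>i<n. v (?p i) = v i)"
      by (auto simp: permutes_inverses[OF W(2)])
    finally have iff: "point_exponent n (v \<circ> ?q) = point_exponent n v \<longleftrightarrow> (\<forall>i<n. v (?p i) = v i)" .
    show "Poly_Mapping.lookup (act_monomial \<sigma> (?m v)) (?m v) =
        (if \<forall>i<n. v (?p i) = v i then \<Prod>i<n. entry_of \<sigma> i powi coord_sum (v i) else 0)"
      unfolding act_monomial_point[OF \<sigma>] lookup_single when_def prod.inject iff by simp
  qed
  finally show ?thesis .
qed

text \<open>Summing the traces over all combinatorial degrees removes the degree condition and
  leaves the families of lattice points fixed by the permutation; being constant along orbits, these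
  are the colorings.\<close>

lemma graded_char_color_char:
  assumes \<sigma>: "\<sigma> \<in> wreath k n" and fin: "finite (lattice_points P d)" and n: "n \<ge> 1"
  shows "graded_char a n (proj_piece (poly_algebra P n) d) \<sigma> =
    color_char n (polytope_colors P n d) coord_sum (\<lambda>v. qpow (int_dot a v)) \<sigma>"
proof -
  note W = wreath_perm[OF \<sigma>]
  let ?X = "lattice_points P d" and ?p = "perm_of \<sigma>"
  let ?V = "{..<n} \<rightarrow>\<^sub>E ?X"
  let ?deg = "\<lambda>v. \<Sum>i<n. int_dot a (v i)"
  let ?fix = "\<lambda>v. \<forall>i<n. v (?p i) = v i"
  let ?c = "\<lambda>v. if ?fix v then \<Prod>i<n. entry_of \<sigma> i powi coord_sum (v i) else 0"
  have finV: "finite ?V" by (intro finite_PiE) (auto simp: fin)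
  \<comment> \<open>Degrees that are not attained contribute nothing, so \<open>Sum_any\<close>
    becomes a finite sum.\<close>
  have zero: "(\<Sum>v | v \<in> ?V \<and> ?deg v = e. ?c v) = 0" if "e \<notin> ?deg ` ?V" for e
  proof -
    have "{v. v \<in> ?V \<and> ?deg v = e} = {}" using that by auto
    then show ?thesis by (simp only: sum.empty)
  qed
  have "graded_char a n (proj_piece (poly_algebra P n) d) \<sigma> =
      Sum_any (\<lambda>e. qconst (\<Sum>v | v \<in> ?V \<and> ?deg v = e. ?c v) * qpow e)"
    unfolding graded_char_def trace_on_graded_piece[OF \<sigma> fin] ..
  also have "\<dots> = (\<Sum>e\<in>?deg ` ?V. qconst (\<Sum>v | v \<in> ?V \<and> ?deg v = e. ?c v) * qpow e)"
  proof (rule Sum_any.expand_superset)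
    show "{e. qconst (\<Sum>v | v \<in> ?V \<and> ?deg v = e. ?c v) * qpow e \<noteq> 0} \<subseteq> ?deg ` ?V"
    proof
      fix e assume e: "e \<in> {e. qconst (\<Sum>v | v \<in> ?V \<and> ?deg v = e. ?c v) * qpow e \<noteq> 0}"
      show "e \<in> ?deg ` ?V"
      proof (rule ccontr)
        assume "e \<notin> ?deg ` ?V"
        from e[unfolded mem_Collect_eq zero[OF this]] show False by simp
      qed
    qed
  qed (simp add: finV)
  also have "\<dots> = (\<Sum>e\<in>?deg ` ?V. \<Sum>v | v \<in> ?V \<and> ?deg v = e. qconst (?c v) * qpow (?deg v))"
    by (intro sum.cong refl) (simp add: qconst_sum sum_distrib_right)
  also have "\<dots> = (\<Sum>v\<in>?V. qconst (?c v) * qpow (?deg v))"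
    by (rule sum.group) (use finV in auto)
  also have "\<dots> = (\<Sum>v | v \<in> ?V \<and> ?fix v. qconst (?c v) * qpow (?deg v))"
    using finV by (intro sum.mono_neutral_right) auto
  also have "\<dots> = (\<Sum>v | v \<in> ?V \<and> ?fix v. \<Prod>i<n. qconst (entry_of \<sigma> i powi coord_sum (v i)) * qpow (int_dot a (v i)))"
    by (intro sum.cong refl) (simp add: qconst_prod qpow_sum prod.distrib)
  also have "{v. v \<in> ?V \<and> ?fix v} = colorings n (polytope_colors P n d) \<sigma>"
  proof -
    have u: "entry_of \<sigma> \<in> {..<n} \<rightarrow> unit_roots k" using W(3) by auto
    interpret set_list "cycle_enum ?p {..<n}" "{..<n}"
      by (rule set_list_cycle_enum[OF W(2)]) simp
    have "colorings n (polytope_colors P n d) \<sigma> = {f. f \<in> ?V \<and> const_on_blocks f}"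
      using colorings_all_colors[OF W(2) u assms(2) n] W(4) by (simp add: polytope_colors_def all_colors_def)
    moreover have "const_on_blocks f \<longleftrightarrow> ?fix f" for f :: "nat \<Rightarrow> int ^ 'a"
    proof
      assume "const_on_blocks f"
      then have c: "f x = f y" if "i < n" "x \<in> orbit ?p i" "y \<in> orbit ?p i" for i x y
        using that unfolding const_on_blocks_def set_cycle_enum[OF W(2) finite_lessThan] by blast
      show "?fix f"
        using c[OF _ orbit.base self_in_orbit[OF W(2) finite_lessThan]] by blast
    next
      assume f: "?fix f"
      have "f x = f i" if "i < n" "x \<in> orbit ?p i" for i x
        using that(2)
      proof induction
        case (step y)
        have "y < n" using orbit_in[OF W(2) finite_lessThan, of i] that(1) step(1) by auto
        with f step show ?case by simp
      qed (use f that(1) in simp)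
      then show "const_on_blocks f"
        unfolding const_on_blocks_def set_cycle_enum[OF W(2) finite_lessThan] by force
    qed
    ultimately show ?thesis by simp
  qed
  finally show ?thesis unfolding color_char_def .
qed

theorem theorem5p11:
  fixes P :: "(real ^ 'm) set" and n k :: nat and a :: "int ^ 'm"
    and R :: "nat \<Rightarrow> ((int ^ 'm) \<times> (int ^ 'm)) set"
  assumes "lattice_polytope P"
    and "aff_dim P = int DIM(real ^ 'm)"
    and "n \<ge> 1" and "k \<ge> 1"
    and "\<And>d. linear_order_on (set_mset (polytope_colors P n d)) (R d)"
  shows
    "(\<forall>\<sigma>\<in>wreath k n.
        bigraded_char a n (poly_algebra P n) \<sigma> =
          Abs_fps (\<lambda>d. graded_char a n (proj_piece (poly_algebra P n) d) \<sigma>) \<and>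
        Abs_fps (\<lambda>d. graded_char a n (proj_piece (poly_algebra P n) d) \<sigma>) =
          Abs_fps (\<lambda>d. color_char n (polytope_colors P n d) coord_sum (\<lambda>v. qpow (int_dot a v)) \<sigma>)) \<and>
     (\<forall>g. is_multipartition k n g \<longrightarrow>
        class_inner k n (bigraded_char a n (poly_algebra P n)) (irr_char g) =
          Abs_fps (\<lambda>d. \<Sum>T\<in>SSYT k (R d) coord_sum g (polytope_colors P n d).
             tableau_weight k (\<lambda>v. qpow (int_dot a v)) g T))"
proof -
  let ?\<rho> = "\<lambda>v. qpow (int_dot a v)"
  have fin: "finite (lattice_points P d)" for d by (rule finite_lattice_points[OF assms(1)])
  have all: "polytope_colors P n d = all_colors n (lattice_points P d)" for d
    by (simp add: polytope_colors_def all_colors_def)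
  have bi: "bigraded_char a n (poly_algebra P n) \<sigma> =
      Abs_fps (\<lambda>d. graded_char a n (proj_piece (poly_algebra P n) d) \<sigma>)" for \<sigma>
    unfolding bigraded_char_def graded_char_def ..
  have color: "graded_char a n (proj_piece (poly_algebra P n) d) \<sigma> =
      color_char n (polytope_colors P n d) coord_sum ?\<rho> \<sigma>" if "\<sigma> \<in> wreath k n" for \<sigma> d
    by (rule graded_char_color_char[OF that fin assms(3)])
  have "class_inner k n (bigraded_char a n (poly_algebra P n)) (irr_char g) =
      Abs_fps (\<lambda>d. \<Sum>T\<in>SSYT k (R d) coord_sum g (polytope_colors P n d). tableau_weight k ?\<rho> g T)"
    if g: "is_multipartition k n g" for g
  proof (rule fps_ext)
    fix d
    let ?X = "lattice_points P d"
    obtain ws where ws: "set ws = ?X" "color_list (R d) ws"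
      using color_list_exists[OF fin] assms(5)[of d] set_all_colors[OF fin assms(3)] all by metis
    \<comment> \<open>Filtering keeps a decreasing list of colors decreasing, so one listing of the
      lattice points serves all residue classes.\<close>
    define vs where "vs = (\<lambda>j. filter (\<lambda>v. [coord_sum v = int j] (mod int k)) ws)"
    have vs: "color_list (R d) (vs j) \<and> set (vs j) = {v \<in> ?X. [coord_sum v = int j] (mod int k)}" for j
      using ws by (auto simp: vs_def color_list_def sorted_wrt_filter)
    \<comment> \<open>The normalisation and the conjugated character values are constant in
      \<open>t\<close>, so the inner product acts on each coefficient separately.\<close>
    have "fps_nth (class_inner k n (bigraded_char a n (poly_algebra P n)) (irr_char g)) d =
        qconst (1 / (fact n * of_nat k ^ n)) * (\<Sum>\<sigma>\<in>wreath k n.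
          color_char n (all_colors n ?X) coord_sum ?\<rho> \<sigma> * qconst (cnj (irr_char g \<sigma>)))"
      unfolding class_inner_def bi
      by (simp add: fps_sum_nth fps_mult_right_const_nth color all)
    also have "\<dots> = qconst (1 / (fact n * of_nat k ^ n)) *
        (of_nat (fact n * k ^ n) * schur_prod (R d) vs ?\<rho> g)"
      by (subst class_inner_coefficient[OF fin assms(3,4) g vs]) simp
    also have "\<dots> = qconst (1 / (fact n * of_nat k ^ n) * of_nat (fact n * k ^ n)) *
        schur_prod (R d) vs ?\<rho> g"
      by (simp only: qconst_mult qconst_of_nat mult.assoc)
    also have "1 / (fact n * of_nat k ^ n) * of_nat (fact n * k ^ n) = (1 :: complex)"
      using assms(4) by simp
    also have "qconst 1 * schur_prod (R d) vs ?\<rho> g =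
        (\<Sum>T\<in>SSYT k (R d) coord_sum g (polytope_colors P n d). tableau_weight k ?\<rho> g T)"
      unfolding all by (subst sum_SSYT[OF fin assms(3) g conjunct2[OF vs]]) simp
    finally show "fps_nth (class_inner k n (bigraded_char a n (poly_algebra P n)) (irr_char g)) d =
        fps_nth (Abs_fps (\<lambda>d. \<Sum>T\<in>SSYT k (R d) coord_sum g (polytope_colors P n d).
          tableau_weight k ?\<rho> g T)) d"
      by simp
  qed
  then show ?thesis
    using bi color by auto
qed

end
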